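(* Let $(X,\sigma)$ and $(Y,\tau)$ be multivariable dynamical systems, each with $n$ maps. Then any algebra isomorphism $\gamma$ of the tensor algebra $\mathcal{A}(X,\sigma)$ onto the tensor algebra $\mathcal{A}(Y,\tau)$, or of the semicrossed product $\mathrm{C}_0(X)\times_\sigma\mathbb{F}_n^+$ onto the semicrossed product $\mathrm{C}_0(Y)\times_\tau\mathbb{F}_n^+$, is automatically continuous.
   Context: Fix $n\ge 1$. A multivariable dynamical system $(X,\sigma)$ is a locally compact Hausdorff space $X$ with $n$ proper continuous maps $\sigma=(\sigma_1,\dots,\sigma_n)$ of $X$ into itself. $\mathbb{F}_n^+$ is the free semigroup of words in $\{1,\dots,n\}$ with the empty word as unit; for $w=i_k\cdots i_1$ and operators $A_1,\dots,A_n$ put $A_w=A_{i_k}\cdots A_{i_1}$. The covariance algebra $\mathcal{A}_0(X,\sigma)$ is the algebra of finite formal sums $\sum_w \mathfrak{s}_w f_w$ ($w\in\mathbb{F}_n^+$, $f_w\in \mathrm{C}_0(X)$), with multiplication determined by $f\mathfrak{s}_i=\mathfrak{s}_i(f\circ\sigma_i)$. A covariant representation $(\pi,A)$ on a Hilbert space consists of a $*$-representation $\pi$ of $\mathrm{C}_0(X)$ and operators $A_1,\dots,A_n$ with $\pi(f)A_i=A_i\pi(f\circ\sigma_i)$; it sends $\sum \mathfrak{s}_wf_w$ to $\sum A_w\pi(f_w)$. The tensor algebra $\mathcal{A}(X,\sigma)$ is the operator algebra obtained by completing $\mathcal{A}_0(X,\sigma)$ in the (matrix) norms given by the supremum over all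 covariant representations that are row contractive, $\|[A_1\ \cdots\ A_n]\|\le1$. The semicrossed product $\mathrm{C}_0(X)\times_\sigma\mathbb{F}_n^+$ is the completion obtained using instead all covariant representations with $\|A_i\|\le1$ for each $i$. *)

theory Defs
  imports "HOL-Analysis.Analysis" "HOL-Library.Function_Algebras"
begin

section \<open>Multivariable dynamical systems\<close>

text \<open>The number of maps is the cardinality of the (nonempty) finite index type \<open>'n\<close>; words are
  lists over \<open>'n\<close>, and \<open>w = i\<^sub>k \<cdots> i\<^sub>1\<close> is the list \<open>[i\<^sub>k, \<dots>, i\<^sub>1]\<close>.\<close>

definition multivariable_system :: "'a topology \<Rightarrow> ('n::finite \<Rightarrow> 'a \<Rightarrow> 'a) \<Rightarrow> bool" where
  "multivariable_system X \<sigma> \<longleftrightarrow>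
     locally_compact_space X \<and> Hausdorff_space X \<and>
     (\<forall>i. continuous_map X X (\<sigma> i) \<and> proper_map X X (\<sigma> i))"

primrec comp_word :: "('n \<Rightarrow> 'c \<Rightarrow> 'c) \<Rightarrow> 'n list \<Rightarrow> 'c \<Rightarrow> 'c" where
  "comp_word A [] = id"
| "comp_word A (i # w) = A i \<circ> comp_word A w"

text \<open>Functions on \<open>topspace X\<close> are represented by their extension by zero, so that equality of
  elements of \<open>C0 X\<close> is equality in \<open>'a \<Rightarrow> complex\<close>.\<close>

definition C0 :: "'a topology \<Rightarrow> ('a \<Rightarrow> complex) set" where
  "C0 X = {f. continuous_map X euclidean f \<and>
              (\<forall>\<epsilon>>0. \<exists>K. compactin X K \<and> (\<forall>x \<in> topspace X - K. cmod (f x) < \<epsilon>)) \<and>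
              (\<forall>x. x \<notin> topspace X \<longrightarrow> f x = 0)}"

definition pullback :: "'a topology \<Rightarrow> ('a \<Rightarrow> 'a) \<Rightarrow> ('a \<Rightarrow> complex) \<Rightarrow> 'a \<Rightarrow> complex" where
  "pullback X h f = (\<lambda>x. if x \<in> topspace X then f (h x) else 0)"


section \<open>Hilbert spaces and covariant representations\<close>

definition hnorm :: "('v \<Rightarrow> 'v \<Rightarrow> complex) \<Rightarrow> 'v \<Rightarrow> real" where
  "hnorm ip x = sqrt (Re (ip x x))"

text \<open>A Hilbert space is a linear subspace \<open>H\<close> of some complex vector space with a complete inner
  product on \<open>H\<close>; no topology on the ambient space is involved.\<close>

locale complex_hilbert_space = vector_space sc
  for sc :: "complex \<Rightarrow> 'v::ab_group_add \<Rightarrow> 'v" +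
  fixes H :: "'v set" and ip :: "'v \<Rightarrow> 'v \<Rightarrow> complex"
  assumes subspace_H: "module.subspace sc H"
    and ip_add: "\<lbrakk>x \<in> H; y \<in> H; z \<in> H\<rbrakk> \<Longrightarrow> ip (x + y) z = ip x z + ip y z"
    and ip_scale: "\<lbrakk>x \<in> H; y \<in> H\<rbrakk> \<Longrightarrow> ip (sc c x) y = c * ip x y"
    and ip_commute: "\<lbrakk>x \<in> H; y \<in> H\<rbrakk> \<Longrightarrow> ip y x = cnj (ip x y)"
    and ip_nonneg: "x \<in> H \<Longrightarrow> 0 \<le> Re (ip x x)"
    and ip_definite: "\<lbrakk>x \<in> H; ip x x = 0\<rbrakk> \<Longrightarrow> x = 0"
    and complete_H:
      "\<lbrakk>range s \<subseteq> H; \<forall>\<epsilon>>0. \<exists>N. \<forall>j\<ge>N. \<forall>k\<ge>N. hnorm ip (s j - s k) < \<epsilon>\<rbrakk>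
        \<Longrightarrow> \<exists>l\<in>H. (\<lambda>k. hnorm ip (s k - l)) \<longlonglongrightarrow> 0"

definition bounded_operator ::
    "(complex \<Rightarrow> 'v::ab_group_add \<Rightarrow> 'v) \<Rightarrow> 'v set \<Rightarrow> ('v \<Rightarrow> 'v \<Rightarrow> complex) \<Rightarrow> ('v \<Rightarrow> 'v) \<Rightarrow> bool" where
  "bounded_operator sc H ip T \<longleftrightarrow>
     (\<forall>x\<in>H. T x \<in> H) \<and>
     (\<forall>x\<in>H. \<forall>y\<in>H. T (x + y) = T x + T y) \<and>
     (\<forall>c. \<forall>x\<in>H. T (sc c x) = sc c (T x)) \<and>
     (\<exists>B. \<forall>x\<in>H. hnorm ip (T x) \<le> B * hnorm ip x)"

definition opnorm :: "'v set \<Rightarrow> ('v \<Rightarrow> 'v \<Rightarrow> complex) \<Rightarrow> ('v \<Rightarrow> 'v) \<Rightarrow> real" where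
  "opnorm H ip T = Sup {hnorm ip (T x) |x. x \<in> H \<and> hnorm ip x \<le> 1}"

locale covariant_representation = complex_hilbert_space sc H ip
  for sc :: "complex \<Rightarrow> 'v::ab_group_add \<Rightarrow> 'v" and H and ip +
  fixes X :: "'a topology" and \<sigma> :: "'n::finite \<Rightarrow> 'a \<Rightarrow> 'a"
    and \<pi> :: "('a \<Rightarrow> complex) \<Rightarrow> 'v \<Rightarrow> 'v" and A :: "'n \<Rightarrow> 'v \<Rightarrow> 'v"
  assumes rep_bounded: "f \<in> C0 X \<Longrightarrow> bounded_operator sc H ip (\<pi> f)"
    and rep_add: "\<lbrakk>f \<in> C0 X; g \<in> C0 X; x \<in> H\<rbrakk> \<Longrightarrow> \<pi> (f + g) x = \<pi> f x + \<pi> g x"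
    and rep_scale: "\<lbrakk>f \<in> C0 X; x \<in> H\<rbrakk> \<Longrightarrow> \<pi> (\<lambda>t. c * f t) x = sc c (\<pi> f x)"
    and rep_mult: "\<lbrakk>f \<in> C0 X; g \<in> C0 X; x \<in> H\<rbrakk> \<Longrightarrow> \<pi> (f * g) x = \<pi> f (\<pi> g x)"
    and rep_star: "\<lbrakk>f \<in> C0 X; x \<in> H; y \<in> H\<rbrakk> \<Longrightarrow> ip (\<pi> f x) y = ip x (\<pi> (\<lambda>t. cnj (f t)) y)"
    and A_bounded: "bounded_operator sc H ip (A i)"
    and covariance: "\<lbrakk>f \<in> C0 X; x \<in> H\<rbrakk> \<Longrightarrow> \<pi> f (A i x) = A i (\<pi> (pullback X (\<sigma> i) f) x)"

definition row_contractive ::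
    "'v::ab_group_add set \<Rightarrow> ('v \<Rightarrow> 'v \<Rightarrow> complex) \<Rightarrow> ('n::finite \<Rightarrow> 'v \<Rightarrow> 'v) \<Rightarrow> bool" where
  "row_contractive H ip A \<longleftrightarrow>
     (\<forall>x. range x \<subseteq> H \<longrightarrow> (hnorm ip (\<Sum>i\<in>UNIV. A i (x i)))\<^sup>2 \<le> (\<Sum>i\<in>UNIV. (hnorm ip (x i))\<^sup>2))"

definition contractive ::
    "'v set \<Rightarrow> ('v \<Rightarrow> 'v \<Rightarrow> complex) \<Rightarrow> ('n::finite \<Rightarrow> 'v \<Rightarrow> 'v) \<Rightarrow> bool" where
  "contractive H ip A \<longleftrightarrow> (\<forall>i. \<forall>x\<in>H. hnorm ip (A i x) \<le> hnorm ip x)"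


section \<open>The covariance algebra\<close>

text \<open>The formal sum \<open>\<Sum>\<^sub>w s\<^sub>w f\<^sub>w\<close> is the function \<open>w \<mapsto> f\<^sub>w\<close>. The product comes from
  \<open>(s\<^sub>v f) (s\<^sub>w g) = s\<^sub>v\<^sub>w (f \<circ> \<sigma>\<^sub>w) g\<close>, with \<open>v\<close>, \<open>w\<close> running over the factorisations of a word.\<close>

definition cov_carrier :: "'a topology \<Rightarrow> ('n list \<Rightarrow> 'a \<Rightarrow> complex) set" where
  "cov_carrier X = {F. finite {w. F w \<noteq> 0} \<and> (\<forall>w. F w \<in> C0 X)}"

definition cov_mult :: "'a topology \<Rightarrow> ('n \<Rightarrow> 'a \<Rightarrow> 'a) \<Rightarrow>
    ('n list \<Rightarrow> 'a \<Rightarrow> complex) \<Rightarrow> ('n list \<Rightarrow> 'a \<Rightarrow> complex) \<Rightarrow> 'n list \<Rightarrow> 'a \<Rightarrow> complex" where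
  "cov_mult X \<sigma> F G = (\<lambda>u. \<Sum>k\<le>length u.
     pullback X (comp_word \<sigma> (drop k u)) (F (take k u)) * G (drop k u))"

definition rep_apply :: "(('a \<Rightarrow> complex) \<Rightarrow> 'v \<Rightarrow> 'v) \<Rightarrow> ('n \<Rightarrow> 'v \<Rightarrow> 'v) \<Rightarrow>
    ('n list \<Rightarrow> 'a \<Rightarrow> complex) \<Rightarrow> 'v \<Rightarrow> 'v::ab_group_add" where
  "rep_apply \<pi> A F x = (\<Sum>w | F w \<noteq> 0. comp_word A w (\<pi> (F w) x))"

text \<open>HOL cannot quantify over all types inside a definition, so the suprema below range over the
  Hilbert spaces inside one fixed complex vector space of functions. Nothing is lost: the norm of
  a representation is the supremum of the norms of its restrictions to the invariant subspaces
  generated by one vector \<open>x\<close>. Such a subspace is the closed linear span of the vectors \<open>A\<^sub>w x\<close> and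
  \<open>A\<^sub>w \<pi>(f) x\<close>, and mapping \<open>y\<close> to its inner products with these vectors embeds it linearly into
  \<open>repspace\<close>. The lemmas \<open>tensor_norm_universal\<close> and \<open>semicrossed_norm_universal\<close> below state
  that representations on Hilbert spaces over an arbitrary type obey the norms defined here.\<close>

type_synonym ('a, 'n) repspace = "'n list \<times> ('a \<Rightarrow> complex) option \<Rightarrow> complex"

definition fscale :: "complex \<Rightarrow> ('j \<Rightarrow> complex) \<Rightarrow> 'j \<Rightarrow> complex" where
  "fscale c u = (\<lambda>j. c * u j)"

definition tensor_norm ::
    "'a topology \<Rightarrow> ('n::finite \<Rightarrow> 'a \<Rightarrow> 'a) \<Rightarrow> ('n list \<Rightarrow> 'a \<Rightarrow> complex) \<Rightarrow> real" where
  "tensor_norm X \<sigma> F = Sup {opnorm H ip (rep_apply \<pi> A F) |(H :: ('a, 'n) repspace set) ip \<pi> A.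
     covariant_representation fscale H ip X \<sigma> \<pi> A \<and> row_contractive H ip A}"

definition semicrossed_norm ::
    "'a topology \<Rightarrow> ('n::finite \<Rightarrow> 'a \<Rightarrow> 'a) \<Rightarrow> ('n list \<Rightarrow> 'a \<Rightarrow> complex) \<Rightarrow> real" where
  "semicrossed_norm X \<sigma> F = Sup {opnorm H ip (rep_apply \<pi> A F) |(H :: ('a, 'n) repspace set) ip \<pi> A.
     covariant_representation fscale H ip X \<sigma> \<pi> A \<and> contractive H ip A}"


section \<open>Normed algebras and their completions\<close>

text \<open>Complex algebras, not necessarily unital, with a seminorm.\<close>

record 'c normed_alg =
  acarrier :: "'c set"
  aadd :: "'c \<Rightarrow> 'c \<Rightarrow> 'c"
  ascale :: "complex \<Rightarrow> 'c \<Rightarrow> 'c"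
  amult :: "'c \<Rightarrow> 'c \<Rightarrow> 'c"
  anorm :: "'c \<Rightarrow> real"

text \<open>The value off the carrier is irrelevant; zero makes \<open>adist\<close> a metric in the sense of
  \<^locale>\<open>Metric_space\<close>, which asks for symmetry and nonnegativity everywhere.\<close>

definition adist :: "'c normed_alg \<Rightarrow> 'c \<Rightarrow> 'c \<Rightarrow> real" where
  "adist R x y = (if x \<in> acarrier R \<and> y \<in> acarrier R
                  then anorm R (aadd R x (ascale R (- 1) y)) else 0)"

definition norm_topology :: "'c normed_alg \<Rightarrow> 'c topology" where
  "norm_topology R = Metric_space.mtopology (acarrier R) (adist R)"

definition cauchy_seqs :: "'c normed_alg \<Rightarrow> (nat \<Rightarrow> 'c) set" where
  "cauchy_seqs R = {s. range s \<subseteq> acarrier R \<and>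
     (\<forall>\<epsilon>>0. \<exists>N. \<forall>j\<ge>N. \<forall>k\<ge>N. adist R (s j) (s k) < \<epsilon>)}"

definition null_rel :: "'c normed_alg \<Rightarrow> ((nat \<Rightarrow> 'c) \<times> (nat \<Rightarrow> 'c)) set" where
  "null_rel R = {(s, t). s \<in> cauchy_seqs R \<and> t \<in> cauchy_seqs R \<and>
     (\<lambda>k. adist R (s k) (t k)) \<longlonglongrightarrow> 0}"

definition completion :: "'c normed_alg \<Rightarrow> (nat \<Rightarrow> 'c) set normed_alg" where
  "completion R = \<lparr>
     acarrier = cauchy_seqs R // null_rel R,
     aadd = (\<lambda>P Q. \<Union>s\<in>P. \<Union>t\<in>Q. null_rel R `` {\<lambda>k. aadd R (s k) (t k)}),
     ascale = (\<lambda>c P. \<Union>s\<in>P. null_rel R `` {\<lambda>k. ascale R c (s k)}),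
     amult = (\<lambda>P Q. \<Union>s\<in>P. \<Union>t\<in>Q. null_rel R `` {\<lambda>k. amult R (s k) (t k)}),
     anorm = (\<lambda>P. THE r. \<forall>s\<in>P. (\<lambda>k. anorm R (s k)) \<longlonglongrightarrow> r)\<rparr>"

definition algebra_isomorphism :: "'c normed_alg \<Rightarrow> 'd normed_alg \<Rightarrow> ('c \<Rightarrow> 'd) \<Rightarrow> bool" where
  "algebra_isomorphism R S \<gamma> \<longleftrightarrow>
     bij_betw \<gamma> (acarrier R) (acarrier S) \<and>
     (\<forall>x\<in>acarrier R. \<forall>y\<in>acarrier R. \<gamma> (aadd R x y) = aadd S (\<gamma> x) (\<gamma> y)) \<and>
     (\<forall>c. \<forall>x\<in>acarrier R. \<gamma> (ascale R c x) = ascale S c (\<gamma> x)) \<and>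
     (\<forall>x\<in>acarrier R. \<forall>y\<in>acarrier R. \<gamma> (amult R x y) = amult S (\<gamma> x) (\<gamma> y))"


section \<open>The two operator algebras\<close>

text \<open>Only the norm at the first matrix level is recorded: the higher matrix norms affect neither
  the algebra nor its topology.\<close>

definition covariance_algebra :: "'a topology \<Rightarrow> ('n \<Rightarrow> 'a \<Rightarrow> 'a) \<Rightarrow>
    (('n list \<Rightarrow> 'a \<Rightarrow> complex) \<Rightarrow> real) \<Rightarrow> ('n list \<Rightarrow> 'a \<Rightarrow> complex) normed_alg" where
  "covariance_algebra X \<sigma> N = \<lparr>
     acarrier = cov_carrier X,
     aadd = (\<lambda>F G. F + G),
     ascale = (\<lambda>c F w t. c * F w t),
     amult = cov_mult X \<sigma>,
     anorm = N\<rparr>"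

definition tensor_algebra :: "'a topology \<Rightarrow> ('n::finite \<Rightarrow> 'a \<Rightarrow> 'a) \<Rightarrow>
    (nat \<Rightarrow> 'n list \<Rightarrow> 'a \<Rightarrow> complex) set normed_alg" where
  "tensor_algebra X \<sigma> = completion (covariance_algebra X \<sigma> (tensor_norm X \<sigma>))"

definition semicrossed_product :: "'a topology \<Rightarrow> ('n::finite \<Rightarrow> 'a \<Rightarrow> 'a) \<Rightarrow>
    (nat \<Rightarrow> 'n list \<Rightarrow> 'a \<Rightarrow> complex) set normed_alg" where
  "semicrossed_product X \<sigma> = completion (covariance_algebra X \<sigma> (semicrossed_norm X \<sigma>))"


section \<open>Independence of the norms from the choice of \<open>repspace\<close>\<close>

context complex_hilbert_space
begin

lemma zero_in: "0 \<in> H" using subspace_H by (rule subspace_0)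
lemma add_in: "x \<in> H \<Longrightarrow> y \<in> H \<Longrightarrow> x + y \<in> H" using subspace_H by (rule subspace_add)
lemma scale_in: "x \<in> H \<Longrightarrow> sc c x \<in> H" using subspace_H by (rule subspace_scale)
lemma diff_in: "x \<in> H \<Longrightarrow> y \<in> H \<Longrightarrow> x - y \<in> H" using subspace_H by (rule subspace_diff)

lemma ip_add_right: "\<lbrakk>x \<in> H; y \<in> H; z \<in> H\<rbrakk> \<Longrightarrow> ip z (x + y) = ip z x + ip z y"
  by (metis add_in ip_add ip_commute complex_cnj_add)

lemma ip_scale_right: "\<lbrakk>x \<in> H; y \<in> H\<rbrakk> \<Longrightarrow> ip y (sc c x) = cnj c * ip y x"
  by (metis scale_in ip_scale ip_commute complex_cnj_mult)

lemma ip_zero: "y \<in> H \<Longrightarrow> ip 0 y = 0" "y \<in> H \<Longrightarrow> ip y 0 = 0"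
  using ip_scale[of y y 0] ip_scale_right[of y y 0] by auto

lemma ip_minus: "\<lbrakk>x \<in> H; y \<in> H\<rbrakk> \<Longrightarrow> ip (- x) y = - ip x y" "\<lbrakk>x \<in> H; y \<in> H\<rbrakk> \<Longrightarrow> ip y (- x) = - ip y x"
  using ip_scale[of x y "-1"] ip_scale_right[of x y "-1"] by auto

lemma ip_diff: "\<lbrakk>x \<in> H; y \<in> H; z \<in> H\<rbrakk> \<Longrightarrow> ip (x - y) z = ip x z - ip y z"
  using ip_add[of x "- y" z] ip_minus[of y z] scale_in[of y "-1"] by auto

lemma ip_diff_right: "\<lbrakk>x \<in> H; y \<in> H; z \<in> H\<rbrakk> \<Longrightarrow> ip z (x - y) = ip z x - ip z y"
  using ip_add_right[of x "- y" z] ip_minus[of y z] scale_in[of y "-1"] by auto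

lemma ip_self: "x \<in> H \<Longrightarrow> ip x x = of_real ((hnorm ip x)\<^sup>2)"
  using ip_commute[of x x] ip_nonneg[of x] by (auto simp: complex_eq_iff hnorm_def)

lemma hnorm_nonneg: "x \<in> H \<Longrightarrow> 0 \<le> hnorm ip x"
  by (simp add: hnorm_def ip_nonneg)

lemma hnorm_zero: "hnorm ip 0 = 0" by (simp add: hnorm_def ip_zero zero_in)

lemma hnorm_eq_0: "x \<in> H \<Longrightarrow> hnorm ip x = 0 \<Longrightarrow> x = 0"
  using ip_self ip_definite by fastforce

lemma hnorm_scale: "x \<in> H \<Longrightarrow> hnorm ip (sc c x) = cmod c * hnorm ip x"
proof -
  assume x: "x \<in> H"
  have "of_real ((hnorm ip (sc c x))\<^sup>2) = (of_real ((cmod c * hnorm ip x)\<^sup>2) :: complex)"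
    using x by (simp add: ip_self[symmetric] scale_in ip_scale ip_scale_right power_mult_distrib
        complex_norm_square del: of_real_power)
  then have "(hnorm ip (sc c x))\<^sup>2 = (cmod c * hnorm ip x)\<^sup>2" by (simp only: of_real_eq_iff)
  then show ?thesis using x by (simp add: hnorm_nonneg scale_in)
qed

lemma cauchy_schwarz: assumes x: "x \<in> H" and y: "y \<in> H"
  shows "cmod (ip x y) \<le> hnorm ip x * hnorm ip y"
proof (cases "hnorm ip y = 0")
  case True then have "y = 0" using hnorm_eq_0 y by auto
  then show ?thesis using x by (simp add: ip_zero hnorm_zero)
next
  case False
  let ?n = "(hnorm ip y)\<^sup>2"
  define c where "c = ip x y / of_real ?n"
  have yy: "ip y y = of_real ?n" using ip_self y by blast
  have n: "?n \<noteq> 0" using False by simp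
  have cy: "sc c y \<in> H" "x - sc c y \<in> H" using x y by (auto simp: scale_in diff_in)
  have 1: "ip x (sc c y) = of_real ((cmod (ip x y))\<^sup>2 / ?n)"
    using x y by (simp add: ip_scale_right c_def complex_norm_square[symmetric] mult.commute[of "cnj _"] del: of_real_power)
  have 2: "ip (sc c y) (sc c y) = of_real ((cmod (ip x y))\<^sup>2 / ?n)"
    using x y n complex_norm_square[of "ip x y"]
    by (simp add: ip_scale ip_scale_right scale_in yy c_def power2_eq_square mult.commute)
  have 3: "ip (sc c y) x = of_real ((cmod (ip x y))\<^sup>2 / ?n)"
    using ip_commute[OF x cy(1)] 1 by simp
  have "ip (x - sc c y) (x - sc c y) = of_real ((hnorm ip x)\<^sup>2 - (cmod (ip x y))\<^sup>2 / ?n)"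
    using x y cy by (simp add: ip_diff ip_diff_right 1 2 3 ip_self[OF x])
  then have "0 \<le> (hnorm ip x)\<^sup>2 - (cmod (ip x y))\<^sup>2 / ?n" using ip_nonneg[OF cy(2)] by simp
  then have "(cmod (ip x y))\<^sup>2 \<le> (hnorm ip x * hnorm ip y)\<^sup>2"
    using n by (simp add: field_simps)
  then show ?thesis by (rule power2_le_imp_le) (simp add: x y hnorm_nonneg)
qed

lemma hnorm_triangle: assumes x: "x \<in> H" and y: "y \<in> H"
  shows "hnorm ip (x + y) \<le> hnorm ip x + hnorm ip y"
proof -
  have c: "ip y x = cnj (ip x y)" using ip_commute x y by blast
  have "of_real ((hnorm ip (x + y))\<^sup>2) = ip (x + y) (x + y)" using x y by (simp add: ip_self add_in)
  also have "\<dots> = ip x x + ip y y + (ip x y + cnj (ip x y))"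
    using x y by (simp add: ip_add ip_add_right add_in c)
  also have "\<dots> = of_real ((hnorm ip x)\<^sup>2 + (hnorm ip y)\<^sup>2 + 2 * Re (ip x y))"
    using x y by (simp add: ip_self complex_add_cnj)
  finally have "(hnorm ip (x + y))\<^sup>2 = (hnorm ip x)\<^sup>2 + (hnorm ip y)\<^sup>2 + 2 * Re (ip x y)"
    by (simp only: of_real_eq_iff)
  also have "\<dots> \<le> (hnorm ip x + hnorm ip y)\<^sup>2"
    using cauchy_schwarz[OF x y] complex_Re_le_cmod[of "ip x y"] by (simp add: power2_sum)
  finally show ?thesis by (rule power2_le_imp_le) (simp add: x y hnorm_nonneg)
qed

lemma hnorm_sum: "(\<And>i. i \<in> I \<Longrightarrow> x i \<in> H) \<Longrightarrow> hnorm ip (sum x I) \<le> (\<Sum>i\<in>I. hnorm ip (x i))"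
proof (induction I rule: infinite_finite_induct)
  case (insert i I)
  have "sum x I \<in> H" by (rule subspace_sum[OF subspace_H]) (use insert in auto)
  then have "hnorm ip (x i + sum x I) \<le> hnorm ip (x i) + hnorm ip (sum x I)"
    using insert hnorm_triangle by auto
  then show ?case using insert by auto
qed (auto simp: hnorm_zero)

lemma complex_hilbert_space_closed_subspace:
  assumes "K \<subseteq> H" "subspace K"
    and closed: "\<And>s l. \<lbrakk>range s \<subseteq> K; l \<in> H; (\<lambda>k. hnorm ip (s k - l)) \<longlonglongrightarrow> 0\<rbrakk> \<Longrightarrow> l \<in> K"
  shows "complex_hilbert_space sc K ip"
proof (intro complex_hilbert_space.intro complex_hilbert_space_axioms.intro)
  show "vector_space sc" by (rule vector_space_axioms)
  fix s :: "nat \<Rightarrow> 'v" assume s: "range s \<subseteq> K"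
    and "\<forall>\<epsilon>>0. \<exists>N. \<forall>j\<ge>N. \<forall>k\<ge>N. hnorm ip (s j - s k) < \<epsilon>"
  then obtain l where "l \<in> H" "(\<lambda>k. hnorm ip (s k - l)) \<longlonglongrightarrow> 0"
    using complete_H[of s] assms(1) by blast
  then show "\<exists>l\<in>K. (\<lambda>k. hnorm ip (s k - l)) \<longlonglongrightarrow> 0" using closed s by blast
qed (use assms(1,2) in \<open>auto simp: ip_add ip_scale ip_nonneg ip_definite subset_eq intro: ip_commute\<close>)

definition closed_span :: "'v set \<Rightarrow> 'v set" where
  "closed_span E = {y \<in> H. \<forall>\<epsilon>>0. \<exists>z\<in>span E. hnorm ip (y - z) < \<epsilon>}"

lemma span_in: "E \<subseteq> H \<Longrightarrow> z \<in> span E \<Longrightarrow> z \<in> H"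
  using span_minimal[OF _ subspace_H] by blast

lemma closed_spanE:
  assumes "y \<in> closed_span E" "\<epsilon> > 0"
  obtains z where "z \<in> span E" "hnorm ip (y - z) < \<epsilon>"
  using assms by (auto simp: closed_span_def)

lemma span_closed_span: "E \<subseteq> H \<Longrightarrow> z \<in> span E \<Longrightarrow> z \<in> closed_span E"
  unfolding closed_span_def using span_in hnorm_zero by (auto intro!: bexI[of _ z])

lemma bounded_operator_pos:
  assumes "bounded_operator sc H ip T"
  obtains B where "B > 0" "\<And>x. x \<in> H \<Longrightarrow> hnorm ip (T x) \<le> B * hnorm ip x"
proof -
  obtain B where B: "\<And>x. x \<in> H \<Longrightarrow> hnorm ip (T x) \<le> B * hnorm ip x"
    using assms unfolding bounded_operator_def by blast
  have "hnorm ip (T x) \<le> (\<bar>B\<bar> + 1) * hnorm ip x" if "x \<in> H" for x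
    using B[OF that] mult_right_mono[of B "\<bar>B\<bar> + 1" "hnorm ip x"] hnorm_nonneg[OF that] by linarith
  then show thesis using that[of "\<bar>B\<bar> + 1"] by auto
qed

lemma bounded_operator_lin:
  assumes "bounded_operator sc H ip T"
  shows "x \<in> H \<Longrightarrow> T x \<in> H" "\<lbrakk>x \<in> H; y \<in> H\<rbrakk> \<Longrightarrow> T (x + y) = T x + T y"
    "x \<in> H \<Longrightarrow> T (sc c x) = sc c (T x)" "T 0 = 0" "\<lbrakk>x \<in> H; y \<in> H\<rbrakk> \<Longrightarrow> T (x - y) = T x - T y"
proof -
  have a: "T x \<in> H" "T (sc c x) = sc c (T x)" if "x \<in> H" for x c
    using assms that by (auto simp: bounded_operator_def)
  have b: "T (x + y) = T x + T y" if "x \<in> H" "y \<in> H" for x y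
    using assms that by (auto simp: bounded_operator_def)
  show "x \<in> H \<Longrightarrow> T x \<in> H" "\<lbrakk>x \<in> H; y \<in> H\<rbrakk> \<Longrightarrow> T (x + y) = T x + T y"
    "x \<in> H \<Longrightarrow> T (sc c x) = sc c (T x)" using a b by auto
  show "T 0 = 0" using a(2)[OF zero_in, of 0] by simp
  show "T (x - y) = T x - T y" if "x \<in> H" "y \<in> H"
    using b[of x "sc (-1) y"] a(2)[of y "-1"] that scale_in[of y "-1"] by simp
qed

lemma closed_span_props:
  assumes E: "E \<subseteq> H"
  shows "closed_span E \<subseteq> H" "subspace (closed_span E)"
    "\<And>s l. \<lbrakk>range s \<subseteq> closed_span E; l \<in> H; (\<lambda>k. hnorm ip (s k - l)) \<longlonglongrightarrow> 0\<rbrakk> \<Longrightarrow> l \<in> closed_span E"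
    "\<lbrakk>bounded_operator sc H ip T; \<And>e. e \<in> E \<Longrightarrow> T e \<in> span E; y \<in> closed_span E\<rbrakk>
      \<Longrightarrow> T y \<in> closed_span E"
    "\<lbrakk>y \<in> closed_span E; \<And>e. e \<in> E \<Longrightarrow> ip y e = 0\<rbrakk> \<Longrightarrow> y = 0"
proof -
  let ?K = "closed_span E"
  show sub: "?K \<subseteq> H" by (auto simp: closed_span_def)
  show "subspace ?K"
  proof (rule subspaceI)
    show "0 \<in> ?K" by (rule span_closed_span[OF E span_zero])
  next
    fix x y assume x: "x \<in> ?K" and y: "y \<in> ?K"
    have "\<exists>z\<in>span E. hnorm ip (x + y - z) < \<epsilon>" if "\<epsilon> > 0" for \<epsilon>
    proof -
      obtain a b where ab: "a \<in> span E" "b \<in> span E" "hnorm ip (x - a) < \<epsilon>/2" "hnorm ip (y - b) < \<epsilon>/2"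
        using closed_spanE[OF x half_gt_zero[OF \<open>\<epsilon> > 0\<close>]] closed_spanE[OF y half_gt_zero[OF \<open>\<epsilon> > 0\<close>]] by metis
      have "hnorm ip ((x - a) + (y - b)) \<le> hnorm ip (x - a) + hnorm ip (y - b)"
        using x y ab E sub by (intro hnorm_triangle diff_in) (auto intro: span_in)
      then have "hnorm ip ((x + y) - (a + b)) < \<epsilon>" using ab by (simp add: algebra_simps)
      then show ?thesis using ab span_add by blast
    qed
    then show "x + y \<in> ?K" using x y add_in by (auto simp: closed_span_def)
  next
    fix c x assume x: "x \<in> ?K"
    have "\<exists>z\<in>span E. hnorm ip (sc c x - z) < \<epsilon>" if "\<epsilon> > 0" for \<epsilon>
    proof -
      have "\<epsilon> / (cmod c + 1) > 0" using that by (simp add: add_nonneg_pos)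
      then obtain a where a: "a \<in> span E" "hnorm ip (x - a) < \<epsilon> / (cmod c + 1)"
        using closed_spanE[OF x] by metis
      have xa: "x - a \<in> H" by (rule diff_in) (use x a E sub span_in in blast)+
      have "hnorm ip (sc c x - sc c a) = cmod c * hnorm ip (x - a)"
        using hnorm_scale[OF xa, of c] by (simp add: scale_right_diff_distrib)
      also have "\<dots> \<le> (cmod c + 1) * hnorm ip (x - a)"
        using hnorm_nonneg[OF xa] by (intro mult_right_mono) auto
      also have "\<dots> < \<epsilon>"
        using a(2) by (subst (asm) pos_less_divide_eq) (auto simp: mult.commute add_nonneg_pos)
      finally show ?thesis using a span_scale by blast
    qed
    then show "sc c x \<in> ?K" using x scale_in by (auto simp: closed_span_def)
  qed
  show "l \<in> ?K" if s: "range s \<subseteq> ?K" and l: "l \<in> H" and lim: "(\<lambda>k. hnorm ip (s k - l)) \<longlonglongrightarrow> 0" for s l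
  proof -
    have "\<exists>z\<in>span E. hnorm ip (l - z) < \<epsilon>" if "\<epsilon> > 0" for \<epsilon>
    proof -
      obtain k where k: "\<bar>hnorm ip (s k - l)\<bar> < \<epsilon>/2"
        using LIMSEQ_D[OF lim, of "\<epsilon>/2"] \<open>\<epsilon> > 0\<close> by auto
      have sk: "s k \<in> ?K" using s by auto
      obtain a where a: "a \<in> span E" "hnorm ip (s k - a) < \<epsilon>/2"
        using closed_spanE[OF sk half_gt_zero[OF \<open>\<epsilon> > 0\<close>]] by metis
      have in_H: "s k - a \<in> H" "s k - l \<in> H" by (rule diff_in, use sk a E sub l span_in in blast, use sk a E sub l span_in in blast)+
      have "hnorm ip (sc (-1) (s k - l) + (s k - a)) \<le> hnorm ip (sc (-1) (s k - l)) + hnorm ip (s k - a)"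
        using in_H by (intro hnorm_triangle scale_in)
      then have "hnorm ip (l - a) < \<epsilon>" using k a(2) in_H by (simp add: hnorm_scale del: scale_minus_left) (simp add: algebra_simps)
      then show ?thesis using a by blast
    qed
    then show ?thesis using l by (auto simp: closed_span_def)
  qed
  show "T y \<in> ?K" if T: "bounded_operator sc H ip T" and TE: "\<And>e. e \<in> E \<Longrightarrow> T e \<in> span E" and y: "y \<in> ?K"
  proof -
    note lin = bounded_operator_lin[OF T]
    have Ts: "z \<in> H \<and> T z \<in> span E" if "z \<in> span E" for z
      using that
    proof (induction rule: span_induct)
      case base
      show ?case unfolding subspace_def
        by (auto simp: zero_in lin add_in scale_in intro: span_zero span_add span_scale)
    next
      case (step e) then show ?case using TE E by auto
    qed
    obtain B where B: "B > 0" "\<And>x. x \<in> H \<Longrightarrow> hnorm ip (T x) \<le> B * hnorm ip x"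
      using bounded_operator_pos[OF T] by blast
    have yH: "y \<in> H" using y sub by auto
    have "\<exists>z\<in>span E. hnorm ip (T y - z) < \<epsilon>" if "\<epsilon> > 0" for \<epsilon>
    proof -
      have "\<epsilon> / B > 0" using that B(1) by simp
      then obtain a where a: "a \<in> span E" "hnorm ip (y - a) < \<epsilon> / B"
        using closed_spanE[OF y] by metis
      have "a \<in> H" using Ts a by auto
      then have "hnorm ip (T y - T a) \<le> B * hnorm ip (y - a)" using B(2)[of "y - a"] yH by (simp add: lin diff_in)
      also have "\<dots> < \<epsilon>" using a B(1) by (simp add: field_simps)
      finally show ?thesis using Ts a by blast
    qed
    then show ?thesis using lin yH by (auto simp: closed_span_def)
  qed
  show "y = 0" if y: "y \<in> ?K" and z: "\<And>e. e \<in> E \<Longrightarrow> ip y e = 0"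
  proof (rule ccontr)
    assume "y \<noteq> 0"
    have yH: "y \<in> H" using y sub by auto
    have n: "hnorm ip y > 0" using hnorm_eq_0[OF yH] hnorm_nonneg[OF yH] \<open>y \<noteq> 0\<close> by fastforce
    then obtain a where a: "a \<in> span E" "hnorm ip (y - a) < hnorm ip y"
      using closed_spanE[OF y] by metis
    have "a \<in> H \<and> ip y a = 0" using a(1)
    proof (induction rule: span_induct)
      case base
      show ?case unfolding subspace_def
        by (auto simp: zero_in add_in scale_in ip_zero ip_add_right ip_scale_right yH)
    next
      case (step e) then show ?case using z E by auto
    qed
    then have "ip y (y - a) = of_real ((hnorm ip y)\<^sup>2)" using yH by (simp add: ip_diff_right ip_self)
    then have "(hnorm ip y)\<^sup>2 \<le> hnorm ip y * hnorm ip (y - a)"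
      using cauchy_schwarz[of y "y - a"] yH \<open>a \<in> H \<and> _\<close> by (simp add: diff_in norm_power)
    then show False using n a(2) by (simp add: power2_eq_square)
  qed
qed

end

lemma C0_vanish:
  assumes "f \<in> C0 X" "\<epsilon> > 0"
  obtains K where "compactin X K" "\<And>x. x \<in> topspace X - K \<Longrightarrow> cmod (f x) < \<epsilon>"
proof -
  have "\<exists>K. compactin X K \<and> (\<forall>x \<in> topspace X - K. cmod (f x) < \<epsilon>)"
    using assms by (simp add: C0_def)
  then show thesis using that by auto
qed

lemma C0_bounded:
  assumes "f \<in> C0 X" obtains M where "M > 0" "\<And>x. cmod (f x) \<le> M"
proof -
  obtain K where K: "compactin X K" "\<And>x. x \<in> topspace X - K \<Longrightarrow> cmod (f x) < 1"
    using C0_vanish[OF assms zero_less_one] by blast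
  have "compactin euclidean (f ` K)" by (rule image_compactin[OF K(1)]) (use assms in \<open>simp add: C0_def\<close>)
  then have "bounded (f ` K)" by (simp add: compact_imp_bounded)
  then obtain b where b: "\<And>x. x \<in> K \<Longrightarrow> cmod (f x) \<le> b" by (auto simp: bounded_iff)
  have "cmod (f x) \<le> max b 1" for x
  proof (cases "x \<in> topspace X")
    case True then show ?thesis using b[of x] K(2)[of x] by (cases "x \<in> K") auto
  next
    case False then show ?thesis using assms by (auto simp: C0_def)
  qed
  then show thesis using that[of "max b 1"] by auto
qed

lemma C0_dominated:
  assumes f: "f \<in> C0 X" and g: "continuous_map X euclidean g" and "M > 0"
    and le: "\<And>x. cmod (g x) \<le> M * cmod (f x)"
  shows "g \<in> C0 X"
  unfolding C0_def
proof (intro CollectI conjI allI impI)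
  fix \<epsilon> :: real assume "\<epsilon> > 0"
  then have "\<epsilon> / M > 0" using \<open>M > 0\<close> by simp
  then obtain K where K: "compactin X K" "\<And>x. x \<in> topspace X - K \<Longrightarrow> cmod (f x) < \<epsilon> / M"
    using C0_vanish[OF f] by blast
  have "cmod (g x) < \<epsilon>" if "x \<in> topspace X - K" for x
  proof -
    have "M * cmod (f x) < \<epsilon>" using K(2)[OF that] \<open>M > 0\<close> by (simp add: field_simps)
    then show ?thesis using le[of x] by linarith
  qed
  then show "\<exists>K. compactin X K \<and> (\<forall>x \<in> topspace X - K. cmod (g x) < \<epsilon>)" using K by blast
next
  fix x assume "x \<notin> topspace X"
  then have "f x = 0" using f by (simp add: C0_def)
  then show "g x = 0" using le[of x] by simp
qed (rule g)

lemma C0_cont: "f \<in> C0 X \<Longrightarrow> continuous_map X euclidean f" by (simp add: C0_def)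

lemma continuous_map_compose_euclidean:
  assumes "continuous_map X euclidean f" "continuous_on UNIV h"
  shows "continuous_map X euclidean (\<lambda>x. h (f x))"
  using continuous_map_compose[OF assms(1), of euclidean h] assms(2) by (simp add: o_def)

lemma C0_scale: assumes f: "f \<in> C0 X" shows "(\<lambda>t. c * f t) \<in> C0 X"
proof (rule C0_dominated[OF f])
  show "continuous_map X euclidean (\<lambda>t. c * f t)"
    by (rule continuous_map_compose_euclidean[OF C0_cont[OF f]]) (intro continuous_intros)
  show "0 < cmod c + 1" by (rule add_nonneg_pos) auto
  show "cmod (c * f x) \<le> (cmod c + 1) * cmod (f x)" for x by (simp add: norm_mult distrib_right)
qed

lemma C0_cnj: assumes f: "f \<in> C0 X" shows "(\<lambda>t. cnj (f t)) \<in> C0 X"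
proof (rule C0_dominated[OF f])
  show "continuous_map X euclidean (\<lambda>t. cnj (f t))"
    by (rule continuous_map_compose_euclidean[OF C0_cont[OF f]]) (intro continuous_intros)
qed (auto intro: zero_less_one)

lemma C0_mult: assumes f: "f \<in> C0 X" and g: "g \<in> C0 X" shows "f * g \<in> C0 X"
proof -
  obtain M where M: "M > 0" "\<And>x. cmod (f x) \<le> M" using C0_bounded[OF f] by blast
  have c: "continuous_map X (prod_topology euclidean euclidean) (\<lambda>x. (f x, g x))"
    using f g by (intro continuous_map_paired[THEN iffD2] conjI C0_cont)
  have "continuous_on UNIV (\<lambda>p::complex \<times> complex. fst p * snd p)" by (intro continuous_intros)
  then have "continuous_map X euclidean ((\<lambda>p. fst p * snd p) \<circ> (\<lambda>x. (f x, g x)))"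
    using c by (intro continuous_map_compose[OF c]) (simp add: euclidean_product_topology[symmetric])
  then have "continuous_map X euclidean (f * g)" by (simp add: o_def times_fun_def)
  then show ?thesis
    by (rule C0_dominated[OF g _ M(1)]) (auto simp: norm_mult M(2) intro: mult_right_mono)
qed

lemma C0_pullback:
  assumes f: "f \<in> C0 X" and h: "continuous_map X X h" "proper_map X X h"
  shows "pullback X h f \<in> C0 X"
  unfolding C0_def
proof (intro CollectI conjI allI impI)
  show "continuous_map X euclidean (pullback X h f)"
    by (rule continuous_map_eq[OF continuous_map_compose[OF h(1) C0_cont[OF f]]])
       (auto simp: pullback_def)
  fix \<epsilon> :: real assume "\<epsilon> > 0"
  then obtain K where K: "compactin X K" "\<And>x. x \<in> topspace X - K \<Longrightarrow> cmod (f x) < \<epsilon>"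
    using C0_vanish[OF f] by blast
  have "compactin X {x \<in> topspace X. h x \<in> K}"
    using h(2) K(1) by (simp add: proper_map_alt)
  moreover have "cmod (pullback X h f x) < \<epsilon>" if "x \<in> topspace X - {x \<in> topspace X. h x \<in> K}" for x
    using that K(2) h(1) by (auto simp: pullback_def continuous_map_def Pi_iff)
  ultimately show "\<exists>K. compactin X K \<and> (\<forall>x \<in> topspace X - K. cmod (pullback X h f x) < \<epsilon>)" by blast
qed (auto simp: pullback_def)

lemma C0_0: "0 \<in> C0 X"
  by (auto simp: C0_def zero_fun_def intro!: exI[of _ "{}"])

context covariant_representation
begin

lemma rep_contractive:
  assumes f: "f \<in> C0 X" and M: "M > 0" "\<And>t. cmod (f t) \<le> M" and x: "x \<in> H"
  shows "hnorm ip (\<pi> f x) \<le> M * hnorm ip x"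
proof -
  define h where "h t = complex_of_real (1 - sqrt (1 - (cmod (f t))\<^sup>2 / M\<^sup>2))" for t
  have r: "0 \<le> 1 - (cmod (f t))\<^sup>2 / M\<^sup>2" for t using M power_mono[OF M(2), of t 2] by (simp add: field_simps)
  have h_le: "cmod (h t) \<le> (1/M) * cmod (f t)" for t
  proof -
    define u where "u = cmod (f t) / M"
    have u: "0 \<le> u" "u \<le> 1" using M(1) M(2)[of t] by (auto simp: u_def field_simps)
    then have u2: "u\<^sup>2 \<le> 1" by (simp add: power_le_one)
    have "(1 - u)\<^sup>2 \<le> 1 - u\<^sup>2" using u mult_left_le[of u u] by (simp add: power2_eq_square algebra_simps)
    then have "1 - u \<le> sqrt (1 - u\<^sup>2)" by (rule real_le_rsqrt)
    moreover have "sqrt (1 - u\<^sup>2) \<le> 1" using u by (simp)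
    moreover have "h t = complex_of_real (1 - sqrt (1 - u\<^sup>2))" by (simp add: h_def u_def power_divide)
    ultimately show ?thesis by (simp add: u_def del: of_real_diff)
  qed
  have "continuous_map X euclidean h"
    unfolding h_def
    by (rule continuous_map_compose_euclidean[of X f "\<lambda>z. complex_of_real (1 - sqrt (1 - (cmod z)\<^sup>2 / M\<^sup>2))", OF C0_cont[OF f]],
        intro continuous_intros) (use M in auto)
  then have h: "h \<in> C0 X" using C0_dominated[OF f, of h "1/M"] h_le M(1) by auto
  let ?g = "(\<lambda>t. cnj (f t)) * f"
  have g: "?g \<in> C0 X" using f by (intro C0_mult C0_cnj)
  have hh: "h * h \<in> C0 X" using h by (intro C0_mult)
  have eq: "h * h + (\<lambda>t. of_real (1/M\<^sup>2) * ?g t) = (\<lambda>t. 2 * h t)"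
  proof
    fix t
    define q where "q = sqrt (1 - (cmod (f t))\<^sup>2 / M\<^sup>2)"
    have q: "q * q = 1 - (cmod (f t))\<^sup>2 / M\<^sup>2" using r[of t] by (simp add: q_def)
    have gt: "?g t = of_real ((cmod (f t))\<^sup>2)" using complex_norm_square[of "f t"] by (simp add: mult.commute)
    have "(1 - q) * (1 - q) + 1/M\<^sup>2 * (cmod (f t))\<^sup>2 = 2 * (1 - q)" using q by (simp add: algebra_simps)
    then have "complex_of_real ((1 - q) * (1 - q) + 1/M\<^sup>2 * (cmod (f t))\<^sup>2) = of_real (2 * (1 - q))" by simp
    then show "(h * h + (\<lambda>t. of_real (1/M\<^sup>2) * ?g t)) t = 2 * h t"
      unfolding plus_fun_apply gt by (simp add: h_def q_def)
  qed
  have in_H: "\<pi> k y \<in> H" if "k \<in> C0 X" "y \<in> H" for k y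
    using rep_bounded[OF that(1)] that(2) by (auto simp: bounded_operator_def)
  have cnjh: "(\<lambda>t. cnj (h t)) = h" by (auto simp: h_def)
  have a1: "ip (\<pi> h x) (\<pi> h x) = ip x (\<pi> (h * h) x)"
    using rep_star[OF h x in_H[OF h x]] by (simp add: cnjh rep_mult h x)
  have a2: "ip (\<pi> f x) (\<pi> f x) = ip x (\<pi> ?g x)"
    using rep_star[OF f x in_H[OF f x]] by (simp add: rep_mult f x C0_cnj)
  have a3: "ip (\<pi> h x) x = ip x (\<pi> h x)" using rep_star[OF h x x] by (simp add: cnjh)
  have a4: "\<pi> (h * h) x + sc (of_real (1/M\<^sup>2)) (\<pi> ?g x) = sc 2 (\<pi> h x)"
    using rep_add[OF hh C0_scale[OF g] x, of "of_real (1/M\<^sup>2)"] rep_scale[OF g x, of "of_real (1/M\<^sup>2)"]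
      rep_scale[OF h x, of 2] unfolding eq by simp
  have a5: "ip x (\<pi> (h * h) x) + of_real (1/M\<^sup>2) * ip x (\<pi> ?g x) = 2 * ip x (\<pi> h x)"
    using arg_cong[OF a4, of "ip x"] by (simp add: ip_add_right ip_scale_right in_H hh g h x scale_in)
  have "ip (x - \<pi> h x) (x - \<pi> h x) = ip x x - of_real (1/M\<^sup>2) * ip (\<pi> f x) (\<pi> f x)"
    using a5 by (simp add: ip_diff ip_diff_right in_H h x diff_in a1 a2 a3 algebra_simps)
  also have "\<dots> = of_real ((hnorm ip x)\<^sup>2 - 1/M\<^sup>2 * (hnorm ip (\<pi> f x))\<^sup>2)"
    by (simp add: ip_self in_H f x)
  finally have "0 \<le> (hnorm ip x)\<^sup>2 - 1/M\<^sup>2 * (hnorm ip (\<pi> f x))\<^sup>2"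
    using ip_nonneg[of "x - \<pi> h x"] by (simp add: in_H h x diff_in)
  then have "(hnorm ip (\<pi> f x))\<^sup>2 \<le> (M * hnorm ip x)\<^sup>2" using M(1) by (simp add: field_simps)
  then show ?thesis by (rule power2_le_imp_le) (use M(1) x in \<open>simp add: hnorm_nonneg\<close>)
qed

lemma pi_in: "f \<in> C0 X \<Longrightarrow> x \<in> H \<Longrightarrow> \<pi> f x \<in> H"
  using rep_bounded by (auto simp: bounded_operator_def)

lemma A_in: "x \<in> H \<Longrightarrow> A i x \<in> H"
  using A_bounded by (auto simp: bounded_operator_def)

lemma word_in: "x \<in> H \<Longrightarrow> comp_word A w x \<in> H"
  by (induction w) (auto simp: A_in)

lemma rep_apply_in: "F \<in> cov_carrier X \<Longrightarrow> x \<in> H \<Longrightarrow> rep_apply \<pi> A F x \<in> H"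
  unfolding rep_apply_def
  by (rule subspace_sum[OF subspace_H]) (auto simp: cov_carrier_def word_in pi_in)

lemma row_contractive_imp_contractive:
  assumes "row_contractive H ip A" shows "contractive H ip A"
  unfolding contractive_def
proof (intro allI ballI)
  fix i x assume x: "x \<in> H"
  define y where "y j = (if j = i then x else 0)" for j :: 'n
  have A0: "A j 0 = 0" for j by (rule bounded_operator_lin(4)[OF A_bounded])
  have "range y \<subseteq> H" using x zero_in by (auto simp: y_def)
  then have "(hnorm ip (\<Sum>j\<in>UNIV. A j (y j)))\<^sup>2 \<le> (\<Sum>j\<in>UNIV. (hnorm ip (y j))\<^sup>2)"
    using assms by (auto simp: row_contractive_def)
  moreover have "(\<Sum>j\<in>UNIV. A j (y j)) = (\<Sum>j\<in>UNIV. if j = i then A i x else 0)"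
    by (intro sum.cong) (auto simp: y_def A0)
  moreover have "(\<Sum>j\<in>UNIV. (hnorm ip (y j))\<^sup>2) = (\<Sum>j\<in>UNIV. if j = i then (hnorm ip x)\<^sup>2 else 0)"
    by (intro sum.cong) (auto simp: y_def hnorm_zero)
  ultimately show "hnorm ip (A i x) \<le> hnorm ip x"
    using power2_le_imp_le[OF _ hnorm_nonneg[OF x]] by (simp add: sum.delta)
qed

lemma rep_apply_le:
  assumes c: "contractive H ip A" and F: "F \<in> cov_carrier X"
    and M: "\<And>w. M w > 0" "\<And>w t. cmod (F w t) \<le> M w" and x: "x \<in> H"
  shows "hnorm ip (rep_apply \<pi> A F x) \<le> (\<Sum>w | F w \<noteq> 0. M w) * hnorm ip x"
proof -
  have FC: "F w \<in> C0 X" for w using F by (auto simp: cov_carrier_def)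
  have word: "hnorm ip (comp_word A w y) \<le> hnorm ip y" if "y \<in> H" for w y
  proof (induction w)
    case (Cons i w)
    have "hnorm ip (A i (comp_word A w y)) \<le> hnorm ip (comp_word A w y)"
      using c word_in[OF that] by (auto simp: contractive_def)
    then show ?case using Cons by auto
  qed simp
  have "hnorm ip (rep_apply \<pi> A F x) \<le> (\<Sum>w | F w \<noteq> 0. hnorm ip (comp_word A w (\<pi> (F w) x)))"
    unfolding rep_apply_def by (rule hnorm_sum) (auto intro: word_in pi_in FC x)
  also have "\<dots> \<le> (\<Sum>w | F w \<noteq> 0. M w * hnorm ip x)"
    by (intro sum_mono order_trans[OF word rep_contractive]) (auto intro: pi_in FC x M)
  finally show ?thesis by (simp add: sum_distrib_right)
qed

lemma opnorm_bdd:
  assumes "contractive H ip A" and F: "F \<in> cov_carrier X"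
    and M: "\<And>w. M w > 0" "\<And>w t. cmod (F w t) \<le> M w"
  shows "bdd_above {hnorm ip (rep_apply \<pi> A F x) |x. x \<in> H \<and> hnorm ip x \<le> 1}"
    "opnorm H ip (rep_apply \<pi> A F) \<le> (\<Sum>w | F w \<noteq> 0. M w)"
proof -
  have *: "hnorm ip (rep_apply \<pi> A F x) \<le> (\<Sum>w | F w \<noteq> 0. M w)" if "x \<in> H" "hnorm ip x \<le> 1" for x
  proof -
    have "(\<Sum>w | F w \<noteq> 0. M w) * hnorm ip x \<le> (\<Sum>w | F w \<noteq> 0. M w)"
      using that by (intro mult_left_le sum_nonneg) (auto intro: less_imp_le M)
    then show ?thesis using rep_apply_le[OF assms that(1)] by linarith
  qed
  then show "bdd_above {hnorm ip (rep_apply \<pi> A F x) |x. x \<in> H \<and> hnorm ip x \<le> 1}"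
    by (auto intro!: bdd_aboveI)
  show "opnorm H ip (rep_apply \<pi> A F) \<le> (\<Sum>w | F w \<noteq> 0. M w)"
    unfolding opnorm_def using * zero_in hnorm_zero by (intro cSup_least) fastforce+
qed

end

lemma opnorm_universal_bdd:
  assumes "F \<in> cov_carrier X"
  shows "bdd_above {opnorm H ip (rep_apply \<pi> A F) |H ip \<pi> A.
    covariant_representation sc H ip X \<sigma> \<pi> A \<and> contractive H ip A}"
proof -
  have "\<exists>M. M > 0 \<and> (\<forall>t. cmod (F w t) \<le> M)" for w
    using assms C0_bounded[of "F w" X] unfolding cov_carrier_def by blast
  then obtain M where "\<And>w. M w > 0" "\<And>w t. cmod (F w t) \<le> M w" by metis
  then show ?thesis
    using covariant_representation.opnorm_bdd(2)[OF _ _ assms, of sc _ _ \<sigma> _ _ M]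
    by (intro bdd_aboveI[of _ "\<Sum>w | F w \<noteq> 0. M w"]) blast
qed

lemma vector_space_fscale: "vector_space fscale"
  by unfold_locales (auto simp: fscale_def fun_eq_iff algebra_simps)

context covariant_representation
begin

lemma restrict_representation:
  assumes "complex_hilbert_space sc K ip" "K \<subseteq> H"
    and pi_K: "\<And>f x. f \<in> C0 X \<Longrightarrow> x \<in> K \<Longrightarrow> \<pi> f x \<in> K"
    and A_K: "\<And>i x. x \<in> K \<Longrightarrow> A i x \<in> K"
  shows "covariant_representation sc K ip X \<sigma> \<pi> A"
proof (intro covariant_representation.intro covariant_representation_axioms.intro)
  have b: "bounded_operator sc K ip T" if "bounded_operator sc H ip T" "\<And>x. x \<in> K \<Longrightarrow> T x \<in> K" for T
    using that assms(2) unfolding bounded_operator_def by blast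
  show "bounded_operator sc K ip (\<pi> f)" if "f \<in> C0 X" for f
    by (rule b[OF rep_bounded[OF that] pi_K[OF that]])
  show "bounded_operator sc K ip (A i)" for i by (rule b[OF A_bounded A_K])
qed (use assms(1,2) in \<open>auto simp: subset_eq rep_add rep_scale rep_mult rep_star covariance\<close>)

lemma transport_representation:
  fixes \<Phi> :: "'v \<Rightarrow> 'j \<Rightarrow> complex"
  assumes add: "\<And>x y. \<lbrakk>x \<in> H; y \<in> H\<rbrakk> \<Longrightarrow> \<Phi> (x + y) = \<Phi> x + \<Phi> y"
    and scale: "\<And>c x. x \<in> H \<Longrightarrow> \<Phi> (sc c x) = fscale c (\<Phi> x)"
    and inj: "inj_on \<Phi> H"
    and pull: "\<And>f i. f \<in> C0 X \<Longrightarrow> pullback X (\<sigma> i) f \<in> C0 X"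
  defines "\<Psi> \<equiv> inv_into H \<Phi>"
  defines "ip' \<equiv> \<lambda>u v. ip (\<Psi> u) (\<Psi> v)"
  defines "\<pi>' \<equiv> \<lambda>f u. \<Phi> (\<pi> f (\<Psi> u))" and "A' \<equiv> \<lambda>i u. \<Phi> (A i (\<Psi> u))"
  shows "covariant_representation fscale (\<Phi> ` H) ip' X \<sigma> \<pi>' A'"
    and "x \<in> H \<Longrightarrow> hnorm ip' (\<Phi> x) = hnorm ip x"
    and "\<lbrakk>F \<in> cov_carrier X; x \<in> H\<rbrakk> \<Longrightarrow> rep_apply \<pi>' A' F (\<Phi> x) = \<Phi> (rep_apply \<pi> A F x)"
    and "contractive H ip A \<Longrightarrow> contractive (\<Phi> ` H) ip' A'"
    and "row_contractive H ip A \<Longrightarrow> row_contractive (\<Phi> ` H) ip' A'"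
proof -
  have inv: "\<Psi> (\<Phi> x) = x" if "x \<in> H" for x using inj that by (simp add: \<Psi>_def)
  have ip': "ip' (\<Phi> x) (\<Phi> y) = ip x y" if "x \<in> H" "y \<in> H" for x y using that by (simp add: ip'_def inv)
  show hn: "hnorm ip' (\<Phi> x) = hnorm ip x" if "x \<in> H" for x using that by (simp add: hnorm_def ip')
  have zero: "\<Phi> 0 = 0" using scale[OF zero_in, of 0] by (simp add: fscale_def zero_fun_def)
  have diff: "\<Phi> (x - y) = \<Phi> x - \<Phi> y" if "x \<in> H" "y \<in> H" for x y
    using add[of "x - y" y] that by (simp add: diff_in)
  interpret V: vector_space "fscale :: complex \<Rightarrow> ('j \<Rightarrow> complex) \<Rightarrow> _" by (rule vector_space_fscale)
  have sub: "V.subspace (\<Phi> ` H)"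
  proof (rule V.subspaceI)
    show "0 \<in> \<Phi> ` H" using zero_in zero by (metis image_eqI)
    show "u + v \<in> \<Phi> ` H" if "u \<in> \<Phi> ` H" "v \<in> \<Phi> ` H" for u v
      using that add add_in by (metis (no_types, lifting) imageE imageI)
    show "fscale c u \<in> \<Phi> ` H" if "u \<in> \<Phi> ` H" for c u
      using that scale scale_in by (metis (no_types, lifting) imageE imageI)
  qed
  have hilb: "complex_hilbert_space fscale (\<Phi> ` H) ip'"
  proof (intro complex_hilbert_space.intro complex_hilbert_space_axioms.intro)
    show "vector_space (fscale :: complex \<Rightarrow> ('j \<Rightarrow> complex) \<Rightarrow> _)" by (rule vector_space_fscale)
    show "V.subspace (\<Phi> ` H)" by (rule sub)
    show "ip' (x + y) z = ip' x z + ip' y z" if "x \<in> \<Phi> ` H" "y \<in> \<Phi> ` H" "z \<in> \<Phi> ` H" for x y z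
      using that by (auto simp: add[symmetric] ip' add_in ip_add)
    show "ip' (fscale c x) y = c * ip' x y" if "x \<in> \<Phi> ` H" "y \<in> \<Phi> ` H" for c x y
      using that by (auto simp: scale[symmetric] ip' scale_in ip_scale)
    show "ip' y x = cnj (ip' x y)" if "x \<in> \<Phi> ` H" "y \<in> \<Phi> ` H" for x y
      using that by (auto simp: ip' intro: ip_commute)
    show "0 \<le> Re (ip' x x)" if "x \<in> \<Phi> ` H" for x using that by (auto simp: ip' ip_nonneg)
    show "x = 0" if "x \<in> \<Phi> ` H" "ip' x x = 0" for x using that zero by (auto simp: ip' dest: ip_definite)
    fix s :: "nat \<Rightarrow> 'j \<Rightarrow> complex"
    assume s: "range s \<subseteq> \<Phi> ` H" and cau: "\<forall>\<epsilon>>0. \<exists>N. \<forall>j\<ge>N. \<forall>k\<ge>N. hnorm ip' (s j - s k) < \<epsilon>"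
    define r where "r k = \<Psi> (s k)" for k
    have r: "r k \<in> H \<and> s k = \<Phi> (r k)" for k
    proof -
      have "s k \<in> \<Phi> ` H" using s by auto
      then show ?thesis using inv by (auto simp: r_def)
    qed
    then have "hnorm ip' (s j - s k) = hnorm ip (r j - r k)" for j k by (metis diff diff_in hn)
    then have "\<exists>l\<in>H. (\<lambda>k. hnorm ip (r k - l)) \<longlonglongrightarrow> 0" using cau r by (intro complete_H) auto
    then obtain l where l: "l \<in> H" "(\<lambda>k. hnorm ip (r k - l)) \<longlonglongrightarrow> 0" by blast
    have "hnorm ip' (s k - \<Phi> l) = hnorm ip (r k - l)" for k using r l(1) by (metis diff diff_in hn)
    then show "\<exists>l\<in>\<Phi> ` H. (\<lambda>k. hnorm ip' (s k - l)) \<longlonglongrightarrow> 0"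
      using l by (intro bexI[of _ "\<Phi> l"]) simp_all
  qed
  have b: "bounded_operator fscale (\<Phi> ` H) ip' (\<lambda>u. \<Phi> (T (\<Psi> u)))" if T: "bounded_operator sc H ip T" for T
  proof -
    note lin = bounded_operator_lin[OF T]
    obtain B where B: "\<And>x. x \<in> H \<Longrightarrow> hnorm ip (T x) \<le> B * hnorm ip x"
      using bounded_operator_pos[OF T] by blast
    show ?thesis unfolding bounded_operator_def
      by (auto simp: add[symmetric] scale[symmetric] inv add_in scale_in lin hn B intro!: exI[of _ B])
  qed
  show "covariant_representation fscale (\<Phi> ` H) ip' X \<sigma> \<pi>' A'"
  proof (intro covariant_representation.intro covariant_representation_axioms.intro hilb)
    show "bounded_operator fscale (\<Phi> ` H) ip' (\<pi>' f)" if "f \<in> C0 X" for f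
      unfolding \<pi>'_def by (rule b[OF rep_bounded[OF that]])
    show "bounded_operator fscale (\<Phi> ` H) ip' (A' i)" for i unfolding A'_def by (rule b[OF A_bounded])
    show "\<pi>' f (A' i x) = A' i (\<pi>' (pullback X (\<sigma> i) f) x)" if f: "f \<in> C0 X" and x: "x \<in> \<Phi> ` H" for f i x
    proof -
      obtain y where y: "y \<in> H" "x = \<Phi> y" using x by auto
      show ?thesis using f y pull by (simp add: \<pi>'_def A'_def inv A_in pi_in covariance)
    qed
  qed (auto simp: \<pi>'_def inv add[symmetric] scale[symmetric] pi_in rep_add rep_scale rep_mult ip' rep_star C0_cnj)
  have word: "comp_word A' w (\<Phi> x) = \<Phi> (comp_word A w x)" if "x \<in> H" for w x
    using that by (induction w) (auto simp: A'_def inv word_in)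
  show "rep_apply \<pi>' A' F (\<Phi> x) = \<Phi> (rep_apply \<pi> A F x)" if F: "F \<in> cov_carrier X" and x: "x \<in> H" for F x
  proof -
    have FC: "F w \<in> C0 X" for w using F by (auto simp: cov_carrier_def)
    have sum: "\<Phi> (sum g I) = (\<Sum>i\<in>I. \<Phi> (g i))" if "\<And>i. g i \<in> H" for g and I :: "'n list set"
    proof (induction I rule: infinite_finite_induct)
      case (insert i I)
      have "\<Phi> (g i + sum g I) = \<Phi> (g i) + \<Phi> (sum g I)"
        by (rule add[OF that subspace_sum[OF subspace_H that]])
      with insert show ?case by (simp del: plus_fun_apply)
    qed (auto simp: zero)
    show ?thesis unfolding rep_apply_def
      by (subst sum) (auto simp: \<pi>'_def inv word pi_in FC x word_in)
  qed
  show "contractive (\<Phi> ` H) ip' A'" if "contractive H ip A"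
    using that by (auto simp: contractive_def A'_def inv hn A_in)
  show "row_contractive (\<Phi> ` H) ip' A'" if rc: "row_contractive H ip A"
    unfolding row_contractive_def
  proof (intro allI impI)
    fix x :: "'n \<Rightarrow> 'j \<Rightarrow> complex" assume x: "range x \<subseteq> \<Phi> ` H"
    define y where "y i = \<Psi> (x i)" for i
    have y: "y i \<in> H \<and> x i = \<Phi> (y i)" for i
    proof -
      have "x i \<in> \<Phi> ` H" using x by auto
      then show ?thesis using inv by (auto simp: y_def)
    qed
    have sum: "\<Phi> (sum g I) = (\<Sum>i\<in>I. \<Phi> (g i))" if "\<And>i. g i \<in> H" for g and I :: "'n set"
    proof (induction I rule: infinite_finite_induct)
      case (insert i I)
      have "\<Phi> (g i + sum g I) = \<Phi> (g i) + \<Phi> (sum g I)"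
        by (rule add[OF that subspace_sum[OF subspace_H that]])
      with insert show ?case by (simp del: plus_fun_apply)
    qed (auto simp: zero)
    have "(\<Sum>i\<in>UNIV. A' i (x i)) = \<Phi> (\<Sum>i\<in>UNIV. A i (y i))"
      using y by (subst sum) (auto simp: A'_def A_in y_def)
    then have "hnorm ip' (\<Sum>i\<in>UNIV. A' i (x i)) = hnorm ip (\<Sum>i\<in>UNIV. A i (y i))"
      using y by (simp add: hn subspace_sum[OF subspace_H] A_in)
    moreover have "hnorm ip' (x i) = hnorm ip (y i)" for i using y hn by metis
    moreover have "range y \<subseteq> H" using y by auto
    ultimately show "(hnorm ip' (\<Sum>i\<in>UNIV. A' i (x i)))\<^sup>2 \<le> (\<Sum>i\<in>UNIV. (hnorm ip' (x i))\<^sup>2)"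
      using rc by (simp add: row_contractive_def)
  qed
qed

end

context covariant_representation
begin

lemma rep_apply_scale:
  assumes "F \<in> cov_carrier X" "x \<in> H"
  shows "rep_apply \<pi> A F (sc c x) = sc c (rep_apply \<pi> A F x)"
proof -
  have FC: "F w \<in> C0 X" for w using assms by (auto simp: cov_carrier_def)
  have w: "comp_word A w (sc c y) = sc c (comp_word A w y)" if "y \<in> H" for w y
    using that by (induction w) (auto simp: bounded_operator_lin(3)[OF A_bounded] word_in)
  show ?thesis unfolding rep_apply_def scale_sum_right
    by (intro sum.cong refl) (simp add: bounded_operator_lin(3)[OF rep_bounded[OF FC]] assms w pi_in FC)
qed

lemma repspace_copy:
  assumes X: "multivariable_system X \<sigma>" and F: "F \<in> cov_carrier X" and x: "x \<in> H"
  obtains H' :: "('a, 'n) repspace set" and ip' \<pi>' A' y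
  where "covariant_representation fscale H' ip' X \<sigma> \<pi>' A'"
    "contractive H ip A \<Longrightarrow> contractive H' ip' A'"
    "row_contractive H ip A \<Longrightarrow> row_contractive H' ip' A'"
    "y \<in> H'" "hnorm ip' y = hnorm ip x"
    "hnorm ip' (rep_apply \<pi>' A' F y) = hnorm ip (rep_apply \<pi> A F x)"
proof -
  have pull: "pullback X (\<sigma> i) f \<in> C0 X" if "f \<in> C0 X" for f i
    using X that by (auto simp: multivariable_system_def C0_pullback)
  define e :: "'n list \<times> ('a \<Rightarrow> complex) option \<Rightarrow> 'v" where
    "e = (\<lambda>(w, u). case u of None \<Rightarrow> comp_word A w x
                    | Some f \<Rightarrow> if f \<in> C0 X then comp_word A w (\<pi> f x) else 0)"
  define E where "E = range e"
  have e_in: "e j \<in> H" for j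
    by (auto simp: e_def word_in x pi_in zero_in split: prod.split option.split)
  then have EH: "E \<subseteq> H" by (auto simp: E_def)
  define K where "K = closed_span E"
  note cs = closed_span_props[OF EH, folded K_def]
  have e1: "comp_word A w x \<in> span E" for w
    proof -
    have "e (w, None) \<in> span E" by (rule span_base) (simp add: E_def)
    then show ?thesis by (simp add: e_def)
  qed
  have e2: "comp_word A w (\<pi> f x) \<in> span E" if "f \<in> C0 X" for w f
    proof -
    have "e (w, Some f) \<in> span E" by (rule span_base) (simp add: E_def)
    then show ?thesis using that by (simp add: e_def)
  qed
  have AE: "A i z \<in> span E" if z: "z \<in> E" for i z
  proof -
    obtain w u where wu: "z = e (w, u)" using z by (auto simp: E_def)
    show ?thesis
      using e1[of "i # w"] e2[of _ "i # w"] bounded_operator_lin(4)[OF A_bounded, of i]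
      by (auto simp: wu e_def span_zero split: option.split)
  qed
  have move: "\<exists>g'\<in>C0 X. \<forall>y\<in>H. \<pi> g (comp_word A w y) = comp_word A w (\<pi> g' y)" if "g \<in> C0 X" for g w
    using that
  proof (induction w arbitrary: g)
    case (Cons i w)
    obtain g' where g': "g' \<in> C0 X" "\<And>y. y \<in> H \<Longrightarrow> \<pi> (pullback X (\<sigma> i) g) (comp_word A w y) = comp_word A w (\<pi> g' y)"
      using Cons.IH[OF pull[OF Cons.prems]] by blast
    have "\<pi> g (comp_word A (i # w) y) = comp_word A (i # w) (\<pi> g' y)" if "y \<in> H" for y
      using g'(2)[OF that] covariance[OF Cons.prems word_in[OF that]] by simp
    then show ?case using g'(1) by blast
  qed auto
  have piE: "\<pi> g z \<in> span E" if g: "g \<in> C0 X" and z: "z \<in> E" for g z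
  proof -
    obtain w u where wu: "z = e (w, u)" using z by (auto simp: E_def)
    obtain g' where g': "g' \<in> C0 X" "\<And>y. y \<in> H \<Longrightarrow> \<pi> g (comp_word A w y) = comp_word A w (\<pi> g' y)"
      using move[OF g] by blast
    have "\<pi> g (comp_word A w (\<pi> f x)) \<in> span E" if "f \<in> C0 X" for f
      using e2[OF C0_mult[OF g'(1) that], of w] by (simp add: g' pi_in that x rep_mult)
    moreover have "\<pi> g (comp_word A w x) \<in> span E" using e2[OF g'(1)] by (simp add: g' x)
    ultimately show ?thesis using bounded_operator_lin(4)[OF rep_bounded[OF g]]
      by (auto simp: wu e_def span_zero split: option.split)
  qed
  interpret R: covariant_representation sc K ip X \<sigma> \<pi> A
  proof (rule restrict_representation)
    show "complex_hilbert_space sc K ip"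
      by (rule complex_hilbert_space_closed_subspace[OF cs(1,2)]) (rule cs(3))
    show "\<pi> f y \<in> K" if "f \<in> C0 X" "y \<in> K" for f y
      by (rule cs(4)[OF rep_bounded[OF that(1)] piE[OF that(1)] that(2)])
    show "A i y \<in> K" if "y \<in> K" for i y by (rule cs(4)[OF A_bounded AE that])
  qed (rule cs(1))
  have KH: "y \<in> H" if "y \<in> K" for y using cs(1) that by auto
  have xK: "x \<in> K" using span_closed_span[OF EH e1[of "[]"]] by (simp add: K_def)
  define \<Phi> where "\<Phi> y = (\<lambda>j. ip y (e j))" for y
  have inj: "inj_on \<Phi> K"
  proof (rule inj_onI)
    fix y z assume yz: "y \<in> K" "z \<in> K" "\<Phi> y = \<Phi> z"
    have "ip (y - z) v = 0" if v: "v \<in> E" for v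
    proof -
      obtain j where j: "v = e j" using v by (auto simp: E_def)
      show ?thesis using fun_cong[OF yz(3), of j] yz KH e_in by (simp add: \<Phi>_def j ip_diff)
    qed
    then have "y - z = 0" using cs(5)[of "y - z"] R.diff_in yz by blast
    then show "y = z" by simp
  qed
  have add: "\<Phi> (y + z) = \<Phi> y + \<Phi> z" if "y \<in> K" "z \<in> K" for y z
    using that KH e_in by (auto simp: \<Phi>_def ip_add)
  have scale: "\<Phi> (sc c y) = fscale c (\<Phi> y)" if "y \<in> K" for c y
    using that KH e_in by (auto simp: \<Phi>_def fscale_def ip_scale)
  note tr = R.transport_representation[OF add scale inj pull, simplified]
  have cK: "contractive K ip A" if "contractive H ip A" using that KH by (auto simp: contractive_def)
  have rK: "row_contractive K ip A" if "row_contractive H ip A"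
    using that cs(1) unfolding row_contractive_def by (meson order_trans)
  show thesis
  proof (rule that[OF tr(1) tr(4)[OF cK] tr(5)[OF rK]])
    show "\<Phi> x \<in> \<Phi> ` K" using xK by blast
    show "hnorm (\<lambda>u v. ip (inv_into K \<Phi> u) (inv_into K \<Phi> v)) (\<Phi> x) = hnorm ip x" by (rule tr(2)[OF xK])
    show "hnorm (\<lambda>u v. ip (inv_into K \<Phi> u) (inv_into K \<Phi> v)) (rep_apply (\<lambda>f u. \<Phi> (\<pi> f (inv_into K \<Phi> u)))
        (\<lambda>i u. \<Phi> (A i (inv_into K \<Phi> u))) F (\<Phi> x)) = hnorm ip (rep_apply \<pi> A F x)"
      by (simp only: tr(3)[OF F xK] tr(2)[OF R.rep_apply_in[OF F xK]])
  qed
qed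

end

lemma (in covariant_representation) rep_apply_le_opnorm:
  assumes "contractive H ip A" "F \<in> cov_carrier X" "x \<in> H" "hnorm ip x \<le> 1"
  shows "hnorm ip (rep_apply \<pi> A F x) \<le> opnorm H ip (rep_apply \<pi> A F)"
proof -
  have "\<exists>M. M > 0 \<and> (\<forall>t. cmod (F w t) \<le> M)" for w
    using assms C0_bounded[of "F w" X] unfolding cov_carrier_def by blast
  then obtain M where M: "\<And>w. M w > 0" "\<And>w t. cmod (F w t) \<le> M w" by metis
  show ?thesis
    unfolding opnorm_def using opnorm_bdd(1)[OF assms(1,2) M] assms(3,4) by (intro cSup_upper) auto
qed

lemma (in covariant_representation) norm_bound_from_repspace:
  assumes X: "multivariable_system X \<sigma>" and F: "F \<in> cov_carrier X" and x: "x \<in> H"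
    and c: "contractive H ip A"
    and bound: "\<And>(H' :: ('a, 'n) repspace set) ip' \<pi>' A'.
      \<lbrakk>covariant_representation fscale H' ip' X \<sigma> \<pi>' A'; contractive H' ip' A';
       row_contractive H ip A \<Longrightarrow> row_contractive H' ip' A'\<rbrakk> \<Longrightarrow> opnorm H' ip' (rep_apply \<pi>' A' F) \<le> N"
  shows "hnorm ip (rep_apply \<pi> A F x) \<le> N * hnorm ip x"
proof (cases "hnorm ip x = 0")
  case True
  then have "x = sc 0 x" using hnorm_eq_0 x by simp
  then have "rep_apply \<pi> A F x = 0" using rep_apply_scale[OF F x, of 0] by simp
  then show ?thesis using True by (simp add: hnorm_zero)
next
  case False
  then have n: "hnorm ip x > 0" using hnorm_nonneg[OF x] by simp
  define z where "z = sc (of_real (1 / hnorm ip x)) x"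
  have z: "z \<in> H" "hnorm ip z = 1" using n x by (auto simp: z_def scale_in hnorm_scale norm_divide)
  obtain H' :: "('a, 'n) repspace set" and ip' \<pi>' A' y where
    rep': "covariant_representation fscale H' ip' X \<sigma> \<pi>' A'" and
    c': "contractive H' ip' A'" and r': "row_contractive H ip A \<Longrightarrow> row_contractive H' ip' A'" and
    y: "y \<in> H'" "hnorm ip' y = 1" "hnorm ip' (rep_apply \<pi>' A' F y) = hnorm ip (rep_apply \<pi> A F z)"
    using repspace_copy[OF X F z(1)] c z(2) by metis
  have "hnorm ip (rep_apply \<pi> A F z) \<le> opnorm H' ip' (rep_apply \<pi>' A' F)"
    using covariant_representation.rep_apply_le_opnorm[OF rep' c' F y(1)] y by simp
  also have "\<dots> \<le> N" by (rule bound[OF rep' c' r'])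
  finally have "(1 / hnorm ip x) * hnorm ip (rep_apply \<pi> A F x) \<le> N"
    using n by (simp add: z_def rep_apply_scale[OF F x] hnorm_scale rep_apply_in F x norm_divide)
  then show ?thesis using n by (simp add: field_simps)
qed

lemma tensor_norm_universal:
  assumes X: "multivariable_system X \<sigma>" and F: "F \<in> cov_carrier X"
    and rep: "covariant_representation sc H ip X \<sigma> \<pi> A" and c: "row_contractive H ip A" and x: "x \<in> H"
  shows "hnorm ip (rep_apply \<pi> A F x) \<le> tensor_norm X \<sigma> F * hnorm ip x"
proof -
  have bdd: "bdd_above {opnorm H ip (rep_apply \<pi> A F) |(H :: ('a, 'b) repspace set) ip \<pi> A.
     covariant_representation fscale H ip X \<sigma> \<pi> A \<and> row_contractive H ip A}"
    by (rule bdd_above_mono[OF opnorm_universal_bdd[OF F, of fscale \<sigma>]])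
       (use covariant_representation.row_contractive_imp_contractive in blast)
  show ?thesis
    by (rule covariant_representation.norm_bound_from_repspace[OF rep X F x
          covariant_representation.row_contractive_imp_contractive[OF rep c]])
       (use c in \<open>auto simp: tensor_norm_def intro!: cSup_upper bdd\<close>)
qed

lemma semicrossed_norm_universal:
  assumes X: "multivariable_system X \<sigma>" and F: "F \<in> cov_carrier X"
    and rep: "covariant_representation sc H ip X \<sigma> \<pi> A" and c: "contractive H ip A" and x: "x \<in> H"
  shows "hnorm ip (rep_apply \<pi> A F x) \<le> semicrossed_norm X \<sigma> F * hnorm ip x"
  by (rule covariant_representation.norm_bound_from_repspace[OF rep X F x c])
     (auto simp: semicrossed_norm_def intro!: cSup_upper opnorm_universal_bdd[OF F])

end

theory Submission
  imports Defs
begin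

text \<open>
  Let \<open>\<gamma> : A \<rightarrow> B\<close> be an algebra isomorphism between two completed covariance algebras. By the closed
  graph theorem (\<open>closed_graph\<close>) it suffices to exclude a sequence \<open>x\<^sub>k \<rightarrow> 0\<close> in \<open>A\<close> with
  \<open>\<gamma> x\<^sub>k \<rightarrow> b \<noteq> 0\<close>. This is done by a gliding hump (\<open>gliding_hump\<close>), which needs an element \<open>u\<close> of \<open>B\<close>
  and contractive linear functionals \<open>\<phi>\<^sub>0, \<phi>\<^sub>1, \<dots>\<close> on \<open>B\<close> such that \<open>\<phi>\<^sub>0 b \<noteq> 0\<close>, \<open>\<phi>\<^sub>0\<close> vanishes on \<open>u B\<close>, and
  \<open>\<phi>\<^sub>k\<^sub>+\<^sub>1 (u x)\<close> is a fixed nonzero multiple of \<open>\<phi>\<^sub>k x\<close>. With \<open>a = \<gamma>\<^sup>-\<^sup>1 u\<close>, a sum \<open>\<Sum> a\<^sup>k x\<^sub>k\<close> of suitable tiny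
  elements would be mapped to an element on which the \<open>\<phi>\<^sub>k\<close> are unbounded.

  The functionals are Fourier coefficients \<open>F \<mapsto> F\<^sub>w(p)\<close>. They are contractive because the Fock
  representation over the orbit of \<open>p\<close> is admissible for both norms and exhibits the coefficients of \<open>F\<close>
  as matrix entries (\<open>coefficient_le\<close>). They separate the points of the completion
  (\<open>coefficients_separate\<close>): scaling the operators \<open>A\<^sub>i\<close> by \<open>r < 1\<close> defines contractions of the
  algebra, and Abel summation recovers an element from its homogeneous components. So some coefficient of
  \<open>b\<close>, at a word \<open>w\<close> and a point \<open>p\<close>, is nonzero. For a word \<open>v\<close> longer than \<open>w\<close> the element \<open>u = s\<^sub>v f\<close>
  shifts the coefficients at \<open>w, v w, v v w, \<dots>\<close>, with weights the values of \<open>f\<close> along an orbit of \<open>p\<close>.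
  That orbit may leave every compact set, but it is countable, so some \<open>f\<close> in \<open>C\<^sub>0\<close> has no zero on it
  (\<open>C0_nonzero_on_sequence\<close>), and \<open>u\<close> is as required (\<open>shifted_functionals_separate\<close>).
\<close>

section \<open>Seminormed and Banach algebras with a carrier set\<close>

text \<open>The record \<^type>\<open>normed_alg\<close> has no field for the zero; it is \<open>0 \<cdot> x\<close> for any element \<open>x\<close> of the carrier.\<close>
definition azero :: "'c normed_alg \<Rightarrow> 'c" where
  "azero R = ascale R 0 (SOME x. x \<in> acarrier R)"

abbreviation asub :: "'c normed_alg \<Rightarrow> 'c \<Rightarrow> 'c \<Rightarrow> 'c" where
  "asub R x y \<equiv> aadd R x (ascale R (- 1) y)"

locale seminormed_algebra =
  fixes R :: "'c normed_alg"
  assumes carrier_nonempty: "acarrier R \<noteq> {}"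
    and add_closed [simp]: "\<lbrakk>x \<in> acarrier R; y \<in> acarrier R\<rbrakk> \<Longrightarrow> aadd R x y \<in> acarrier R"
    and scale_closed [simp]: "x \<in> acarrier R \<Longrightarrow> ascale R c x \<in> acarrier R"
    and mult_closed [simp]: "\<lbrakk>x \<in> acarrier R; y \<in> acarrier R\<rbrakk> \<Longrightarrow> amult R x y \<in> acarrier R"
    and add_assoc: "\<lbrakk>x \<in> acarrier R; y \<in> acarrier R; z \<in> acarrier R\<rbrakk>
      \<Longrightarrow> aadd R (aadd R x y) z = aadd R x (aadd R y z)"
    and add_commute: "\<lbrakk>x \<in> acarrier R; y \<in> acarrier R\<rbrakk> \<Longrightarrow> aadd R x y = aadd R y x"
    and scale_zero_add: "\<lbrakk>x \<in> acarrier R; y \<in> acarrier R\<rbrakk> \<Longrightarrow> aadd R (ascale R 0 x) y = y"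
    and scale_add: "\<lbrakk>x \<in> acarrier R; y \<in> acarrier R\<rbrakk>
      \<Longrightarrow> ascale R c (aadd R x y) = aadd R (ascale R c x) (ascale R c y)"
    and scale_add_left: "x \<in> acarrier R \<Longrightarrow> ascale R (c + e) x = aadd R (ascale R c x) (ascale R e x)"
    and scale_scale: "x \<in> acarrier R \<Longrightarrow> ascale R c (ascale R e x) = ascale R (c * e) x"
    and scale_one: "x \<in> acarrier R \<Longrightarrow> ascale R 1 x = x"
    and mult_add_right: "\<lbrakk>x \<in> acarrier R; y \<in> acarrier R; z \<in> acarrier R\<rbrakk>
      \<Longrightarrow> amult R x (aadd R y z) = aadd R (amult R x y) (amult R x z)"
    and mult_add_left: "\<lbrakk>x \<in> acarrier R; y \<in> acarrier R; z \<in> acarrier R\<rbrakk>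
      \<Longrightarrow> amult R (aadd R x y) z = aadd R (amult R x z) (amult R y z)"
    and mult_scale_right: "\<lbrakk>x \<in> acarrier R; y \<in> acarrier R\<rbrakk>
      \<Longrightarrow> amult R x (ascale R c y) = ascale R c (amult R x y)"
    and mult_scale_left: "\<lbrakk>x \<in> acarrier R; y \<in> acarrier R\<rbrakk>
      \<Longrightarrow> amult R (ascale R c x) y = ascale R c (amult R x y)"
    and norm_scale: "x \<in> acarrier R \<Longrightarrow> anorm R (ascale R c x) = cmod c * anorm R x"
    and norm_triangle: "\<lbrakk>x \<in> acarrier R; y \<in> acarrier R\<rbrakk>
      \<Longrightarrow> anorm R (aadd R x y) \<le> anorm R x + anorm R y"
    and norm_mult: "\<lbrakk>x \<in> acarrier R; y \<in> acarrier R\<rbrakk>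
      \<Longrightarrow> anorm R (amult R x y) \<le> anorm R x * anorm R y"
begin

lemma zero_closed [simp]: "azero R \<in> acarrier R"
  unfolding azero_def using carrier_nonempty by (intro scale_closed) (simp add: some_in_eq)

lemma zero_add: "x \<in> acarrier R \<Longrightarrow> aadd R (azero R) x = x"
  unfolding azero_def using carrier_nonempty by (intro scale_zero_add) (simp_all add: some_in_eq)

lemma add_zero: "x \<in> acarrier R \<Longrightarrow> aadd R x (azero R) = x"
  using zero_add add_commute by simp

lemma scale_zero: "x \<in> acarrier R \<Longrightarrow> ascale R 0 x = azero R"
  using scale_zero_add[of x "azero R"] add_zero[of "ascale R 0 x"] by simp

lemma scale_azero: "ascale R c (azero R) = azero R"
  using scale_scale[of "azero R" c 0] scale_zero[of "azero R"] by simp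

lemma sub_self: "x \<in> acarrier R \<Longrightarrow> asub R x x = azero R"
  using scale_add_left[of x 1 "-1"] by (simp add: scale_one scale_zero)

lemma add_left_commute: "\<lbrakk>x \<in> acarrier R; y \<in> acarrier R; z \<in> acarrier R\<rbrakk>
    \<Longrightarrow> aadd R x (aadd R y z) = aadd R y (aadd R x z)"
  using add_assoc[of x y z] add_assoc[of y x z] add_commute[of x y] by simp

lemmas add_ac = add_assoc add_commute add_left_commute

lemma sub_add: "\<lbrakk>x \<in> acarrier R; y \<in> acarrier R; z \<in> acarrier R; w \<in> acarrier R\<rbrakk>
    \<Longrightarrow> asub R (aadd R x y) (aadd R z w) = aadd R (asub R x z) (asub R y w)"
  by (simp add: scale_add add_ac)

lemma add_sub_cancel: "\<lbrakk>x \<in> acarrier R; y \<in> acarrier R\<rbrakk> \<Longrightarrow> aadd R y (asub R x y) = x"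
  using sub_self[of y] by (simp add: add_left_commute[of y x] add_zero)

lemma sub_zero: "x \<in> acarrier R \<Longrightarrow> asub R x (azero R) = x"
  by (simp add: scale_azero add_zero)

lemma norm_zero: "anorm R (azero R) = 0"
  using norm_scale[of "azero R" 0] by (simp add: scale_azero)

lemma norm_nonneg [simp]: "x \<in> acarrier R \<Longrightarrow> 0 \<le> anorm R x"
  using norm_triangle[of x "ascale R (-1) x"] norm_scale[of x "-1"]
  by (simp add: sub_self norm_zero)

lemma dist_eq: "\<lbrakk>x \<in> acarrier R; y \<in> acarrier R\<rbrakk> \<Longrightarrow> adist R x y = anorm R (asub R x y)"
  by (simp add: adist_def)

lemma dist_nonneg [simp]: "0 \<le> adist R x y"
  by (simp add: adist_def)

lemma dist_self [simp]: "adist R x x = 0"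
  by (simp add: adist_def sub_self norm_zero)

lemma dist_commute: "adist R x y = adist R y x"
proof (cases "x \<in> acarrier R \<and> y \<in> acarrier R")
  case True
  then have "asub R y x = ascale R (-1) (asub R x y)"
    by (simp add: scale_add scale_scale scale_one add_commute)
  then show ?thesis using True by (simp add: dist_eq norm_scale)
qed (auto simp: adist_def)

lemma dist_zero: "x \<in> acarrier R \<Longrightarrow> adist R x (azero R) = anorm R x"
  by (simp add: dist_eq sub_zero)

lemma dist_add: "\<lbrakk>x \<in> acarrier R; y \<in> acarrier R; z \<in> acarrier R; w \<in> acarrier R\<rbrakk>
    \<Longrightarrow> adist R (aadd R x y) (aadd R z w) \<le> adist R x z + adist R y w"
  using norm_triangle[of "asub R x z" "asub R y w"] by (simp add: dist_eq sub_add)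

lemma dist_add_left: "\<lbrakk>x \<in> acarrier R; y \<in> acarrier R; z \<in> acarrier R\<rbrakk>
    \<Longrightarrow> adist R (aadd R x y) (aadd R x z) = adist R y z"
  by (simp add: dist_eq sub_add sub_self zero_add)

lemma dist_triangle: "\<lbrakk>x \<in> acarrier R; y \<in> acarrier R; z \<in> acarrier R\<rbrakk>
    \<Longrightarrow> adist R x z \<le> adist R x y + adist R y z"
proof -
  assume c: "x \<in> acarrier R" "y \<in> acarrier R" "z \<in> acarrier R"
  have "asub R x z = aadd R (asub R x y) (asub R y z)"
    using sub_add[of x y y z] sub_add[of y x y z] c sub_self[of y]
    by (simp add: add_commute[of x y] zero_add)
  then show ?thesis using norm_triangle[of "asub R x y" "asub R y z"] c by (simp add: dist_eq)
qed

lemma dist_scale: "\<lbrakk>x \<in> acarrier R; y \<in> acarrier R\<rbrakk>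
    \<Longrightarrow> adist R (ascale R c x) (ascale R c y) = cmod c * adist R x y"
proof -
  assume c: "x \<in> acarrier R" "y \<in> acarrier R"
  have "asub R (ascale R c x) (ascale R c y) = ascale R c (asub R x y)"
    using c by (simp add: scale_add scale_scale)
  then show ?thesis using c by (simp add: dist_eq norm_scale)
qed

lemma dist_mult_right: "\<lbrakk>x \<in> acarrier R; y \<in> acarrier R; u \<in> acarrier R\<rbrakk>
    \<Longrightarrow> adist R (amult R u x) (amult R u y) \<le> anorm R u * adist R x y"
  using norm_mult[of u "asub R x y"] by (simp add: dist_eq mult_add_right mult_scale_right)

lemma dist_mult_left: "\<lbrakk>x \<in> acarrier R; y \<in> acarrier R; u \<in> acarrier R\<rbrakk>
    \<Longrightarrow> adist R (amult R x u) (amult R y u) \<le> adist R x y * anorm R u"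
  using norm_mult[of "asub R x y" u] by (simp add: dist_eq mult_add_left mult_scale_left)

lemma norm_dist: "\<lbrakk>x \<in> acarrier R; y \<in> acarrier R\<rbrakk> \<Longrightarrow> \<bar>anorm R x - anorm R y\<bar> \<le> adist R x y"
  using dist_triangle[of x y "azero R"] dist_triangle[of y x "azero R"] dist_commute[of x y]
  by (simp add: dist_zero)

end

locale banach_algebra = seminormed_algebra +
  assumes norm_definite: "\<lbrakk>x \<in> acarrier R; anorm R x = 0\<rbrakk> \<Longrightarrow> x = azero R"
    and complete: "s \<in> cauchy_seqs R \<Longrightarrow> \<exists>l\<in>acarrier R. (\<lambda>k. adist R (s k) l) \<longlonglongrightarrow> 0"
begin

sublocale Metric_space "acarrier R" "adist R"
proof
  show "adist R x y = 0 \<longleftrightarrow> x = y" if "x \<in> acarrier R" "y \<in> acarrier R" for x y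
  proof
    assume "adist R x y = 0"
    then have "asub R x y = azero R" using norm_definite[of "asub R x y"] that by (simp add: dist_eq)
    then show "x = y" using add_sub_cancel[of x y] that by (simp add: add_zero)
  qed simp
qed (rule dist_nonneg dist_commute dist_triangle; assumption?)+

lemma mcomplete: mcomplete
  unfolding mcomplete_def
proof (intro allI impI)
  fix s assume s: "MCauchy s"
  then have "s \<in> cauchy_seqs R" unfolding MCauchy_def cauchy_seqs_def mem_Collect_eq by meson
  then obtain l where l: "l \<in> acarrier R" "(\<lambda>k. adist R (s k) l) \<longlonglongrightarrow> 0" using complete by blast
  have "limitin mtopology s l sequentially"
    unfolding limitin_metric_dist_null using l s by (auto simp: MCauchy_def intro!: always_eventually)
  then show "\<exists>x. limitin mtopology s x sequentially" by blast
qed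

text \<open>The limits constructed below are limits of sequences whose steps shrink
  geometrically. The closed graph theorem needs the explicit distance from each term to the limit,
  because it bounds the image of the first term by its distance from the limit.\<close>
lemma geometric_imp_convergent:
  assumes s: "range s \<subseteq> acarrier R" and d: "\<And>k. adist R (s k) (s (Suc k)) \<le> B * (1/2) ^ k"
  obtains l where "l \<in> acarrier R" "(\<lambda>k. adist R (s k) l) \<longlonglongrightarrow> 0" "\<And>k. adist R (s k) l \<le> 2 * B * (1/2) ^ k"
proof -
  have sc: "s k \<in> acarrier R" for k using s by auto
  \<comment> \<open>The factor \<open>1 - (1/2) ^ m\<close> is the partial geometric sum that makes the induction go through.\<close>
  have le: "adist R (s k) (s (k + m)) \<le> 2 * B * (1/2) ^ k * (1 - (1/2) ^ m)" for k m
  proof (induction m)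
    case (Suc m)
    have "adist R (s k) (s (k + Suc m)) \<le> adist R (s k) (s (k + m)) + adist R (s (k + m)) (s (Suc (k + m)))"
      using dist_triangle sc by simp
    also have "\<dots> \<le> 2 * B * (1/2) ^ k * (1 - (1/2) ^ m) + B * (1/2) ^ (k + m)"
      using Suc d by (intro add_mono)
    also have "\<dots> = 2 * B * (1/2) ^ k * (1 - (1/2) ^ Suc m)" by (simp add: power_add algebra_simps)
    finally show ?case .
  qed simp
  have B: "B \<ge> 0" using order_trans[OF dist_nonneg d[of 0]] by simp
  have le2: "adist R (s k) (s (k + m)) \<le> 2 * B * (1/2) ^ k" for k m
    using B by (intro order_trans[OF le] mult_left_le) auto
  have lim: "(\<lambda>k. 2 * B * (1/2) ^ k) \<longlonglongrightarrow> 0"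
    by (intro tendsto_mult_right_zero LIMSEQ_realpow_zero) auto
  have "s \<in> cauchy_seqs R" unfolding cauchy_seqs_def
  proof (intro CollectI conjI allI impI)
    fix \<epsilon> :: real assume "\<epsilon> > 0"
    then obtain N where N: "2 * B * (1/2) ^ N < \<epsilon> / 2"
      using order_tendstoD(2)[OF lim, of "\<epsilon>/2"] by (auto simp: eventually_sequentially)
    have "adist R (s j) (s k) < \<epsilon>" if "j \<ge> N" "k \<ge> N" for j k
    proof -
      have "adist R (s j) (s k) \<le> adist R (s j) (s N) + adist R (s N) (s k)" using dist_triangle sc by simp
      then show ?thesis
        using le2[of N "j - N"] le2[of N "k - N"] that N dist_commute[of "s N" "s j"] by simp
    qed
    then show "\<exists>N. \<forall>j\<ge>N. \<forall>k\<ge>N. adist R (s j) (s k) < \<epsilon>" by blast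
  qed (rule s)
  then obtain l where l: "l \<in> acarrier R" "(\<lambda>k. adist R (s k) l) \<longlonglongrightarrow> 0" using complete by blast
  have "adist R (s k) l \<le> 2 * B * (1/2) ^ k" for k
  proof (rule LIMSEQ_le_const)
    show "(\<lambda>m. 2 * B * (1/2) ^ k + adist R (s (m + k)) l) \<longlonglongrightarrow> 2 * B * (1/2) ^ k"
      using LIMSEQ_ignore_initial_segment[OF l(2), of k] by (auto intro!: tendsto_eq_intros)
    have "adist R (s k) l \<le> 2 * B * (1/2) ^ k + adist R (s (m + k)) l" for m
      using dist_triangle[OF sc sc l(1), of k "m + k"] le2[of k m] by (simp add: add.commute)
    then show "\<exists>N. \<forall>m\<ge>N. adist R (s k) l \<le> 2 * B * (1/2) ^ k + adist R (s (m + k)) l" by blast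
  qed
  then show thesis using that l by blast
qed

end

section \<open>The completion of a seminormed algebra\<close>

lemma squeeze_null:
  fixes f g :: "nat \<Rightarrow> real"
  assumes "g \<longlonglongrightarrow> 0" "\<And>k. 0 \<le> f k" "\<And>k. f k \<le> g k"
  shows "f \<longlonglongrightarrow> 0"
  by (rule tendsto_sandwich[OF _ _ tendsto_const assms(1)]) (use assms in auto)

context seminormed_algebra
begin

abbreviation cls :: "(nat \<Rightarrow> 'c) \<Rightarrow> (nat \<Rightarrow> 'c) set" where
  "cls s \<equiv> null_rel R `` {s}"

lemma cauchy_seqs_in: "s \<in> cauchy_seqs R \<Longrightarrow> s k \<in> acarrier R"
  by (auto simp: cauchy_seqs_def)

lemma cauchy_seqsD:
  assumes "s \<in> cauchy_seqs R" "\<epsilon> > 0"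
  obtains N where "\<And>j k. j \<ge> N \<Longrightarrow> k \<ge> N \<Longrightarrow> adist R (s j) (s k) < \<epsilon>"
proof -
  have "\<exists>N. \<forall>j\<ge>N. \<forall>k\<ge>N. adist R (s j) (s k) < \<epsilon>" using assms by (simp add: cauchy_seqs_def)
  then show thesis using that by blast
qed

text \<open>The common source of the closure of Cauchy sequences under sums, scalar multiples
  and products, whose distances obey such a bound.\<close>
lemma cauchy_seqs_dominated:
  assumes s: "s \<in> cauchy_seqs R" and t: "t \<in> cauchy_seqs R" and r: "range r \<subseteq> acarrier R"
    and B: "B > 0" "\<And>j k. adist R (r j) (r k) \<le> B * (adist R (s j) (s k) + adist R (t j) (t k))"
  shows "r \<in> cauchy_seqs R"
  unfolding cauchy_seqs_def
proof (intro CollectI conjI allI impI)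
  fix \<epsilon> :: real assume "\<epsilon> > 0"
  then have e: "\<epsilon> / (2 * B) > 0" using B by simp
  obtain N1 where N1: "\<And>j k. j \<ge> N1 \<Longrightarrow> k \<ge> N1 \<Longrightarrow> adist R (s j) (s k) < \<epsilon> / (2 * B)"
    using cauchy_seqsD[OF s e] by blast
  obtain N2 where N2: "\<And>j k. j \<ge> N2 \<Longrightarrow> k \<ge> N2 \<Longrightarrow> adist R (t j) (t k) < \<epsilon> / (2 * B)"
    using cauchy_seqsD[OF t e] by blast
  have "adist R (r j) (r k) < \<epsilon>" if "j \<ge> max N1 N2" "k \<ge> max N1 N2" for j k
  proof -
    have "adist R (s j) (s k) + adist R (t j) (t k) < \<epsilon> / B"
      using add_strict_mono[OF N1[of j k] N2[of j k]] that B(1) by (simp add: field_simps)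
    then have "B * (adist R (s j) (s k) + adist R (t j) (t k)) < \<epsilon>" using B(1) by (simp add: field_simps)
    then show ?thesis using B(2)[of j k] by linarith
  qed
  then show "\<exists>N. \<forall>j\<ge>N. \<forall>k\<ge>N. adist R (r j) (r k) < \<epsilon>" by blast
qed (rule r)

lemma cauchy_seqs_add:
  assumes "s \<in> cauchy_seqs R" "t \<in> cauchy_seqs R"
  shows "(\<lambda>k. aadd R (s k) (t k)) \<in> cauchy_seqs R"
  by (rule cauchy_seqs_dominated[OF assms, of _ 1]) (use assms cauchy_seqs_in in \<open>auto intro: dist_add\<close>)

lemma cauchy_seqs_scale:
  assumes "s \<in> cauchy_seqs R"
  shows "(\<lambda>k. ascale R c (s k)) \<in> cauchy_seqs R"
proof (rule cauchy_seqs_dominated[OF assms assms, of _ "cmod c + 1"])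
  show "0 < cmod c + 1" by (simp add: add_nonneg_pos)
  have "adist R (ascale R c (s j)) (ascale R c (s k)) \<le> (cmod c + 1) * adist R (s j) (s k)" for j k
    using assms by (simp add: dist_scale cauchy_seqs_in mult_right_mono)
  then show "adist R (ascale R c (s j)) (ascale R c (s k))
      \<le> (cmod c + 1) * (adist R (s j) (s k) + adist R (s j) (s k))" for j k
    by (rule order_trans) (simp add: mult_left_mono)
qed (use assms cauchy_seqs_in in auto)

lemma cauchy_seqs_norm_convergent:
  assumes s: "s \<in> cauchy_seqs R" shows "convergent (\<lambda>k. anorm R (s k))"
proof (rule real_Cauchy_convergent, rule CauchyI)
  fix \<epsilon> :: real assume "\<epsilon> > 0"
  then obtain N where N: "\<And>j k. j \<ge> N \<Longrightarrow> k \<ge> N \<Longrightarrow> adist R (s j) (s k) < \<epsilon>"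
    using cauchy_seqsD[OF s] by blast
  have "norm (anorm R (s j) - anorm R (s k)) < \<epsilon>" if "j \<ge> N" "k \<ge> N" for j k
    using N[OF that] norm_dist[OF cauchy_seqs_in[OF s] cauchy_seqs_in[OF s], of j k] by simp
  then show "\<exists>M. \<forall>m\<ge>M. \<forall>n\<ge>M. norm (anorm R (s m) - anorm R (s n)) < \<epsilon>" by blast
qed

lemma cauchy_seqs_bounded:
  assumes s: "s \<in> cauchy_seqs R"
  obtains B where "B > 0" "\<And>k. anorm R (s k) \<le> B"
proof -
  have "Bseq (\<lambda>k. anorm R (s k))"
    using cauchy_seqs_norm_convergent[OF s] by (rule convergent_imp_Bseq)
  then obtain B where "B > 0" "\<And>k. norm (anorm R (s k)) \<le> B" by (auto simp: Bseq_def)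
  then show thesis using that by (metis abs_le_D1 real_norm_def)
qed

lemma dist_mult:
  assumes "x \<in> acarrier R" "y \<in> acarrier R" "z \<in> acarrier R" "w \<in> acarrier R"
  shows "adist R (amult R x y) (amult R z w) \<le> anorm R x * adist R y w + adist R x z * anorm R w"
  using dist_triangle[of "amult R x y" "amult R x w" "amult R z w"] assms
    dist_mult_right[of y w x] dist_mult_left[of x z w] by simp

lemma dist_mult_bounded:
  assumes "x \<in> acarrier R" "y \<in> acarrier R" "z \<in> acarrier R" "w \<in> acarrier R"
    and "anorm R x \<le> B" "anorm R w \<le> D"
  shows "adist R (amult R x y) (amult R z w) \<le> (B + D) * (adist R x z + adist R y w)"
proof -
  have B: "0 \<le> B" "0 \<le> D" using assms norm_nonneg order_trans by blast+
  have "adist R (amult R x y) (amult R z w) \<le> B * adist R y w + adist R x z * D"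
    using assms by (intro order_trans[OF dist_mult[OF assms(1-4)]] add_mono mult_right_mono mult_left_mono) auto
  also have "\<dots> \<le> (B + D) * (adist R x z + adist R y w)"
    using B by (simp add: algebra_simps)
  finally show ?thesis .
qed

lemma cauchy_seqs_mult:
  assumes s: "s \<in> cauchy_seqs R" and t: "t \<in> cauchy_seqs R"
  shows "(\<lambda>k. amult R (s k) (t k)) \<in> cauchy_seqs R"
proof -
  obtain B where B: "B > 0" "\<And>k. anorm R (s k) \<le> B" using cauchy_seqs_bounded[OF s] by blast
  obtain D where D: "D > 0" "\<And>k. anorm R (t k) \<le> D" using cauchy_seqs_bounded[OF t] by blast
  show ?thesis
    by (rule cauchy_seqs_dominated[OF assms, of _ "B + D"])
      (use assms cauchy_seqs_in B D dist_mult_bounded in \<open>auto\<close>)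
qed

lemma null_relI:
  assumes "s \<in> cauchy_seqs R" "t \<in> cauchy_seqs R" "(\<lambda>k. adist R (s k) (t k)) \<longlonglongrightarrow> 0"
  shows "(s, t) \<in> null_rel R"
  using assms by (simp add: null_rel_def)

lemma null_rel_cauchy: "(s, t) \<in> null_rel R \<Longrightarrow> s \<in> cauchy_seqs R" "(s, t) \<in> null_rel R \<Longrightarrow> t \<in> cauchy_seqs R"
  by (auto simp: null_rel_def)

lemma null_rel_lim: "(s, t) \<in> null_rel R \<Longrightarrow> (\<lambda>k. adist R (s k) (t k)) \<longlonglongrightarrow> 0"
  by (auto simp: null_rel_def)

lemma equiv_null_rel: "equiv (cauchy_seqs R) (null_rel R)"
proof (rule equivI)
  show "refl_on (cauchy_seqs R) (null_rel R)"
    by (auto simp: refl_on_def null_rel_def)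
  show "sym (null_rel R)"
  proof (rule symI)
    fix s t assume st: "(s, t) \<in> null_rel R"
    have "(\<lambda>k. adist R (t k) (s k)) = (\<lambda>k. adist R (s k) (t k))" by (intro ext dist_commute)
    then show "(t, s) \<in> null_rel R" using st by (simp add: null_rel_def)
  qed
  show "null_rel R \<subseteq> cauchy_seqs R \<times> cauchy_seqs R" by (auto simp: null_rel_def)
  show "trans (null_rel R)"
  proof (rule transI)
    fix r s t assume rs: "(r, s) \<in> null_rel R" and st: "(s, t) \<in> null_rel R"
    note c = null_rel_cauchy(1)[OF rs] null_rel_cauchy[OF st]
    show "(r, t) \<in> null_rel R"
    proof (rule null_relI[OF c(1,3)])
      have "adist R (r k) (t k) \<le> adist R (r k) (s k) + adist R (s k) (t k)" for k
        by (rule dist_triangle) (use c cauchy_seqs_in in auto)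
      then show "(\<lambda>k. adist R (r k) (t k)) \<longlonglongrightarrow> 0"
        by (rule squeeze_null[OF tendsto_add_zero[OF null_rel_lim[OF rs] null_rel_lim[OF st]] dist_nonneg])
    qed
  qed
qed

lemma cls_eq_iff: "\<lbrakk>s \<in> cauchy_seqs R; t \<in> cauchy_seqs R\<rbrakk> \<Longrightarrow> cls s = cls t \<longleftrightarrow> (s, t) \<in> null_rel R"
  by (rule eq_equiv_class_iff[OF equiv_null_rel])

lemma cls_in: "s \<in> cauchy_seqs R \<Longrightarrow> cls s \<in> acarrier (completion R)"
  by (simp add: completion_def quotientI)

lemma completionE:
  assumes "P \<in> acarrier (completion R)"
  obtains s where "s \<in> cauchy_seqs R" "P = cls s"
  using assms by (auto simp: completion_def elim: quotientE)

lemma add_cls: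
  assumes s: "s \<in> cauchy_seqs R" and t: "t \<in> cauchy_seqs R"
  shows "aadd (completion R) (cls s) (cls t) = cls (\<lambda>k. aadd R (s k) (t k))"
proof -
  have "cls (\<lambda>k. aadd R (s' k) (t' k)) = cls (\<lambda>k. aadd R (s k) (t k))"
    if r: "(s, s') \<in> null_rel R" "(t, t') \<in> null_rel R" for s' t'
  proof -
    note c = null_rel_cauchy[OF r(1)] null_rel_cauchy[OF r(2)]
    have "(\<lambda>k. adist R (aadd R (s k) (t k)) (aadd R (s' k) (t' k))) \<longlonglongrightarrow> 0"
      by (rule squeeze_null[OF tendsto_add_zero[OF null_rel_lim[OF r(1)] null_rel_lim[OF r(2)]] dist_nonneg dist_add])
        (use c cauchy_seqs_in in blast)+
    then show ?thesis
      using c by (intro equiv_class_eq[OF equiv_null_rel, symmetric] null_relI cauchy_seqs_add)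
  qed
  then show ?thesis
    using equiv_class_self[OF equiv_null_rel s] equiv_class_self[OF equiv_null_rel t]
    unfolding completion_def normed_alg.simps by (intro SUP_eq_const) blast+
qed

lemma scale_cls:
  assumes s: "s \<in> cauchy_seqs R"
  shows "ascale (completion R) c (cls s) = cls (\<lambda>k. ascale R c (s k))"
proof -
  have "cls (\<lambda>k. ascale R c (s' k)) = cls (\<lambda>k. ascale R c (s k))" if r: "(s, s') \<in> null_rel R" for s'
  proof -
    note c = null_rel_cauchy[OF r]
    have "(\<lambda>k. adist R (ascale R c (s k)) (ascale R c (s' k))) \<longlonglongrightarrow> 0"
      using tendsto_mult_right_zero[OF null_rel_lim[OF r], of "cmod c"] c
      by (simp add: dist_scale cauchy_seqs_in)
    then show ?thesis
      using c by (intro equiv_class_eq[OF equiv_null_rel, symmetric] null_relI cauchy_seqs_scale)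
  qed
  then show ?thesis
    using equiv_class_self[OF equiv_null_rel s]
    unfolding completion_def normed_alg.simps by (intro SUP_eq_const) blast+
qed

lemma mult_cls:
  assumes s: "s \<in> cauchy_seqs R" and t: "t \<in> cauchy_seqs R"
  shows "amult (completion R) (cls s) (cls t) = cls (\<lambda>k. amult R (s k) (t k))"
proof -
  have "cls (\<lambda>k. amult R (s' k) (t' k)) = cls (\<lambda>k. amult R (s k) (t k))"
    if r: "(s, s') \<in> null_rel R" "(t, t') \<in> null_rel R" for s' t'
  proof -
    note c = null_rel_cauchy[OF r(1)] null_rel_cauchy[OF r(2)]
    obtain B where B: "\<And>k. anorm R (s k) \<le> B" using cauchy_seqs_bounded[OF c(1)] by blast
    obtain D where D: "\<And>k. anorm R (t' k) \<le> D" using cauchy_seqs_bounded[OF c(4)] by blast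
    have "(\<lambda>k. (B + D) * (adist R (s k) (s' k) + adist R (t k) (t' k))) \<longlonglongrightarrow> 0"
      by (intro tendsto_mult_right_zero tendsto_add_zero null_rel_lim r)
    then have "(\<lambda>k. adist R (amult R (s k) (t k)) (amult R (s' k) (t' k))) \<longlonglongrightarrow> 0"
      by (rule squeeze_null[OF _ dist_nonneg dist_mult_bounded])
        (use c cauchy_seqs_in B D in blast)+
    then show ?thesis
      using c by (intro equiv_class_eq[OF equiv_null_rel, symmetric] null_relI cauchy_seqs_mult)
  qed
  then show ?thesis
    using equiv_class_self[OF equiv_null_rel s] equiv_class_self[OF equiv_null_rel t]
    unfolding completion_def normed_alg.simps by (intro SUP_eq_const) blast+
qed

lemma norm_cls:
  assumes s: "s \<in> cauchy_seqs R"
  shows "(\<lambda>k. anorm R (s k)) \<longlonglongrightarrow> anorm (completion R) (cls s)"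
proof -
  obtain r where r: "(\<lambda>k. anorm R (s k)) \<longlonglongrightarrow> r"
    using cauchy_seqs_norm_convergent[OF s] by (auto simp: convergent_def)
  have all: "(\<lambda>k. anorm R (s' k)) \<longlonglongrightarrow> r" if s': "s' \<in> cls s" for s'
  proof -
    have rel: "(s, s') \<in> null_rel R" using s' by simp
    note c = null_rel_cauchy[OF rel]
    have "(\<lambda>k. anorm R (s' k) - anorm R (s k)) \<longlonglongrightarrow> 0"
    proof (rule Lim_null_comparison[OF always_eventually null_rel_lim[OF rel]], intro allI)
      show "norm (anorm R (s' k) - anorm R (s k)) \<le> adist R (s k) (s' k)" for k
        using norm_dist[of "s k" "s' k"] c cauchy_seqs_in by (simp add: abs_minus_commute)
    qed
    then show ?thesis using tendsto_add[OF _ r] by fastforce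
  qed
  have "(THE r. \<forall>s'\<in>cls s. (\<lambda>k. anorm R (s' k)) \<longlonglongrightarrow> r) = r"
    using all equiv_class_self[OF equiv_null_rel s] LIMSEQ_unique by (intro the_equality) blast+
  then show ?thesis using r by (simp add: completion_def)
qed

lemma norm_clsI: "s \<in> cauchy_seqs R \<Longrightarrow> (\<lambda>k. anorm R (s k)) \<longlonglongrightarrow> r \<Longrightarrow> anorm (completion R) (cls s) = r"
  using norm_cls LIMSEQ_unique by blast

lemma dist_cls:
  assumes s: "s \<in> cauchy_seqs R" and t: "t \<in> cauchy_seqs R"
  shows "(\<lambda>k. adist R (s k) (t k)) \<longlonglongrightarrow> adist (completion R) (cls s) (cls t)"
proof -
  have "(\<lambda>k. anorm R (asub R (s k) (t k))) \<longlonglongrightarrow> anorm (completion R) (cls (\<lambda>k. asub R (s k) (t k)))"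
    by (intro norm_cls cauchy_seqs_add cauchy_seqs_scale s t)
  moreover have "adist (completion R) (cls s) (cls t) = anorm (completion R) (cls (\<lambda>k. asub R (s k) (t k)))"
    by (simp only: adist_def cls_in s t simp_thms if_True scale_cls add_cls cauchy_seqs_scale)
  ultimately show ?thesis using s t by (simp add: dist_eq cauchy_seqs_in)
qed

lemma const_cauchy: "x \<in> acarrier R \<Longrightarrow> (\<lambda>k. x) \<in> cauchy_seqs R"
  by (auto simp: cauchy_seqs_def)

lemma seminormed_algebra_completion: "seminormed_algebra (completion R)"
proof
  show "acarrier (completion R) \<noteq> {}"
    using cls_in[OF const_cauchy[OF zero_closed]] by blast
  note cs = cauchy_seqs_add cauchy_seqs_scale cauchy_seqs_mult
  fix P Q S and c e :: complex
  assume P: "P \<in> acarrier (completion R)"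
  then obtain s where s: "s \<in> cauchy_seqs R" "P = cls s" by (rule completionE)
  note si = cauchy_seqs_in[OF s(1)]
  show "ascale (completion R) c P \<in> acarrier (completion R)"
    using s by (simp add: scale_cls cls_in cs)
  show "ascale (completion R) (c + e) P = aadd (completion R) (ascale (completion R) c P) (ascale (completion R) e P)"
    using s si by (simp add: scale_cls add_cls cs scale_add_left)
  show "ascale (completion R) c (ascale (completion R) e P) = ascale (completion R) (c * e) P"
    using s si by (simp add: scale_cls cs scale_scale)
  show "ascale (completion R) 1 P = P"
    using s si by (simp add: scale_cls scale_one)
  show "anorm (completion R) (ascale (completion R) c P) = cmod c * anorm (completion R) P"
    unfolding s(2) scale_cls[OF s(1)]
    by (rule norm_clsI[OF cauchy_seqs_scale[OF s(1)]])
      (simp add: norm_scale si tendsto_mult_left[OF norm_cls[OF s(1)]])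
  assume Q: "Q \<in> acarrier (completion R)"
  then obtain t where t: "t \<in> cauchy_seqs R" "Q = cls t" by (rule completionE)
  note ti = cauchy_seqs_in[OF t(1)]
  show "aadd (completion R) P Q \<in> acarrier (completion R)" "amult (completion R) P Q \<in> acarrier (completion R)"
    using s t by (simp_all add: add_cls mult_cls cls_in cs)
  show "aadd (completion R) P Q = aadd (completion R) Q P"
    unfolding s(2) t(2) add_cls[OF s(1) t(1)] add_cls[OF t(1) s(1)] by (simp only: add_commute[OF si ti])
  show "aadd (completion R) (ascale (completion R) 0 P) Q = Q"
    using s t si ti by (simp add: scale_cls add_cls cs scale_zero_add)
  show "ascale (completion R) c (aadd (completion R) P Q)
      = aadd (completion R) (ascale (completion R) c P) (ascale (completion R) c Q)"
    using s t si ti by (simp add: scale_cls add_cls cs scale_add)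
  show "amult (completion R) P (ascale (completion R) c Q) = ascale (completion R) c (amult (completion R) P Q)"
    using s t si ti by (simp add: scale_cls mult_cls cs mult_scale_right)
  show "amult (completion R) (ascale (completion R) c P) Q = ascale (completion R) c (amult (completion R) P Q)"
    using s t si ti by (simp add: scale_cls mult_cls cs mult_scale_left)
  show "anorm (completion R) (aadd (completion R) P Q) \<le> anorm (completion R) P + anorm (completion R) Q"
    unfolding s(2) t(2) add_cls[OF s(1) t(1)]
    by (rule LIMSEQ_le[OF norm_cls[OF cauchy_seqs_add[OF s(1) t(1)]] tendsto_add[OF norm_cls[OF s(1)] norm_cls[OF t(1)]]])
      (use si ti norm_triangle in blast)
  show "anorm (completion R) (amult (completion R) P Q) \<le> anorm (completion R) P * anorm (completion R) Q"
    unfolding s(2) t(2) mult_cls[OF s(1) t(1)]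
    by (rule LIMSEQ_le[OF norm_cls[OF cauchy_seqs_mult[OF s(1) t(1)]] tendsto_mult[OF norm_cls[OF s(1)] norm_cls[OF t(1)]]])
      (use si ti norm_mult in blast)
  assume S: "S \<in> acarrier (completion R)"
  then obtain r where r: "r \<in> cauchy_seqs R" "S = cls r" by (rule completionE)
  note ri = cauchy_seqs_in[OF r(1)]
  show "aadd (completion R) (aadd (completion R) P Q) S = aadd (completion R) P (aadd (completion R) Q S)"
    using s t r si ti ri by (simp add: add_cls cs add_assoc)
  show "amult (completion R) P (aadd (completion R) Q S)
      = aadd (completion R) (amult (completion R) P Q) (amult (completion R) P S)"
    using s t r si ti ri by (simp add: add_cls mult_cls cs mult_add_right)
  show "amult (completion R) (aadd (completion R) P Q) S
      = aadd (completion R) (amult (completion R) P S) (amult (completion R) Q S)"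
    using s t r si ti ri by (simp add: add_cls mult_cls cs mult_add_left)
qed

text \<open>A diagonal argument. Each class is approximated up to \<open>1 / (m + 1)\<close> by one
  element of the algebra, and these elements form a Cauchy sequence whose class is the limit.\<close>
lemma completion_complete:
  assumes P: "P \<in> cauchy_seqs (completion R)"
  shows "\<exists>L\<in>acarrier (completion R). (\<lambda>m. adist (completion R) (P m) L) \<longlonglongrightarrow> 0"
proof -
  interpret B: seminormed_algebra "completion R" by (rule seminormed_algebra_completion)
  have "\<forall>m. \<exists>s. s \<in> cauchy_seqs R \<and> P m = cls s"
    using B.cauchy_seqs_in[OF P] completionE by metis
  then obtain s where s: "\<And>m. s m \<in> cauchy_seqs R" "\<And>m. P m = cls (s m)" by metis
  have si: "s m k \<in> acarrier R" for m k using s cauchy_seqs_in by blast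
  have "\<exists>N. \<forall>j\<ge>N. \<forall>k\<ge>N. adist R (s m j) (s m k) < 1 / real (Suc m)" for m
    using cauchy_seqsD[OF s(1), of "1 / real (Suc m)" m] by (metis of_nat_0_less_iff zero_less_Suc zero_less_divide_1_iff)
  then obtain n where n: "\<And>m j k. j \<ge> n m \<Longrightarrow> k \<ge> n m \<Longrightarrow> adist R (s m j) (s m k) < 1 / real (Suc m)" by metis
  define t where "t m = s m (n m)" for m
  have ti: "t m \<in> acarrier R" for m by (simp add: t_def si)
  have tc: "cls (\<lambda>k. t m) \<in> acarrier (completion R)" for m by (rule cls_in[OF const_cauchy[OF ti]])
  have approx: "adist (completion R) (P m) (cls (\<lambda>k. t m)) \<le> 1 / real (Suc m)" for m
    unfolding s(2)
  proof (rule LIMSEQ_le_const2[OF dist_cls[OF s(1) const_cauchy[OF ti]]])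
    show "\<exists>N. \<forall>k\<ge>N. adist R (s m k) (t m) \<le> 1 / real (Suc m)"
      using n[of m _ "n m"] unfolding t_def by (meson less_imp_le order_refl)
  qed
  have tt: "adist R (t j) (t k) = adist (completion R) (cls (\<lambda>_. t j)) (cls (\<lambda>_. t k))" for j k
    using dist_cls[OF const_cauchy[OF ti] const_cauchy[OF ti], of j k] by (simp add: LIMSEQ_const_iff)
  have small: "\<exists>N. \<forall>m\<ge>N. 1 / real (Suc m) < \<epsilon>" if "\<epsilon> > 0" for \<epsilon>
    using order_tendstoD(2)[OF LIMSEQ_inverse_real_of_nat that]
    by (simp add: eventually_sequentially inverse_eq_divide)
  have t: "t \<in> cauchy_seqs R"
    unfolding cauchy_seqs_def
  proof (intro CollectI conjI allI impI)
    fix \<epsilon> :: real assume "\<epsilon> > 0"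
    then obtain N where N: "\<And>j k. j \<ge> N \<Longrightarrow> k \<ge> N \<Longrightarrow> adist (completion R) (P j) (P k) < \<epsilon> / 3"
      using B.cauchy_seqsD[OF P, of "\<epsilon> / 3"] by (metis divide_pos_pos zero_less_numeral)
    obtain N' where N': "\<And>m. m \<ge> N' \<Longrightarrow> 1 / real (Suc m) < \<epsilon> / 3" using small[of "\<epsilon> / 3"] \<open>\<epsilon> > 0\<close> by auto
    have "adist R (t j) (t k) < \<epsilon>" if "j \<ge> max N N'" "k \<ge> max N N'" for j k
    proof -
      let ?d = "adist (completion R)"
      have "?d (cls (\<lambda>_. t j)) (cls (\<lambda>_. t k)) \<le> ?d (cls (\<lambda>_. t j)) (P j) + ?d (P j) (cls (\<lambda>_. t k))"
        by (rule B.dist_triangle[OF tc B.cauchy_seqs_in[OF P] tc])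
      also have "?d (P j) (cls (\<lambda>_. t k)) \<le> ?d (P j) (P k) + ?d (P k) (cls (\<lambda>_. t k))"
        by (rule B.dist_triangle[OF B.cauchy_seqs_in[OF P] B.cauchy_seqs_in[OF P] tc])
      finally show ?thesis
        using approx[of j] approx[of k] N[of j k] N'[of j] N'[of k] that
          B.dist_commute[of "cls (\<lambda>_. t j)" "P j"] unfolding tt by simp
    qed
    then show "\<exists>N. \<forall>j\<ge>N. \<forall>k\<ge>N. adist R (t j) (t k) < \<epsilon>" by blast
  qed (use ti in auto)
  have "(\<lambda>m. adist (completion R) (P m) (cls t)) \<longlonglongrightarrow> 0"
  proof (rule LIMSEQ_I)
    fix \<epsilon> :: real assume "\<epsilon> > 0"
    then obtain N where N: "\<And>j k. j \<ge> N \<Longrightarrow> k \<ge> N \<Longrightarrow> adist R (t j) (t k) < \<epsilon> / 2"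
      using cauchy_seqsD[OF t, of "\<epsilon> / 2"] by (metis half_gt_zero)
    obtain N' where N': "\<And>m. m \<ge> N' \<Longrightarrow> 1 / real (Suc m) < \<epsilon> / 2" using small[of "\<epsilon> / 2"] \<open>\<epsilon> > 0\<close> by auto
    have "adist (completion R) (P m) (cls t) < \<epsilon>" if "m \<ge> max N N'" for m
    proof -
      have "adist (completion R) (cls (\<lambda>_. t m)) (cls t) \<le> \<epsilon> / 2"
        by (rule LIMSEQ_le_const2[OF dist_cls[OF const_cauchy[OF ti] t]]) (use N that less_imp_le in \<open>metis max.boundedE\<close>)
      then show ?thesis
        using B.dist_triangle[OF B.cauchy_seqs_in[OF P] tc cls_in[OF t], of m m] approx[of m] N'[of m] that by simp
    qed
    then show "\<exists>N. \<forall>m\<ge>N. norm (adist (completion R) (P m) (cls t) - 0) < \<epsilon>" by (intro exI[of _ "max N N'"]) simp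
  qed
  then show ?thesis using cls_in[OF t] by blast
qed

lemma banach_algebra_completion: "banach_algebra (completion R)"
proof -
  interpret B: seminormed_algebra "completion R" by (rule seminormed_algebra_completion)
  show ?thesis
  proof
    fix P assume P: "P \<in> acarrier (completion R)" and z: "anorm (completion R) P = 0"
    obtain s where s: "s \<in> cauchy_seqs R" "P = cls s" using P by (rule completionE)
    have z0: "azero (completion R) = cls (\<lambda>k. azero R)"
      using B.scale_zero[OF P] s by (simp add: scale_cls scale_zero cauchy_seqs_in)
    have "(\<lambda>k. adist R (s k) (azero R)) \<longlonglongrightarrow> 0"
      using norm_cls[OF s(1)] z s by (simp add: dist_zero cauchy_seqs_in)
    then show "P = azero (completion R)"
      unfolding s(2) z0 by (intro equiv_class_eq[OF equiv_null_rel] null_relI s const_cauchy zero_closed)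
  qed (rule completion_complete)
qed

end

section \<open>Automatic continuity for linear maps of Banach algebras\<close>

locale banach_linear_map = A: banach_algebra A + B: banach_algebra B
  for A :: "'c normed_alg" and B :: "'d normed_alg" +
  fixes \<gamma> :: "'c \<Rightarrow> 'd"
  assumes map_in [simp]: "x \<in> acarrier A \<Longrightarrow> \<gamma> x \<in> acarrier B"
    and map_add: "\<lbrakk>x \<in> acarrier A; y \<in> acarrier A\<rbrakk> \<Longrightarrow> \<gamma> (aadd A x y) = aadd B (\<gamma> x) (\<gamma> y)"
    and map_scale: "x \<in> acarrier A \<Longrightarrow> \<gamma> (ascale A c x) = ascale B c (\<gamma> x)"
begin

lemma map_zero: "\<gamma> (azero A) = azero B"
  using map_scale[of "azero A" 0] by (simp add: A.scale_azero B.scale_zero)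

text \<open>The closed graph theorem by Baire category. The sets of elements whose image has norm at
  most \<open>n\<close> cover \<open>A\<close>, so some closure contains a ball. Differences and multiples then show that every
  \<open>x\<close> can be approximated arbitrarily well by elements \<open>t\<close> with \<open>\<parallel>\<gamma> t\<parallel> \<le> K \<parallel>x\<parallel>\<close>. Subtracting such
  approximants again and again gives remainders that tend to \<open>0\<close> while their images converge
  geometrically; the limit of the images is \<open>0\<close> by hypothesis, which bounds the image of \<open>x\<close>.\<close>
lemma closed_graph:
  assumes closed: "\<And>s b. \<lbrakk>range s \<subseteq> acarrier A; b \<in> acarrier B;
      (\<lambda>k. anorm A (s k)) \<longlonglongrightarrow> 0; (\<lambda>k. adist B (\<gamma> (s k)) b) \<longlonglongrightarrow> 0\<rbrakk> \<Longrightarrow> b = azero B"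
  shows "\<exists>K. \<forall>x\<in>acarrier A. anorm B (\<gamma> x) \<le> K * anorm A x"
proof -
  define V where "V n = {x \<in> acarrier A. anorm B (\<gamma> x) \<le> real n}" for n
  define F where "F n = A.mtopology closure_of (V n)" for n
  have cover: "\<Union>(range F) = acarrier A"
  proof
    show "\<Union>(range F) \<subseteq> acarrier A"
      using closure_of_subset_topspace[of A.mtopology] by (auto simp: F_def)
    show "acarrier A \<subseteq> \<Union>(range F)"
    proof
      fix x assume x: "x \<in> acarrier A"
      obtain n where "anorm B (\<gamma> x) \<le> real n" using real_arch_simple by blast
      then have "x \<in> V n" using x by (simp add: V_def)
      then have "x \<in> F n" unfolding F_def by (intro closure_of_subset[THEN subsetD]) (auto simp: V_def)
      then show "x \<in> \<Union>(range F)" by blast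
    qed
  qed
  have "\<exists>n. A.mtopology interior_of (F n) \<noteq> {}"
  proof (rule ccontr)
    assume "\<not> ?thesis"
    then have "A.mtopology interior_of \<Union>(range F) = {}"
      by (intro A.metric_Baire_category_alt[OF A.mcomplete]) (auto simp: F_def)
    then show False
      unfolding cover using A.carrier_nonempty interior_of_topspace[of A.mtopology] by simp
  qed
  then obtain n a r where ar: "a \<in> acarrier A" "r > 0" "A.mball a r \<subseteq> F n"
    unfolding A.metric_interior_of by blast
  have near: "\<exists>p\<in>acarrier A. anorm B (\<gamma> p) \<le> real n \<and> adist A x p < \<epsilon>" if "x \<in> F n" "\<epsilon> > 0" for x \<epsilon>
    using that unfolding F_def A.metric_closure_of V_def by (auto simp: A.mball_def)
  \<comment> \<open>\<open>x\<close> is scaled to norm \<open>r / 2\<close>, where it differs from an element with image of norm at most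
    \<open>2 n\<close> by as little as desired.\<close>
  define K where "K = 4 * real n / r"
  have K: "K \<ge> 0" using ar by (simp add: K_def)
  have step: "\<exists>t\<in>acarrier A. adist A x t \<le> \<epsilon> \<and> anorm B (\<gamma> t) \<le> K * anorm A x"
    if x: "x \<in> acarrier A" and e: "\<epsilon> > 0" for x \<epsilon>
  proof (cases "anorm A x = 0")
    case True
    then show ?thesis using x e
      by (intro bexI[of _ "azero A"]) (auto simp: A.dist_zero map_zero B.norm_zero)
  next
    case False
    then have nx: "anorm A x > 0" using A.norm_nonneg[OF x] by linarith
    define c where "c = r / (2 * anorm A x)"
    have c: "c > 0" using nx ar by (simp add: c_def)
    define y where "y = ascale A (of_real c) x"
    have y: "y \<in> acarrier A" using x by (simp add: y_def)
    have ny: "anorm A y = r / 2" using nx c x by (simp add: y_def A.norm_scale) (simp add: c_def)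
    have "adist A a (aadd A a y) = anorm A y"
      using A.dist_add_left[of a "azero A" y] ar y A.dist_zero[of y] A.dist_commute[of y "azero A"]
      by (simp add: A.add_zero)
    then have "aadd A a y \<in> F n" "a \<in> F n" using ar y ny by (auto intro!: subsetD[OF ar(3)])
    moreover have d: "c * \<epsilon> / 2 > 0" using c e by simp
    ultimately obtain p q where p: "p \<in> acarrier A" "anorm B (\<gamma> p) \<le> real n" "adist A (aadd A a y) p < c * \<epsilon> / 2"
      and q: "q \<in> acarrier A" "anorm B (\<gamma> q) \<le> real n" "adist A a q < c * \<epsilon> / 2"
      using near by meson
    have eq: "y = asub A (aadd A a y) a"
      using y ar A.sub_self[of a] by (simp add: A.add_commute[of a y] A.add_assoc A.add_zero)
    have "adist A y (asub A p q) \<le> adist A (aadd A a y) p + adist A (ascale A (-1) a) (ascale A (-1) q)"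
      using A.dist_add[of "aadd A a y" "ascale A (-1) a" p "ascale A (-1) q"] eq p q ar y by simp
    also have "\<dots> < c * \<epsilon>" using p q ar A.dist_scale[of a q "-1"] by simp
    finally have yd: "adist A y (asub A p q) < c * \<epsilon>" .
    define t where "t = ascale A (of_real (1 / c)) (asub A p q)"
    have t: "t \<in> acarrier A" using p q by (simp add: t_def)
    have "x = ascale A (of_real (1 / c)) y"
      using x c by (simp add: y_def A.scale_scale A.scale_one flip: of_real_mult)
    then have "adist A x t = (1 / c) * adist A y (asub A p q)"
      using A.dist_scale[of y "asub A p q" "of_real (1 / c)"] y p q c by (simp add: t_def norm_divide)
    also have "\<dots> \<le> \<epsilon>" using yd c by (simp add: field_simps)
    finally have 1: "adist A x t \<le> \<epsilon>" .
    have "anorm B (\<gamma> t) = (1 / c) * anorm B (asub B (\<gamma> p) (\<gamma> q))"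
      using p q c by (simp add: t_def map_scale map_add B.norm_scale norm_divide)
    also have "\<dots> \<le> (1 / c) * (real n + real n)"
      using B.norm_triangle[of "\<gamma> p" "ascale B (-1) (\<gamma> q)"] p q c by (intro mult_left_mono) (simp_all add: B.norm_scale)
    also have "\<dots> = K * anorm A x" using ar nx by (simp add: K_def c_def field_simps)
    finally show ?thesis using 1 t by blast
  qed
  have "anorm B (\<gamma> x) \<le> 2 * K * anorm A x" if x: "x \<in> acarrier A" for x
  proof (cases "anorm A x = 0")
    case True
    then show ?thesis using A.norm_definite[OF x] by (simp add: map_zero B.norm_zero)
  next
    case False
    define N where "N = anorm A x"
    have N: "N > 0" using False A.norm_nonneg[OF x] by (simp add: N_def)
    obtain \<tau> where \<tau>: "\<And>y \<epsilon>. y \<in> acarrier A \<Longrightarrow> \<epsilon> > 0 \<Longrightarrow>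
        \<tau> y \<epsilon> \<in> acarrier A \<and> adist A y (\<tau> y \<epsilon>) \<le> \<epsilon> \<and> anorm B (\<gamma> (\<tau> y \<epsilon>)) \<le> K * anorm A y"
      using step by metis
    \<comment> \<open>The remainders: \<open>s (k + 1) = s k - t k\<close>, where \<open>t k\<close> approximates \<open>s k\<close> within \<open>N / 2 ^ (k + 1)\<close>.\<close>
    define s where "s = rec_nat x (\<lambda>k y. asub A y (\<tau> y (N * (1/2) ^ Suc k)))"
    define t where "t k = \<tau> (s k) (N * (1/2) ^ Suc k)" for k
    have s0: "s 0 = x" and sS: "s (Suc k) = asub A (s k) (t k)" for k
      by (simp_all add: s_def t_def)
    have e: "N * (1/2) ^ Suc k > 0" for k using N by simp
    have s: "s k \<in> acarrier A \<and> anorm A (s k) \<le> N * (1/2) ^ k" for k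
    proof (induction k)
      case 0 then show ?case using x by (simp add: s0 N_def)
    next
      case (Suc k)
      then have "t k \<in> acarrier A" "adist A (s k) (t k) \<le> N * (1/2) ^ Suc k"
        using \<tau>[OF _ e[of k], of "s k"] by (auto simp: t_def)
      then show ?case using Suc by (simp add: sS A.dist_eq)
    qed
    have t: "t k \<in> acarrier A" "anorm B (\<gamma> (t k)) \<le> K * N * (1/2) ^ k" for k
    proof -
      show "t k \<in> acarrier A" using \<tau>[OF _ e[of k], of "s k"] s[of k] by (simp add: t_def)
      have "anorm B (\<gamma> (t k)) \<le> K * anorm A (s k)" using \<tau>[OF _ e[of k], of "s k"] s[of k] by (simp add: t_def)
      also have "\<dots> \<le> K * (N * (1/2) ^ k)" using s[of k] K by (intro mult_left_mono) auto
      finally show "anorm B (\<gamma> (t k)) \<le> K * N * (1/2) ^ k" by (simp add: mult.assoc)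
    qed
    have d: "adist B (\<gamma> (s k)) (\<gamma> (s (Suc k))) \<le> K * N * (1/2) ^ k" for k
    proof -
      have "adist B (aadd B (\<gamma> (s k)) (azero B)) (aadd B (\<gamma> (s k)) (ascale B (-1) (\<gamma> (t k)))) = anorm B (\<gamma> (t k))"
        using s[of k] t(1)[of k] B.dist_zero[of "ascale B (-1) (\<gamma> (t k))"] B.dist_commute[of "azero B"]
        by (simp add: B.dist_add_left B.norm_scale)
      then show ?thesis using s[of k] t[of k] by (simp add: sS map_add map_scale B.add_zero)
    qed
    obtain l where l: "l \<in> acarrier B" "(\<lambda>k. adist B (\<gamma> (s k)) l) \<longlonglongrightarrow> 0" "adist B (\<gamma> (s 0)) l \<le> 2 * (K * N) * (1/2) ^ 0"
      using B.geometric_imp_convergent[of "\<lambda>k. \<gamma> (s k)" "K * N"] d s by (metis image_subsetI map_in)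
    have "(\<lambda>k. anorm A (s k)) \<longlonglongrightarrow> 0"
    proof (rule squeeze_null)
      show "(\<lambda>k. N * (1/2) ^ k) \<longlonglongrightarrow> 0"
        by (intro tendsto_mult_right_zero LIMSEQ_realpow_zero) auto
    qed (use s in auto)
    then have "l = azero B" using closed[of s l] l s by blast
    then show ?thesis using l(3) x by (simp add: s0 B.dist_zero N_def)
  qed
  then show ?thesis by blast
qed

lemma bounded_imp_continuous:
  assumes K: "\<And>x. x \<in> acarrier A \<Longrightarrow> anorm B (\<gamma> x) \<le> K * anorm A x"
  shows "continuous_map A.mtopology B.mtopology \<gamma>"
  unfolding A.metric_continuous_map[OF B.Metric_space_axioms]
proof (intro conjI ballI allI impI)
  show "\<gamma> ` acarrier A \<subseteq> acarrier B" by auto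
  fix a and \<epsilon> :: real assume a: "a \<in> acarrier A" and e: "\<epsilon> > 0"
  have "adist B (\<gamma> a) (\<gamma> x) < \<epsilon>" if x: "x \<in> acarrier A" "adist A a x < \<epsilon> / (\<bar>K\<bar> + 1)" for x
  proof -
    have "adist B (\<gamma> a) (\<gamma> x) = anorm B (\<gamma> (asub A a x))"
      using a x by (simp add: B.dist_eq map_add map_scale)
    also have "\<dots> \<le> K * adist A a x" using K[of "asub A a x"] a x by (simp add: A.dist_eq)
    also have "\<dots> \<le> (\<bar>K\<bar> + 1) * adist A a x" by (intro mult_right_mono) auto
    also have "\<dots> < \<epsilon>" using x(2) by (simp add: field_simps add_nonneg_pos)
    finally show ?thesis .
  qed
  then show "\<exists>\<delta>>0. \<forall>x. x \<in> acarrier A \<and> adist A a x < \<delta> \<longrightarrow> adist B (\<gamma> a) (\<gamma> x) < \<epsilon>"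
    using e by (intro exI[of _ "\<epsilon> / (\<bar>K\<bar> + 1)"]) (auto simp: add_nonneg_pos)
qed

end

text \<open>Multiplication by \<open>u\<close> acts as a weighted shift on the coordinates \<open>\<phi> 0, \<phi> 1, \<dots>\<close>. Hence
  \<open>\<phi> k\<close> vanishes on \<open>u\<^sup>k\<^sup>+\<^sup>1 B\<close>, and on \<open>u\<^sup>k x\<close> it equals a nonzero multiple of \<open>\<phi> 0 x\<close>.\<close>
definition shifted_functionals :: "'d normed_alg \<Rightarrow> 'd \<Rightarrow> (nat \<Rightarrow> 'd \<Rightarrow> complex) \<Rightarrow> bool" where
  "shifted_functionals B u \<phi> \<longleftrightarrow>
     (\<forall>k. \<forall>x\<in>acarrier B. \<forall>y\<in>acarrier B. \<phi> k (aadd B x y) = \<phi> k x + \<phi> k y) \<and>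
     (\<forall>k c. \<forall>x\<in>acarrier B. \<phi> k (ascale B c x) = c * \<phi> k x) \<and>
     (\<forall>k. \<forall>x\<in>acarrier B. cmod (\<phi> k x) \<le> anorm B x) \<and>
     (\<forall>x\<in>acarrier B. \<phi> 0 (amult B u x) = 0) \<and>
     (\<forall>k. \<exists>c. c \<noteq> 0 \<and> (\<forall>x\<in>acarrier B. \<phi> (Suc k) (amult B u x) = c * \<phi> k x))"

context banach_linear_map
begin

text \<open>The gliding hump argument behind Sinclair's lemma. If \<open>\<phi> 0 b \<noteq> 0\<close>, multiples of the \<open>s k\<close>
  give arbitrarily small \<open>x\<close> with \<open>\<phi> 0 (\<gamma> x)\<close> arbitrarily large. Choose \<open>x\<^sub>0, x\<^sub>1, \<dots>\<close> inductively and so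
  small that \<open>z = \<Sum>\<^sub>j a\<^sup>j x\<^sub>j\<close> converges. The functional \<open>\<phi> k\<close> does not see the terms of \<open>\<gamma> z\<close> with
  \<open>j > k\<close>, because their sum is \<open>u\<^sup>k\<^sup>+\<^sup>1\<close> times an element of \<open>B\<close>, namely the image of a convergent sum.
  As \<open>x\<^sub>k\<close> can be chosen after the terms with \<open>j < k\<close>, it can force \<open>\<bar>\<phi> k (\<gamma> z)\<bar> \<ge> k\<close>. Since each \<open>\<phi> k\<close>
  is a contraction, \<open>\<gamma> z\<close> would have infinite norm.\<close>
lemma gliding_hump:
  assumes a: "a \<in> acarrier A"
    and intertwine: "\<And>x. x \<in> acarrier A \<Longrightarrow> \<gamma> (amult A a x) = amult B u (\<gamma> x)"
    and \<phi>: "shifted_functionals B u \<phi>"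
    and s: "range s \<subseteq> acarrier A" "(\<lambda>k. anorm A (s k)) \<longlonglongrightarrow> 0"
    and b: "b \<in> acarrier B" "(\<lambda>k. adist B (\<gamma> (s k)) b) \<longlonglongrightarrow> 0"
  shows "\<phi> 0 b = 0"
proof (rule ccontr)
  assume nz: "\<phi> 0 b \<noteq> 0"
  have \<phi>_add: "\<phi> k (aadd B x y) = \<phi> k x + \<phi> k y" if "x \<in> acarrier B" "y \<in> acarrier B" for k x y
    using \<phi> that by (simp add: shifted_functionals_def)
  have \<phi>_scale: "\<phi> k (ascale B c x) = c * \<phi> k x" if "x \<in> acarrier B" for k c x
    using \<phi> that by (simp add: shifted_functionals_def)
  have \<phi>_le: "cmod (\<phi> k x) \<le> anorm B x" if "x \<in> acarrier B" for k x
    using \<phi> that by (simp add: shifted_functionals_def)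
  have \<phi>_0: "\<phi> 0 (amult B u x) = 0" if "x \<in> acarrier B" for x
    using \<phi> that by (simp add: shifted_functionals_def)
  obtain c where c: "\<And>k. c k \<noteq> 0" "\<And>k x. x \<in> acarrier B \<Longrightarrow> \<phi> (Suc k) (amult B u x) = c k * \<phi> k x"
    using \<phi> unfolding shifted_functionals_def by metis
  define T where "T = amult A a"
  have T_in [simp]: "T x \<in> acarrier A" if "x \<in> acarrier A" for x using a that by (simp add: T_def)
  have \<gamma>T: "\<gamma> (T x) = amult B u (\<gamma> x)" if "x \<in> acarrier A" for x
    using intertwine[OF that] by (simp add: T_def)
  have u\<gamma>: "amult B u (\<gamma> x) \<in> acarrier B" if "x \<in> acarrier A" for x
    using map_in[OF T_in[OF that]] that by (simp add: \<gamma>T)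
  have T_add: "T (aadd A x y) = aadd A (T x) (T y)" if "x \<in> acarrier A" "y \<in> acarrier A" for x y
    using a that by (simp add: T_def A.mult_add_right)
  have T_zero: "T (azero A) = azero A"
    using A.mult_scale_right[of a "azero A" 0] a by (simp add: T_def A.scale_azero A.scale_zero)
  define M where "M = anorm A a + 1"
  have M: "M \<ge> 1" using a by (simp add: M_def)
  have T_dist: "adist A (T x) (T y) \<le> M * adist A x y" if "x \<in> acarrier A" "y \<in> acarrier A" for x y
  proof -
    have "adist A (T x) (T y) \<le> anorm A a * adist A x y" using a that by (simp add: T_def A.dist_mult_right)
    also have "\<dots> \<le> M * adist A x y" by (intro mult_right_mono) (auto simp: M_def)
    finally show ?thesis .
  qed
  have Tk_in [simp]: "(T ^^ k) x \<in> acarrier A" if "x \<in> acarrier A" for k x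
    using that by (induction k) auto
  have Tk_add: "(T ^^ k) (aadd A x y) = aadd A ((T ^^ k) x) ((T ^^ k) y)"
    if "x \<in> acarrier A" "y \<in> acarrier A" for k x y
    using that by (induction k) (auto simp: T_add)
  have \<phi>_Tk: "\<phi> k (\<gamma> ((T ^^ k) x)) = (\<Prod>j<k. c j) * \<phi> 0 (\<gamma> x)" if "x \<in> acarrier A" for k x
    using that by (induction k) (auto simp: \<gamma>T c)
  have big: "\<exists>x\<in>acarrier A. anorm A x \<le> \<delta> \<and> cmod (\<phi> 0 (\<gamma> x)) \<ge> C" if d: "\<delta> > 0" for \<delta> C
  proof -
    have si: "s k \<in> acarrier A" for k using s by auto
    \<comment> \<open>For large \<open>k\<close> the value \<open>\<bar>\<phi> 0 (\<gamma> (s k))\<bar>\<close> is at least \<open>\<bar>\<phi> 0 b\<bar> / 2\<close>, so the factor \<open>t\<close> raises it to at least \<open>C\<close>.\<close>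
    define t where "t = 2 * \<bar>C\<bar> / cmod (\<phi> 0 b) + 1"
    have t: "t > 0" by (auto simp: t_def intro!: add_nonneg_pos)
    have h: "cmod (\<phi> 0 b) / 2 > 0" "\<delta> / t > 0" using nz d t by auto
    have "\<forall>\<^sub>F k in sequentially. anorm A (s k) < \<delta> / t \<and> adist B (\<gamma> (s k)) b < cmod (\<phi> 0 b) / 2"
      by (intro eventually_conj order_tendstoD(2)[OF s(2)] order_tendstoD(2)[OF b(2)] h)
    then obtain k where k: "anorm A (s k) < \<delta> / t" "adist B (\<gamma> (s k)) b < cmod (\<phi> 0 b) / 2"
      by (auto simp: eventually_sequentially)
    have "cmod (\<phi> 0 (\<gamma> (s k)) - \<phi> 0 b) = cmod (\<phi> 0 (asub B (\<gamma> (s k)) b))"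
      using b si by (simp add: \<phi>_add \<phi>_scale)
    also have "\<dots> \<le> adist B (\<gamma> (s k)) b" using b si by (simp add: \<phi>_le B.dist_eq)
    finally have "cmod (\<phi> 0 (\<gamma> (s k))) \<ge> cmod (\<phi> 0 b) / 2"
      using k(2) norm_triangle_ineq2[of "\<phi> 0 b" "\<phi> 0 (\<gamma> (s k))"] norm_minus_commute[of "\<phi> 0 b"] by simp
    then have "t * cmod (\<phi> 0 (\<gamma> (s k))) \<ge> t * (cmod (\<phi> 0 b) / 2)" using t by (intro mult_left_mono) auto
    moreover have "t * (cmod (\<phi> 0 b) / 2) \<ge> \<bar>C\<bar>" using nz by (simp add: t_def field_simps)
    ultimately have "C \<le> t * cmod (\<phi> 0 (\<gamma> (s k)))" by linarith
    then have "cmod (\<phi> 0 (\<gamma> (ascale A (of_real t) (s k)))) \<ge> C"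
      using t si by (simp add: map_scale \<phi>_scale norm_mult)
    moreover have "anorm A (ascale A (of_real t) (s k)) \<le> \<delta>"
      using t si k(1) by (simp add: A.norm_scale field_simps)
    ultimately show ?thesis using si by (intro bexI[of _ "ascale A (of_real t) (s k)"]) auto
  qed
  have "\<exists>x. x \<in> acarrier A \<and> anorm A x \<le> (1 / (2 * M)) ^ k \<and>
      cmod (\<phi> 0 (\<gamma> x)) \<ge> (real k + cmod (\<phi> k (\<gamma> w))) / cmod (\<Prod>j<k. c j)" for k w
    using big[of "(1 / (2 * M)) ^ k"] M by fastforce
  then obtain X where X: "\<And>k w. X k w \<in> acarrier A" "\<And>k w. anorm A (X k w) \<le> (1 / (2 * M)) ^ k"
      "\<And>k w. cmod (\<phi> 0 (\<gamma> (X k w))) \<ge> (real k + cmod (\<phi> k (\<gamma> w))) / cmod (\<Prod>j<k. c j)"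
    by metis
  \<comment> \<open>The partial sums \<open>w k = \<Sum>\<^sub>j\<^sub><\<^sub>k a\<^sup>j x\<^sub>j\<close>, on which the choice of \<open>x\<^sub>k\<close> depends.\<close>
  define w where "w = rec_nat (azero A) (\<lambda>k w. aadd A w ((T ^^ k) (X k w)))"
  define x where "x k = X k (w k)" for k
  have w0: "w 0 = azero A" and wS: "w (Suc k) = aadd A (w k) ((T ^^ k) (x k))" for k
    by (simp_all add: w_def x_def)
  have x_in [simp]: "x k \<in> acarrier A" for k by (simp add: x_def X)
  have w_in [simp]: "w k \<in> acarrier A" for k by (induction k) (auto simp: w0 wS)
  \<comment> \<open>\<open>p m k\<close> is the sum of the first \<open>m\<close> terms of the tail \<open>z k = \<Sum>\<^sub>j a\<^sup>j x\<^sub>k\<^sub>+\<^sub>j\<close>, written in Horner form.\<close>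
  define p where "p = rec_nat (\<lambda>k. azero A) (\<lambda>m q k. aadd A (x k) (T (q (Suc k))))"
  have p0: "p 0 k = azero A" and pS: "p (Suc m) k = aadd A (x k) (T (p m (Suc k)))" for m k
    by (simp_all add: p_def)
  have p_in [simp]: "p m k \<in> acarrier A" for m k by (induction m arbitrary: k) (auto simp: p0 pS)
  have p_dist: "adist A (p m k) (p (Suc m) k) \<le> M ^ m * anorm A (x (k + m))" for m k
  proof (induction m arbitrary: k)
    case 0
    then show ?case
      using A.dist_zero[of "x k"] A.dist_commute[of "azero A"] by (simp add: p0 pS T_zero A.add_zero)
  next
    case (Suc m)
    have "adist A (p (Suc m) k) (p (Suc (Suc m)) k) = adist A (T (p m (Suc k))) (T (p (Suc m) (Suc k)))"
      unfolding pS[of "Suc m" k] by (subst pS) (simp add: A.dist_add_left)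
    also have "\<dots> \<le> M * adist A (p m (Suc k)) (p (Suc m) (Suc k))" by (simp add: T_dist)
    also have "\<dots> \<le> M * (M ^ m * anorm A (x (Suc k + m)))" using M by (intro mult_left_mono Suc) auto
    finally show ?case by simp
  qed
  have p_geo: "adist A (p m k) (p (Suc m) k) \<le> 1 * (1/2) ^ m" for m k
  proof -
    have "M ^ m * anorm A (x (k + m)) \<le> M ^ m * (1 / (2 * M)) ^ (k + m)"
      using M by (intro mult_left_mono) (auto simp: x_def X)
    also have "\<dots> = (1/2) ^ m * (1 / (2 * M)) ^ k"
      using M by (simp add: power_add power_divide power_mult_distrib field_simps)
    also have "\<dots> \<le> (1/2) ^ m" using M by (intro mult_left_le power_le_one) (auto simp: field_simps)
    finally show ?thesis using p_dist[of m k] by linarith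
  qed
  have "\<exists>l. l \<in> acarrier A \<and> (\<lambda>m. adist A (p m k) l) \<longlonglongrightarrow> 0" for k
    using A.geometric_imp_convergent[of "\<lambda>m. p m k" 1] p_geo p_in by (metis image_subsetI)
  then obtain z where z: "\<And>k. z k \<in> acarrier A" "\<And>k. (\<lambda>m. adist A (p m k) (z k)) \<longlonglongrightarrow> 0" by metis
  have z_rec: "z k = aadd A (x k) (T (z (Suc k)))" for k
  proof -
    let ?y = "aadd A (x k) (T (z (Suc k)))"
    have y: "?y \<in> acarrier A" using z by simp
    have "(\<lambda>m. adist A (p (Suc m) k) (z k) + M * adist A (p m (Suc k)) (z (Suc k))) \<longlonglongrightarrow> 0"
      by (intro tendsto_add_zero tendsto_mult_right_zero z(2) LIMSEQ_Suc[OF z(2)])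
    moreover have "adist A (z k) ?y \<le> adist A (p (Suc m) k) (z k) + M * adist A (p m (Suc k)) (z (Suc k))" for m
    proof -
      have "adist A (p (Suc m) k) ?y \<le> M * adist A (p m (Suc k)) (z (Suc k))"
        using z by (simp add: pS A.dist_add_left T_dist)
      then show ?thesis
        using A.dist_triangle[of "z k" "p (Suc m) k" ?y] y z A.dist_commute[of "z k" "p (Suc m) k"] by simp
    qed
    ultimately have "(\<lambda>m::nat. adist A (z k) ?y) \<longlonglongrightarrow> 0" by (intro squeeze_null[OF _ A.dist_nonneg])
    then have "adist A (z k) ?y = 0" by (simp add: LIMSEQ_const_iff)
    then show ?thesis using y z by simp
  qed
  have \<phi>z: "\<phi> 0 (\<gamma> (z k)) = \<phi> 0 (\<gamma> (x k))" for k
    by (subst z_rec) (use z in \<open>simp add: map_add \<gamma>T u\<gamma> \<phi>_add \<phi>_0\<close>)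
  have z0: "z 0 = aadd A (w k) ((T ^^ k) (z k))" for k
  proof (induction k)
    case 0 then show ?case using z by (simp add: w0 A.zero_add)
  next
    case (Suc k)
    have "(T ^^ k) (z k) = aadd A ((T ^^ k) (x k)) ((T ^^ Suc k) (z (Suc k)))"
      by (subst z_rec) (use z in \<open>simp add: Tk_add funpow_swap1\<close>)
    then show ?case using Suc z Tk_in[of "z (Suc k)" "Suc k"] by (simp add: wS A.add_assoc del: funpow.simps)
  qed
  have "real k \<le> anorm B (\<gamma> (z 0))" for k
  proof -
    let ?C = "\<Prod>j<k. c j"
    have C: "cmod ?C > 0" using c(1) by simp
    have "\<phi> k (\<gamma> (z 0)) = \<phi> k (\<gamma> (w k)) + ?C * \<phi> 0 (\<gamma> (x k))"
      by (subst z0[of k]) (use z in \<open>simp add: map_add \<phi>_add \<phi>_Tk \<phi>z\<close>)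
    then have "cmod ?C * cmod (\<phi> 0 (\<gamma> (x k))) \<le> cmod (\<phi> k (\<gamma> (z 0))) + cmod (\<phi> k (\<gamma> (w k)))"
      using norm_triangle_ineq4[of "\<phi> k (\<gamma> (z 0))" "\<phi> k (\<gamma> (w k))"] by (simp add: norm_mult)
    moreover have "real k + cmod (\<phi> k (\<gamma> (w k))) \<le> cmod ?C * cmod (\<phi> 0 (\<gamma> (x k)))"
      using X(3)[of k "w k"] C by (simp add: x_def divide_le_eq mult.commute)
    ultimately show ?thesis using \<phi>_le[of "\<gamma> (z 0)" k] z by simp
  qed
  then show False using reals_Archimedean2[of "anorm B (\<gamma> (z 0))"] by (meson not_le)
qed

end

text \<open>By the closed graph theorem, \<open>\<gamma>\<close> can only fail to be continuous if there are \<open>s k \<rightarrow> 0\<close>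
  with \<open>\<gamma> (s k) \<rightarrow> b \<noteq> 0\<close>. Surjectivity lets the shift \<open>u\<close> that separates \<open>b\<close> be lifted to \<open>A\<close>, and
  multiplicativity makes \<open>\<gamma>\<close> intertwine the two multiplications, as the gliding hump requires.\<close>
theorem isomorphism_continuous:
  assumes A: "banach_algebra A" and B: "banach_algebra B"
    and iso: "algebra_isomorphism A B \<gamma>"
    and sep: "\<And>b. \<lbrakk>b \<in> acarrier B; b \<noteq> azero B\<rbrakk>
      \<Longrightarrow> \<exists>u\<in>acarrier B. \<exists>\<phi>. shifted_functionals B u \<phi> \<and> \<phi> 0 b \<noteq> 0"
  shows "continuous_map (norm_topology A) (norm_topology B) \<gamma>"
proof -
  interpret A: banach_algebra A by (rule A)
  interpret B: banach_algebra B by (rule B)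
  interpret banach_linear_map A B \<gamma>
    by unfold_locales (use iso in \<open>auto simp: algebra_isomorphism_def bij_betw_def\<close>)
  have "b = azero B"
    if s: "range s \<subseteq> acarrier A" "b \<in> acarrier B"
      "(\<lambda>k. anorm A (s k)) \<longlonglongrightarrow> 0" "(\<lambda>k. adist B (\<gamma> (s k)) b) \<longlonglongrightarrow> 0" for s b
  proof (rule ccontr)
    assume "b \<noteq> azero B"
    then obtain u \<phi> where u: "u \<in> acarrier B" "shifted_functionals B u \<phi>" "\<phi> 0 b \<noteq> 0" using sep s by blast
    have "u \<in> \<gamma> ` acarrier A" using iso u(1) by (simp add: algebra_isomorphism_def bij_betw_def)
    then obtain a where a: "a \<in> acarrier A" "\<gamma> a = u" by blast
    have "\<gamma> (amult A a x) = amult B u (\<gamma> x)" if "x \<in> acarrier A" for x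
      using iso a that by (auto simp: algebra_isomorphism_def)
    then show False using gliding_hump[OF a(1) _ u(2) s(1,3,2,4)] u(3) by blast
  qed
  then obtain K where "\<And>x. x \<in> acarrier A \<Longrightarrow> anorm B (\<gamma> x) \<le> K * anorm A x"
    using closed_graph by blast
  then show ?thesis unfolding norm_topology_def by (rule bounded_imp_continuous)
qed

section \<open>Functions vanishing at infinity and the covariance algebra\<close>

lemma sum_fun_apply: "(sum f I) x = (\<Sum>i\<in>I. f i x)"
  by (induction I rule: infinite_finite_induct) auto

lemma C0_add:
  assumes f: "f \<in> C0 X" and g: "g \<in> C0 X" shows "f + g \<in> C0 X"
  unfolding C0_def
proof (intro CollectI conjI allI impI)
  show "continuous_map X euclidean (f + g)"
    unfolding plus_fun_def using f g by (intro continuous_map_add C0_cont)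
  fix \<epsilon> :: real assume "\<epsilon> > 0"
  then have e: "\<epsilon> / 2 > 0" by simp
  obtain K where K: "compactin X K" "\<And>x. x \<in> topspace X - K \<Longrightarrow> cmod (f x) < \<epsilon> / 2"
    using C0_vanish[OF f e] by blast
  obtain L where L: "compactin X L" "\<And>x. x \<in> topspace X - L \<Longrightarrow> cmod (g x) < \<epsilon> / 2"
    using C0_vanish[OF g e] by blast
  have "cmod ((f + g) x) < \<epsilon>" if "x \<in> topspace X - (K \<union> L)" for x
    using K(2)[of x] L(2)[of x] that norm_triangle_ineq[of "f x" "g x"] by simp
  then show "\<exists>K. compactin X K \<and> (\<forall>x\<in>topspace X - K. cmod ((f + g) x) < \<epsilon>)"
    using compactin_Un[OF K(1) L(1)] by blast
qed (use f g in \<open>auto simp: C0_def\<close>)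

lemma C0_sum: "(\<And>i. i \<in> I \<Longrightarrow> f i \<in> C0 X) \<Longrightarrow> sum f I \<in> C0 X"
  by (induction I rule: infinite_finite_induct) (auto intro: C0_add C0_0)

lemma C0_outside: "f \<in> C0 X \<Longrightarrow> t \<notin> topspace X \<Longrightarrow> f t = 0"
  by (simp add: C0_def)

lemma C0_uniform_limit:
  assumes f: "\<And>n::nat. f n \<in> C0 X" and lim: "uniform_limit UNIV f g sequentially"
  shows "g \<in> C0 X"
  unfolding C0_def
proof (intro CollectI conjI allI impI)
  have ev: "\<forall>\<^sub>F n in sequentially. \<forall>x. dist (f n x) (g x) < \<epsilon>" if "\<epsilon> > 0" for \<epsilon>
    using lim that by (simp add: uniform_limit_iff)
  have "continuous_map X Met_TC.mtopology g"
  proof (rule Met_TC.continuous_map_uniform_limit[where F = sequentially and f = f])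
    show "\<forall>\<^sub>F n in sequentially. \<forall>x\<in>topspace X. g x \<in> UNIV \<and> dist (f n x) (g x) < \<epsilon>" if "\<epsilon> > 0" for \<epsilon>
      using ev[OF that] by (rule eventually_mono) auto
  qed (use f in \<open>auto intro: C0_cont always_eventually\<close>)
  then show "continuous_map X euclidean g" by simp
  show "g x = 0" if "x \<notin> topspace X" for x
  proof -
    have "(\<lambda>n. f n x) \<longlonglongrightarrow> g x" by (rule tendsto_uniform_limitI[OF lim]) simp
    then show ?thesis using that by (simp add: C0_outside[OF f] LIMSEQ_const_iff)
  qed
  fix \<epsilon> :: real assume "\<epsilon> > 0"
  then have e: "\<epsilon> / 2 > 0" by simp
  obtain n where n: "\<And>x. dist (f n x) (g x) < \<epsilon> / 2"
    using eventually_happens'[OF _ ev[OF e]] by auto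
  obtain K where K: "compactin X K" "\<And>x. x \<in> topspace X - K \<Longrightarrow> cmod (f n x) < \<epsilon> / 2"
    using C0_vanish[OF f e] by blast
  have "cmod (g x) < \<epsilon>" if "x \<in> topspace X - K" for x
    using K(2)[OF that] n[of x] norm_triangle_ineq2[of "g x" "f n x"]
    by (simp add: dist_norm norm_minus_commute)
  then show "\<exists>K. compactin X K \<and> (\<forall>x\<in>topspace X - K. cmod (g x) < \<epsilon>)" using K(1) by blast
qed

text \<open>Urysohn on a compact neighbourhood: a locally compact Hausdorff space is completely regular.\<close>
lemma C0_bump:
  assumes X: "locally_compact_space X" "Hausdorff_space X" and p: "p \<in> topspace X"
  obtains g :: "'a \<Rightarrow> real" where "(\<lambda>t. complex_of_real (g t)) \<in> C0 X" "g p = 1" "\<And>t. 0 \<le> g t \<and> g t \<le> 1"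
proof -
  obtain U K where UK: "openin X U" "compactin X K" "p \<in> U" "U \<subseteq> K"
    using X(1) p unfolding locally_compact_space_def by blast
  have cr: "completely_regular_space X"
    using X by (simp add: locally_compact_regular_imp_completely_regular_space locally_compact_Hausdorff_imp_regular_space)
  obtain h where h: "continuous_map X (top_of_set {0..1::real}) h"
      "h ` (topspace X - U) \<subseteq> {0}" "h ` {p} \<subseteq> {1}"
    by (rule Urysohn_completely_regular_compact_closed[of 0 1 X "{p}" "topspace X - U"])
      (use cr p UK in auto)
  define g where "g t = (if t \<in> topspace X then h t else 0)" for t
  have hc: "continuous_map X euclidean h" using h(1) by (simp add: continuous_map_in_subtopology)
  have h01: "0 \<le> h t \<and> h t \<le> 1" if "t \<in> topspace X" for t
    using h(1) that by (auto simp: continuous_map_def Pi_iff)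
  have h0: "h t = 0" if "t \<in> topspace X" "t \<notin> U" for t using h(2) that by blast
  show thesis
  proof (rule that)
    show "g p = 1" using p h(3) by (simp add: g_def)
    show "0 \<le> g t \<and> g t \<le> 1" for t using h01 by (simp add: g_def)
    show "(\<lambda>t. complex_of_real (g t)) \<in> C0 X"
      unfolding C0_def
    proof (intro CollectI conjI allI impI)
      have "continuous_map X euclidean (\<lambda>t. complex_of_real (h t))"
        using continuous_map_compose[OF hc, of euclidean complex_of_real]
        by (simp add: o_def continuous_on_of_real_id)
      then show "continuous_map X euclidean (\<lambda>t. complex_of_real (g t))"
        by (rule continuous_map_eq) (simp add: g_def)
      fix \<epsilon> :: real assume "\<epsilon> > 0"
      then show "\<exists>K. compactin X K \<and> (\<forall>x\<in>topspace X - K. cmod (complex_of_real (g x)) < \<epsilon>)"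
        using UK(2,4) h0 by (intro exI[of _ K]) (auto simp: g_def subset_eq)
    qed (simp add: g_def)
  qed
qed

text \<open>The points may leave every compact set; a sum of bump functions at the points with weights
  \<open>2\<^sup>-\<^sup>k\<close> still vanishes at infinity, being a uniform limit, and it is at least \<open>2\<^sup>-\<^sup>k\<close> at the \<open>k\<close>-th point.\<close>
lemma C0_nonzero_on_sequence:
  assumes X: "locally_compact_space X" "Hausdorff_space X" and p: "\<And>k::nat. p k \<in> topspace X"
  obtains f where "f \<in> C0 X" "\<And>k. f (p k) \<noteq> 0"
proof -
  have "\<exists>g :: 'a \<Rightarrow> real. (\<lambda>t. complex_of_real (g t)) \<in> C0 X \<and> g (p k) = 1 \<and> (\<forall>t. 0 \<le> g t \<and> g t \<le> 1)" for k
    using C0_bump[OF X p[of k]] by metis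
  then obtain g :: "nat \<Rightarrow> 'a \<Rightarrow> real" where g: "\<And>k. (\<lambda>t. complex_of_real (g k t)) \<in> C0 X"
    "\<And>k. g k (p k) = 1" "\<And>k t. 0 \<le> g k t \<and> g k t \<le> 1" by metis
  define a where "a k t = (1/2) ^ k * g k t" for k t
  have a: "0 \<le> a k t" "a k t \<le> (1/2) ^ k" for k t
    using g(3)[of k t] by (auto simp: a_def intro: mult_left_le)
  have "uniform_limit UNIV (\<lambda>n t. \<Sum>k<n. complex_of_real (a k t)) (\<lambda>t. \<Sum>k. complex_of_real (a k t)) sequentially"
    by (rule Weierstrass_m_test[where M = "\<lambda>k. (1/2) ^ k"]) (use a in \<open>auto intro: summable_geometric\<close>)
  moreover have "(\<lambda>t. \<Sum>k<n. complex_of_real (a k t)) \<in> C0 X" for n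
  proof -
    have "(\<lambda>t. complex_of_real (a k t)) \<in> C0 X" for k
      using C0_scale[OF g(1)[of k], of "of_real ((1/2) ^ k)"] by (simp add: a_def)
    then have "(\<Sum>k<n. (\<lambda>t. complex_of_real (a k t))) \<in> C0 X" by (rule C0_sum)
    moreover have "(\<Sum>k<n. (\<lambda>t. complex_of_real (a k t))) = (\<lambda>t. \<Sum>k<n. complex_of_real (a k t))"
      by (simp add: fun_eq_iff sum_fun_apply)
    ultimately show ?thesis by simp
  qed
  ultimately have "(\<lambda>t. \<Sum>k. complex_of_real (a k t)) \<in> C0 X"
    by (rule C0_uniform_limit[rotated])
  moreover have "(\<Sum>k. complex_of_real (a k (p j))) \<noteq> 0" for j
  proof -
    have s: "summable (\<lambda>k. a k (p j))"
      by (rule summable_comparison_test'[OF summable_geometric[of "1/2::real"]]) (use a in auto)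
    have "0 < a j (p j)" by (simp add: a_def g)
    also have "\<dots> \<le> (\<Sum>k. a k (p j))"
      using sum_le_suminf[OF s, of "{j}"] a(1) by simp
    finally show ?thesis using suminf_of_real[OF s, where 'a = complex] by (metis less_irrefl of_real_eq_0_iff)
  qed
  ultimately show thesis by (rule that)
qed

lemma pullback_0 [simp]: "pullback X h 0 = 0"
  by (auto simp: pullback_def)

lemma pullback_add: "pullback X h (f + g) = pullback X h f + pullback X h g"
  by (auto simp: pullback_def)

lemma pullback_scale: "pullback X h (\<lambda>t. c * f t) = (\<lambda>t. c * pullback X h f t)"
  by (auto simp: pullback_def)

lemma pullback_id: "f \<in> C0 X \<Longrightarrow> pullback X id f = f" "f \<in> C0 X \<Longrightarrow> pullback X (\<lambda>t. t) f = f"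
  by (auto simp: pullback_def C0_outside)

lemma comp_word_topspace:
  "multivariable_system X \<sigma> \<Longrightarrow> t \<in> topspace X \<Longrightarrow> comp_word \<sigma> w t \<in> topspace X"
  by (induction w) (auto simp: multivariable_system_def continuous_map_def Pi_iff)

lemma pullback_Cons:
  assumes "multivariable_system X \<sigma>"
  shows "pullback X (comp_word \<sigma> (i # w)) f = pullback X (comp_word \<sigma> w) (pullback X (\<sigma> i) f)"
  using comp_word_topspace[OF assms] by (auto simp: pullback_def)

lemma C0_pullback_word:
  assumes X: "multivariable_system X \<sigma>"
  shows "f \<in> C0 X \<Longrightarrow> pullback X (comp_word \<sigma> w) f \<in> C0 X"
proof (induction w arbitrary: f)
  case Nil then show ?case by (simp add: pullback_id)
next
  case (Cons i w)
  have "pullback X (\<sigma> i) f \<in> C0 X" using X Cons.prems by (intro C0_pullback) (auto simp: multivariable_system_def)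
  then show ?case unfolding pullback_Cons[OF X] by (rule Cons.IH)
qed

lemma finite_support: "F \<in> cov_carrier X \<Longrightarrow> finite {w. F w \<noteq> 0}"
  by (simp add: cov_carrier_def)

lemma cov_carrier_C0: "F \<in> cov_carrier X \<Longrightarrow> F w \<in> C0 X"
  by (simp add: cov_carrier_def)

lemma cov_carrierI:
  assumes "finite W" "\<And>w. w \<notin> W \<Longrightarrow> F w = 0" "\<And>w. F w \<in> C0 X"
  shows "F \<in> cov_carrier X"
  using assms finite_subset[of "{w. F w \<noteq> 0}" W] by (auto simp: cov_carrier_def)

lemma cov_add: "F \<in> cov_carrier X \<Longrightarrow> G \<in> cov_carrier X \<Longrightarrow> F + G \<in> cov_carrier X"
  by (rule cov_carrierI[of "{w. F w \<noteq> 0} \<union> {w. G w \<noteq> 0}"])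
    (simp_all add: finite_support cov_carrier_C0 C0_add)

lemma cov_weight:
  assumes F: "F \<in> cov_carrier X" shows "(\<lambda>w t. c w * F w t) \<in> cov_carrier X"
  by (rule cov_carrierI[OF finite_support[OF F]]) (use F in \<open>auto simp: cov_carrier_C0 C0_scale\<close>)

lemma cov_mult_support:
  assumes "cov_mult X \<sigma> F G u \<noteq> 0"
  obtains v w where "u = v @ w" "F v \<noteq> 0" "G w \<noteq> 0"
proof -
  obtain k where "pullback X (comp_word \<sigma> (drop k u)) (F (take k u)) * G (drop k u) \<noteq> 0"
    using assms unfolding cov_mult_def by (meson sum.neutral)
  then have "F (take k u) \<noteq> 0" "G (drop k u) \<noteq> 0" by auto
  then show thesis using that by (metis append_take_drop_id)
qed

lemma cov_mult_outside:
  assumes "u \<notin> (\<lambda>(v, w). v @ w) ` ({v. F v \<noteq> 0} \<times> {w. G w \<noteq> 0})"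
  shows "cov_mult X \<sigma> F G u = 0"
proof (rule ccontr)
  assume "cov_mult X \<sigma> F G u \<noteq> 0"
  then obtain v w where "u = v @ w" "F v \<noteq> 0" "G w \<noteq> 0" by (rule cov_mult_support)
  then show False using assms by blast
qed

lemma cov_mult_in:
  assumes X: "multivariable_system X \<sigma>" and F: "F \<in> cov_carrier X" and G: "G \<in> cov_carrier X"
  shows "cov_mult X \<sigma> F G \<in> cov_carrier X"
proof (rule cov_carrierI[OF _ cov_mult_outside])
  show "finite ((\<lambda>(v, w). v @ w) ` ({v. F v \<noteq> 0} \<times> {w. G w \<noteq> 0}))"
    using F G by (simp add: finite_support)
  show "cov_mult X \<sigma> F G w \<in> C0 X" for w
    unfolding cov_mult_def by (intro C0_sum C0_mult C0_pullback_word X cov_carrier_C0 F G)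
qed

lemma cov_mult_add_right: "cov_mult X \<sigma> F (G + K) = cov_mult X \<sigma> F G + cov_mult X \<sigma> F K"
  by (rule ext) (simp add: cov_mult_def sum.distrib distrib_left)

lemma cov_mult_add_left: "cov_mult X \<sigma> (F + K) G = cov_mult X \<sigma> F G + cov_mult X \<sigma> K G"
  by (rule ext) (simp add: cov_mult_def sum.distrib distrib_right pullback_add)

lemma cov_mult_scale_right: "cov_mult X \<sigma> F (\<lambda>w t. c * G w t) = (\<lambda>w t. c * cov_mult X \<sigma> F G w t)"
  by (intro ext) (simp add: cov_mult_def sum_fun_apply sum_distrib_left mult_ac)

lemma cov_mult_scale_left: "cov_mult X \<sigma> (\<lambda>w t. c * F w t) G = (\<lambda>w t. c * cov_mult X \<sigma> F G w t)"
  by (intro ext) (simp add: cov_mult_def sum_fun_apply sum_distrib_left mult_ac pullback_scale)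

definition single :: "'n list \<Rightarrow> ('a \<Rightarrow> complex) \<Rightarrow> 'n list \<Rightarrow> 'a \<Rightarrow> complex" where
  "single v f = (\<lambda>w. if w = v then f else 0)"

lemma single_in: "f \<in> C0 X \<Longrightarrow> single v f \<in> cov_carrier X"
  by (rule cov_carrierI[of "{v}"]) (auto simp: single_def C0_0)

text \<open>Left multiplication by \<open>s\<^sub>v f\<close> prefixes words with \<open>v\<close>, so it raises degrees by \<open>\<bar>v\<bar>\<close> and acts
  on coefficients as a weighted shift.\<close>
lemma cov_mult_single:
  "cov_mult X \<sigma> (single v f) G (v @ w) t = pullback X (comp_word \<sigma> w) f t * G w t"
  "length u < length v \<Longrightarrow> cov_mult X \<sigma> (single v f) G u t = 0"
proof -
  have "take k (v @ w) \<noteq> v" if "k \<noteq> length v" "k \<le> length (v @ w)" for k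
    using that by (metis length_take min.absorb2)
  then have "cov_mult X \<sigma> (single v f) G (v @ w) t =
      (\<Sum>k\<le>length (v @ w). if k = length v then pullback X (comp_word \<sigma> w) f t * G w t else 0)"
    unfolding cov_mult_def sum_fun_apply by (intro sum.cong refl) (auto simp: single_def)
  then show "cov_mult X \<sigma> (single v f) G (v @ w) t = pullback X (comp_word \<sigma> w) f t * G w t"
    by simp
  show "cov_mult X \<sigma> (single v f) G u t = 0" if "length u < length v"
  proof -
    have "take k u \<noteq> v" for k using that by (metis length_take min.cobounded1 not_less)
    then show ?thesis by (simp add: cov_mult_def single_def)
  qed
qed

context covariant_representation
begin

lemma rep_zero: "x \<in> H \<Longrightarrow> \<pi> 0 x = 0"
  using rep_scale[OF C0_0, of x 0] by (simp add: zero_fun_def)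

lemma rep_sum: "(\<And>i. i \<in> I \<Longrightarrow> f i \<in> C0 X) \<Longrightarrow> x \<in> H \<Longrightarrow> \<pi> (sum f I) x = (\<Sum>i\<in>I. \<pi> (f i) x)"
  by (induction I rule: infinite_finite_induct) (auto simp: rep_zero rep_add C0_sum)

lemma word_add: "x \<in> H \<Longrightarrow> y \<in> H \<Longrightarrow> comp_word A w (x + y) = comp_word A w x + comp_word A w y"
  by (induction w) (auto simp: bounded_operator_lin(2)[OF A_bounded] word_in)

lemma word_zero: "comp_word A w 0 = 0"
  by (induction w) (auto simp: bounded_operator_lin(4)[OF A_bounded])

lemma word_scale: "x \<in> H \<Longrightarrow> comp_word A w (sc c x) = sc c (comp_word A w x)"
  by (induction w) (auto simp: bounded_operator_lin(3)[OF A_bounded] word_in)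

lemma word_sum: "(\<And>i. i \<in> I \<Longrightarrow> f i \<in> H) \<Longrightarrow> comp_word A w (sum f I) = (\<Sum>i\<in>I. comp_word A w (f i))"
  by (induction I rule: infinite_finite_induct) (auto simp: word_zero word_add subspace_sum[OF subspace_H])

lemma word_append: "comp_word A (v @ w) x = comp_word A v (comp_word A w x)"
  by (induction v) auto

lemma rep_word:
  assumes X: "multivariable_system X \<sigma>" and x: "x \<in> H"
  shows "f \<in> C0 X \<Longrightarrow> \<pi> f (comp_word A w x) = comp_word A w (\<pi> (pullback X (comp_word \<sigma> w) f) x)"
proof (induction w arbitrary: f)
  case Nil then show ?case by (simp add: pullback_id)
next
  case (Cons i w)
  have pf: "pullback X (\<sigma> i) f \<in> C0 X" using X Cons.prems by (intro C0_pullback) (auto simp: multivariable_system_def)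
  have "\<pi> f (A i (comp_word A w x)) = A i (\<pi> (pullback X (\<sigma> i) f) (comp_word A w x))"
    by (rule covariance[OF Cons.prems word_in[OF x]])
  then show ?case by (simp add: Cons.IH[OF pf] pullback_Cons[OF X] del: comp_word.simps(2)) simp
qed

lemma rep_apply_superset:
  assumes "finite W" "\<And>w. w \<notin> W \<Longrightarrow> F w = 0" "x \<in> H"
  shows "rep_apply \<pi> A F x = (\<Sum>w\<in>W. comp_word A w (\<pi> (F w) x))"
  unfolding rep_apply_def
  using assms by (intro sum.mono_neutral_left) (auto simp: rep_zero word_zero)

lemma rep_apply_add:
  assumes F: "F \<in> cov_carrier X" and G: "G \<in> cov_carrier X" and x: "x \<in> H"
  shows "rep_apply \<pi> A (F + G) x = rep_apply \<pi> A F x + rep_apply \<pi> A G x"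
proof -
  let ?W = "{w. F w \<noteq> 0} \<union> {w. G w \<noteq> 0}"
  have W: "finite ?W" using F G by (simp add: finite_support)
  have "rep_apply \<pi> A (F + G) x = (\<Sum>w\<in>?W. comp_word A w (\<pi> ((F + G) w) x))"
    by (rule rep_apply_superset[OF W _ x]) auto
  moreover have "rep_apply \<pi> A F x = (\<Sum>w\<in>?W. comp_word A w (\<pi> (F w) x))"
    by (rule rep_apply_superset[OF W _ x]) auto
  moreover have "rep_apply \<pi> A G x = (\<Sum>w\<in>?W. comp_word A w (\<pi> (G w) x))"
    by (rule rep_apply_superset[OF W _ x]) auto
  ultimately show ?thesis
    using F G x by (simp add: rep_add word_add pi_in cov_carrier_C0 sum.distrib)
qed

lemma rep_apply_scale_left:
  assumes F: "F \<in> cov_carrier X" and x: "x \<in> H"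
  shows "rep_apply \<pi> A (\<lambda>w t. c * F w t) x = sc c (rep_apply \<pi> A F x)"
proof -
  have "rep_apply \<pi> A (\<lambda>w t. c * F w t) x = (\<Sum>w | F w \<noteq> 0. comp_word A w (\<pi> (\<lambda>t. c * F w t) x))"
    by (intro rep_apply_superset finite_support[OF F] x) auto
  then show ?thesis
    using F x by (simp add: rep_apply_def scale_sum_right rep_scale word_scale pi_in cov_carrier_C0)
qed

text \<open>Both sides are sums of \<open>A\<^sub>v A\<^sub>w \<pi> ((F\<^sub>v \<circ> \<sigma>\<^sub>w) G\<^sub>w) x\<close>: on the left over the factorisations of the
  words in the support of the product, on the right over pairs of words. The factorisations with a
  factor outside the supports contribute nothing.\<close>
lemma rep_apply_mult:
  assumes X: "multivariable_system X \<sigma>" and F: "F \<in> cov_carrier X" and G: "G \<in> cov_carrier X" and x: "x \<in> H"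
  shows "rep_apply \<pi> A (cov_mult X \<sigma> F G) x = rep_apply \<pi> A F (rep_apply \<pi> A G x)"
proof -
  define t where "t v w = comp_word A (v @ w) (\<pi> (pullback X (comp_word \<sigma> w) (F v) * G w) x)" for v w
  define V where "V = {v. F v \<noteq> 0}"
  define W where "W = {w. G w \<noteq> 0}"
  define U where "U = (\<lambda>(v, w). v @ w) ` (V \<times> W)"
  have fin: "finite V" "finite W" "finite U" using F G by (auto simp: V_def W_def U_def finite_support)
  note C0s = cov_carrier_C0[OF F] cov_carrier_C0[OF G] C0_pullback_word[OF X cov_carrier_C0[OF F]]
  have t0: "t v w = 0" if "v \<notin> V \<or> w \<notin> W" for v w
    using that x by (auto simp: t_def V_def W_def rep_zero word_zero)
  have "rep_apply \<pi> A (cov_mult X \<sigma> F G) x = (\<Sum>u\<in>U. comp_word A u (\<pi> (cov_mult X \<sigma> F G u) x))"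
    by (rule rep_apply_superset[OF fin(3) cov_mult_outside x]) (simp add: U_def V_def W_def)
  also have "\<dots> = (\<Sum>u\<in>U. \<Sum>k\<le>length u. t (take k u) (drop k u))"
    using x by (simp add: cov_mult_def rep_sum word_sum pi_in C0_mult C0s t_def)
  also have "\<dots> = (\<Sum>(u, k)\<in>Sigma U (\<lambda>u. {..length u}). t (take k u) (drop k u))"
    using fin by (simp add: sum.Sigma)
  also have "\<dots> = (\<Sum>(v, w)\<in>V \<times> W. t v w)"
  proof (rule sum.reindex_bij_witness_not_neutral[where T' = "{}"
        and S' = "{p \<in> Sigma U (\<lambda>u. {..length u}). take (snd p) (fst p) \<notin> V \<or> drop (snd p) (fst p) \<notin> W}"
        and i = "\<lambda>(v, w). (v @ w, length v)" and j = "\<lambda>(u, k). (take k u, drop k u)"])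
    show "finite {p \<in> Sigma U (\<lambda>u. {..length u}). take (snd p) (fst p) \<notin> V \<or> drop (snd p) (fst p) \<notin> W}"
      by (rule finite_subset[OF _ finite_SigmaI[OF fin(3), of "\<lambda>u. {..length u}"]]) auto
    show "(case p of (u, k) \<Rightarrow> t (take k u) (drop k u)) = 0"
      if "p \<in> {p \<in> Sigma U (\<lambda>u. {..length u}). take (snd p) (fst p) \<notin> V \<or> drop (snd p) (fst p) \<notin> W}" for p
      using that t0 by (cases p) simp
    show "(case p of (v, w) \<Rightarrow> (v @ w, length v)) \<in> Sigma U (\<lambda>u. {..length u})
        - {p \<in> Sigma U (\<lambda>u. {..length u}). take (snd p) (fst p) \<notin> V \<or> drop (snd p) (fst p) \<notin> W}"
      if "p \<in> V \<times> W - {}" for p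
    proof -
      obtain v w where "p = (v, w)" "v \<in> V" "w \<in> W" using \<open>p \<in> V \<times> W - {}\<close> by (cases p) auto
      moreover from this have "v @ w \<in> U" unfolding U_def by blast
      ultimately show ?thesis by simp
    qed
  qed auto
  also have "\<dots> = (\<Sum>v\<in>V. \<Sum>w\<in>W. comp_word A v (\<pi> (F v) (comp_word A w (\<pi> (G w) x))))"
    unfolding sum.cartesian_product[symmetric] t_def
    using x by (simp add: rep_word[OF X] pi_in C0s rep_mult word_append)
  also have "\<dots> = (\<Sum>v\<in>V. comp_word A v (\<pi> (F v) (\<Sum>w\<in>W. comp_word A w (\<pi> (G w) x))))"
  proof (rule sum.cong[OF refl])
    fix v
    have "\<pi> (F v) (sum g W) = (\<Sum>w\<in>W. \<pi> (F v) (g w))" if "\<And>w. g w \<in> H" for g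
      using that bounded_operator_lin(2,4)[OF rep_bounded[OF C0s(1)[of v]]]
      by (induction W rule: infinite_finite_induct) (auto simp: subspace_sum[OF subspace_H])
    then show "(\<Sum>w\<in>W. comp_word A v (\<pi> (F v) (comp_word A w (\<pi> (G w) x))))
        = comp_word A v (\<pi> (F v) (\<Sum>w\<in>W. comp_word A w (\<pi> (G w) x)))"
      using x by (simp add: word_sum pi_in word_in C0s)
  qed
  finally show ?thesis by (simp add: rep_apply_def V_def W_def)
qed

end

section \<open>Fourier coefficients are contractive\<close>

text \<open>The Fock representation of the orbit of a point \<open>p\<close>, cut off at words of length \<open>L\<close>. The cut
  makes the Hilbert space finite dimensional, and a coefficient at a word of length at most \<open>L\<close> is not
  affected by it.\<close>
definition fock_space :: "nat \<Rightarrow> ('n list \<Rightarrow> complex) set" where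
  "fock_space L = {u. \<forall>w. L < length w \<longrightarrow> u w = 0}"

definition fock_ip :: "nat \<Rightarrow> ('n list \<Rightarrow> complex) \<Rightarrow> ('n list \<Rightarrow> complex) \<Rightarrow> complex" where
  "fock_ip L u v = (\<Sum>w | length w \<le> L. u w * cnj (v w))"

definition fock_shift :: "nat \<Rightarrow> 'n \<Rightarrow> ('n list \<Rightarrow> complex) \<Rightarrow> 'n list \<Rightarrow> complex" where
  "fock_shift L i u = (\<lambda>w. case w of [] \<Rightarrow> 0 | j # v \<Rightarrow> if j = i \<and> length v < L then u v else 0)"

text \<open>\<open>f\<close> acts on the basis vector of \<open>w\<close> as \<open>f (\<sigma>\<^sub>w p)\<close>. Going through \<^const>\<open>pullback\<close> gives the zero
  representation when \<open>p\<close> is not a point of the space, so \<open>p\<close> is unrestricted.\<close>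
definition fock_rep :: "'a topology \<Rightarrow> ('n \<Rightarrow> 'a \<Rightarrow> 'a) \<Rightarrow> 'a \<Rightarrow> ('a \<Rightarrow> complex) \<Rightarrow> ('n list \<Rightarrow> complex) \<Rightarrow> 'n list \<Rightarrow> complex" where
  "fock_rep X \<sigma> p f u = (\<lambda>w. pullback X (comp_word \<sigma> w) f p * u w)"

lemma finite_words: "finite {w :: 'n::finite list. length w \<le> L}"
  using finite_lists_length_le[of "UNIV :: 'n set" L] by simp

lemma fock_ip_self: "fock_ip L u u = of_real (\<Sum>w | length w \<le> L. (cmod (u w))\<^sup>2)"
  by (simp add: fock_ip_def complex_norm_square flip: of_real_power)

lemma fock_hnorm: "hnorm (fock_ip L) u = sqrt (\<Sum>w | length w \<le> L. (cmod (u w))\<^sup>2)"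
  unfolding hnorm_def fock_ip_self by simp

lemma fock_hnorm_mono:
  assumes "\<And>w. cmod (u w) \<le> M * cmod (v w)" "M \<ge> 0"
  shows "hnorm (fock_ip L) u \<le> M * hnorm (fock_ip L) v"
proof -
  have "(\<Sum>w | length w \<le> L. (cmod (u w))\<^sup>2) \<le> (\<Sum>w | length w \<le> L. M\<^sup>2 * (cmod (v w))\<^sup>2)"
    using power_mono[OF assms(1), of _ 2] by (intro sum_mono) (simp add: power_mult_distrib)
  also have "\<dots> = M\<^sup>2 * (\<Sum>w | length w \<le> L. (cmod (v w))\<^sup>2)" by (rule sum_distrib_left[symmetric])
  finally have "sqrt (\<Sum>w | length w \<le> L. (cmod (u w))\<^sup>2) \<le> sqrt (M\<^sup>2 * (\<Sum>w | length w \<le> L. (cmod (v w))\<^sup>2))"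
    by (rule real_sqrt_le_mono)
  then show ?thesis using assms(2) by (simp add: fock_hnorm real_sqrt_mult)
qed

lemma fock_coordinate_le:
  fixes u :: "'n::finite list \<Rightarrow> complex"
  assumes "length w \<le> L" shows "cmod (u w) \<le> hnorm (fock_ip L) u"
proof -
  have "(cmod (u w))\<^sup>2 \<le> (\<Sum>w | length w \<le> L. (cmod (u w))\<^sup>2)"
    by (rule member_le_sum) (use assms finite_words in auto)
  then show ?thesis unfolding fock_hnorm by (rule real_le_rsqrt)
qed

lemma fock_hilbert_space:
  "complex_hilbert_space fscale (fock_space L :: ('n::finite list \<Rightarrow> complex) set) (fock_ip L)"
proof (intro complex_hilbert_space.intro complex_hilbert_space_axioms.intro)
  interpret V: vector_space "fscale :: complex \<Rightarrow> ('n list \<Rightarrow> complex) \<Rightarrow> _" by (rule vector_space_fscale)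
  show "vector_space (fscale :: complex \<Rightarrow> ('n list \<Rightarrow> complex) \<Rightarrow> _)" by (rule vector_space_fscale)
  show "V.subspace (fock_space L)"
    by (rule V.subspaceI) (auto simp: fock_space_def fscale_def)
  fix x y z :: "'n list \<Rightarrow> complex" and c
  show "fock_ip L (x + y) z = fock_ip L x z + fock_ip L y z"
    by (simp add: fock_ip_def distrib_right sum.distrib)
  show "fock_ip L (fscale c x) y = c * fock_ip L x y"
    by (simp add: fock_ip_def fscale_def sum_distrib_left mult.assoc)
  show "fock_ip L y x = cnj (fock_ip L x y)"
    by (simp add: fock_ip_def mult.commute)
  show "0 \<le> Re (fock_ip L x x)" by (simp add: fock_ip_self sum_nonneg)
  show "x = 0" if x: "x \<in> fock_space L" and z: "fock_ip L x x = 0"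
  proof
    fix w
    have "hnorm (fock_ip L) x = 0" using z by (simp add: hnorm_def)
    then show "x w = 0 w" using x fock_coordinate_le[of w L x]
      by (cases "length w \<le> L") (auto simp: fock_space_def)
  qed
next
  fix s :: "nat \<Rightarrow> 'n list \<Rightarrow> complex"
  assume s: "range s \<subseteq> fock_space L" and c: "\<forall>\<epsilon>>0. \<exists>N. \<forall>j\<ge>N. \<forall>k\<ge>N. hnorm (fock_ip L) (s j - s k) < \<epsilon>"
  have "convergent (\<lambda>k. s k w)" if w: "length w \<le> L" for w
  proof (rule Cauchy_convergent, rule CauchyI)
    fix \<epsilon> :: real assume "\<epsilon> > 0"
    then obtain N where N: "\<forall>j\<ge>N. \<forall>k\<ge>N. hnorm (fock_ip L) (s j - s k) < \<epsilon>" using c by blast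
    have "norm (s j w - s k w) < \<epsilon>" if "j \<ge> N" "k \<ge> N" for j k
    proof -
      have "norm (s j w - s k w) \<le> hnorm (fock_ip L) (s j - s k)"
        using fock_coordinate_le[OF w, of "s j - s k"] by simp
      then show ?thesis using N that by (meson le_less_trans)
    qed
    then show "\<exists>M. \<forall>m\<ge>M. \<forall>n\<ge>M. norm (s m w - s n w) < \<epsilon>" by blast
  qed
  then obtain l0 where l0: "\<And>w. length w \<le> L \<Longrightarrow> (\<lambda>k. s k w) \<longlonglongrightarrow> l0 w"
    unfolding convergent_def by metis
  define l where "l w = (if length w \<le> L then l0 w else 0)" for w
  have "(\<lambda>k. sqrt (\<Sum>w | length w \<le> L. (cmod (s k w - l w))\<^sup>2)) \<longlonglongrightarrow> sqrt (\<Sum>w :: 'n list | length w \<le> L. (cmod (l w - l w))\<^sup>2)"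
    using l0 by (intro tendsto_intros) (simp add: l_def)
  then have "(\<lambda>k. hnorm (fock_ip L) (s k - l)) \<longlonglongrightarrow> 0" by (simp add: fock_hnorm)
  moreover have "l \<in> fock_space L" by (simp add: fock_space_def l_def)
  ultimately show "\<exists>l\<in>fock_space L. (\<lambda>k. hnorm (fock_ip L) (s k - l)) \<longlonglongrightarrow> 0" by blast
qed

text \<open>The vectors in the range of the \<open>i\<close>-th shift are supported on words with first letter \<open>i\<close>, so
  the shifts have orthogonal ranges.\<close>
lemma fock_shift_row:
  fixes x :: "'n::finite \<Rightarrow> 'n list \<Rightarrow> complex"
  shows "(hnorm (fock_ip L) (\<Sum>i\<in>UNIV. fock_shift L i (x i)))\<^sup>2 \<le> (\<Sum>i\<in>UNIV. (hnorm (fock_ip L) (x i))\<^sup>2)"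
proof -
  let ?W = "{w :: 'n list. length w \<le> L}"
  define g where "g w = (cmod ((\<Sum>i\<in>UNIV. fock_shift L i (x i)) w))\<^sup>2" for w
  have g0: "g [] = 0" by (simp add: g_def sum_fun_apply fock_shift_def)
  have gC: "g (j # v) \<le> (cmod (x j v))\<^sup>2" for j v
    by (cases "length v < L") (simp_all add: g_def sum_fun_apply fock_shift_def)
  have "(\<Sum>w\<in>?W. g w) \<le> (\<Sum>w\<in>insert [] ((\<lambda>(j, v). j # v) ` (UNIV \<times> ?W)). g w)"
  proof (rule sum_mono2)
    show "?W \<subseteq> insert [] ((\<lambda>(j, v). j # v) ` (UNIV \<times> ?W))"
    proof
      fix w assume "w \<in> ?W"
      then show "w \<in> insert [] ((\<lambda>(j, v). j # v) ` (UNIV \<times> ?W))" by (cases w) force+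
    qed
  qed (auto simp: finite_words g_def)
  also have "\<dots> = (\<Sum>w\<in>(\<lambda>(j, v). j # v) ` (UNIV \<times> ?W). g w)"
    by (rule sum.mono_neutral_right) (auto simp: finite_words g0)
  also have "\<dots> = (\<Sum>(j, v)\<in>UNIV \<times> ?W. g (j # v))"
    by (subst sum.reindex) (auto simp: inj_on_def case_prod_unfold)
  also have "\<dots> \<le> (\<Sum>(j, v)\<in>UNIV \<times> ?W. (cmod (x j v))\<^sup>2)"
    using gC by (intro sum_mono) auto
  also have "\<dots> = (\<Sum>j\<in>UNIV. \<Sum>v\<in>?W. (cmod (x j v))\<^sup>2)" by (rule sum.cartesian_product[symmetric])
  finally show ?thesis by (simp add: fock_hnorm g_def sum_nonneg)
qed

lemma fock_shift_norm: "hnorm (fock_ip L) (fock_shift L i u) \<le> hnorm (fock_ip L) u" for u :: "'n::finite list \<Rightarrow> complex"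
proof -
  define x where "x j = (if j = i then u else 0)" for j
  have n0: "hnorm (fock_ip L) (0 :: 'n list \<Rightarrow> complex) = 0" by (simp add: fock_hnorm)
  have s0: "fock_shift L j (0 :: 'n list \<Rightarrow> complex) = 0" for j
    by (auto simp: fock_shift_def fun_eq_iff split: list.split)
  have "(\<Sum>j\<in>UNIV. fock_shift L j (x j)) = (\<Sum>j\<in>UNIV. if j = i then fock_shift L i u else 0)"
    by (intro sum.cong) (auto simp: x_def s0)
  then have 1: "(\<Sum>j\<in>UNIV. fock_shift L j (x j)) = fock_shift L i u" by simp
  have "(\<Sum>j\<in>UNIV. (hnorm (fock_ip L) (x j))\<^sup>2) = (\<Sum>j\<in>UNIV. if j = i then (hnorm (fock_ip L) u)\<^sup>2 else 0)"
    by (intro sum.cong) (auto simp: x_def n0)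
  then have "(hnorm (fock_ip L) (fock_shift L i u))\<^sup>2 \<le> (hnorm (fock_ip L) u)\<^sup>2"
    using fock_shift_row[of L x] 1 by simp
  then show ?thesis by (rule power2_le_imp_le) (simp add: fock_hnorm sum_nonneg)
qed

lemma fock_representation:
  fixes \<sigma> :: "'n::finite \<Rightarrow> 'a \<Rightarrow> 'a"
  assumes X: "multivariable_system X \<sigma>"
  shows "covariant_representation fscale (fock_space L) (fock_ip L) X \<sigma> (fock_rep X \<sigma> p) (fock_shift L)"
proof (intro covariant_representation.intro fock_hilbert_space covariant_representation_axioms.intro)
  fix f g :: "'a \<Rightarrow> complex" and x y :: "'n list \<Rightarrow> complex" and c
  assume f: "f \<in> C0 X"
  obtain M where M: "M > 0" "\<And>t. cmod (f t) \<le> M" using C0_bounded[OF f] by blast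
  show "bounded_operator fscale (fock_space L) (fock_ip L) (fock_rep X \<sigma> p f)"
    unfolding bounded_operator_def
  proof (intro conjI ballI allI exI)
    show "hnorm (fock_ip L) (fock_rep X \<sigma> p f x) \<le> M * hnorm (fock_ip L) x" for x
      by (rule fock_hnorm_mono)
        (use M in \<open>auto simp: fock_rep_def norm_mult pullback_def intro!: mult_right_mono\<close>)
  qed (auto simp: fock_space_def fock_rep_def fscale_def algebra_simps)
  show "fock_rep X \<sigma> p (f + g) x = fock_rep X \<sigma> p f x + fock_rep X \<sigma> p g x"
    "fock_rep X \<sigma> p (\<lambda>t. c * f t) x = fscale c (fock_rep X \<sigma> p f x)"
    "fock_rep X \<sigma> p (f * g) x = fock_rep X \<sigma> p f (fock_rep X \<sigma> p g x)"
    by (auto simp: fock_rep_def pullback_def fscale_def algebra_simps)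
  show "fock_ip L (fock_rep X \<sigma> p f x) y = fock_ip L x (fock_rep X \<sigma> p (\<lambda>t. cnj (f t)) y)"
    unfolding fock_ip_def by (intro sum.cong) (auto simp: fock_rep_def pullback_def)
  show "fock_rep X \<sigma> p f (fock_shift L i x) = fock_shift L i (fock_rep X \<sigma> p (pullback X (\<sigma> i) f) x)" for i
    by (auto simp: fock_rep_def fock_shift_def pullback_Cons[OF X] simp del: comp_word.simps split: list.split)
next
  show "bounded_operator fscale (fock_space L) (fock_ip L) (fock_shift L i)" for i :: 'n
    unfolding bounded_operator_def
  proof (intro conjI ballI allI exI)
    show "hnorm (fock_ip L) (fock_shift L i x) \<le> 1 * hnorm (fock_ip L) x" for x
      using fock_shift_norm[of L i x] by simp
  qed (auto simp: fock_space_def fock_shift_def fscale_def fun_eq_iff split: list.split)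
qed

lemma fock_row_contractive: "row_contractive (fock_space L) (fock_ip L) (fock_shift L)"
  unfolding row_contractive_def using fock_shift_row by blast

text \<open>Applied to the vacuum vector, the basis vector of the empty word, \<open>F\<close> returns its own
  coefficients at \<open>p\<close>.\<close>
lemma fock_vacuum:
  assumes X: "multivariable_system X \<sigma>" and F: "F \<in> cov_carrier X" and w: "length w \<le> L"
  shows "rep_apply (fock_rep X \<sigma> p) (fock_shift L) F (\<lambda>v. if v = [] then 1 else 0) w = F w p"
proof -
  have word: "comp_word (fock_shift L) v (\<lambda>u. if u = [] then c else 0)
      = (\<lambda>u. if u = v \<and> length v \<le> L then c else 0)" for v c
    by (induction v) (auto simp: fock_shift_def fun_eq_iff split: list.split)
  have "fock_rep X \<sigma> p (F v) (\<lambda>v. if v = [] then 1 else 0) = (\<lambda>u. if u = [] then F v p else 0)" for v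
    using pullback_id[OF cov_carrier_C0[OF F], of v] by (auto simp: fock_rep_def)
  then have "rep_apply (fock_rep X \<sigma> p) (fock_shift L) F (\<lambda>v. if v = [] then 1 else 0) w
      = (\<Sum>v | F v \<noteq> 0. if v = w then F w p else 0)"
    using w by (simp add: rep_apply_def sum_fun_apply word) (intro sum.cong; auto)
  then show ?thesis using finite_support[OF F] by simp
qed

lemma coefficient_le:
  fixes \<sigma> :: "'n::finite \<Rightarrow> 'a \<Rightarrow> 'a"
  assumes X: "multivariable_system X \<sigma>" and F: "F \<in> cov_carrier X"
    and N: "\<And>L p. hnorm (fock_ip L) (rep_apply (fock_rep X \<sigma> p) (fock_shift L) F (\<lambda>v. if v = [] then 1 else 0))
      \<le> N * hnorm (fock_ip L) (\<lambda>v :: 'n list. if v = [] then 1 else 0)"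
  shows "cmod (F w p) \<le> N"
proof -
  let ?L = "length w" and ?\<xi> = "\<lambda>v :: 'n list. if v = [] then 1 else (0 :: complex)"
  have "(\<Sum>v | length v \<le> ?L. (cmod (?\<xi> v))\<^sup>2) = (\<Sum>v :: 'n list | length v \<le> ?L. if v = [] then 1 else 0)"
    by (intro sum.cong) auto
  then have n: "hnorm (fock_ip ?L) ?\<xi> = 1" by (simp add: fock_hnorm finite_words)
  have "cmod (F w p) \<le> hnorm (fock_ip ?L) (rep_apply (fock_rep X \<sigma> p) (fock_shift ?L) F ?\<xi>)"
    using fock_coordinate_le[of w ?L "rep_apply (fock_rep X \<sigma> p) (fock_shift ?L) F ?\<xi>"]
    by (simp only: fock_vacuum[OF X F order_refl] order_refl simp_thms)
  then show ?thesis using N[of ?L p] n by simp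
qed

section \<open>The two universal norms\<close>

text \<open>The supremum that defines a norm needs at least one representation.\<close>
lemma zero_representation:
  "covariant_representation fscale {0 :: 'j \<Rightarrow> complex} (\<lambda>_ _. 0) X \<sigma> (\<lambda>_ _. 0) (\<lambda>_ _. 0)"
proof (intro covariant_representation.intro complex_hilbert_space.intro complex_hilbert_space_axioms.intro
    covariant_representation_axioms.intro)
  interpret V: vector_space "fscale :: complex \<Rightarrow> ('j \<Rightarrow> complex) \<Rightarrow> _" by (rule vector_space_fscale)
  show "vector_space (fscale :: complex \<Rightarrow> ('j \<Rightarrow> complex) \<Rightarrow> _)" by (rule vector_space_fscale)
  show "V.subspace {0}" by (rule V.subspace_single_0)
qed (auto simp: hnorm_def bounded_operator_def fscale_def zero_fun_def)

lemma Sup_opnorm_le: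
  assumes F: "F \<in> cov_carrier X" and c: "c \<ge> 0"
    and Q: "Q {0 :: 'j \<Rightarrow> complex} (\<lambda>_ _. 0) (\<lambda>_ _. 0)"
    and le: "\<And>(H :: ('j \<Rightarrow> complex) set) ip \<pi> A x. \<lbrakk>covariant_representation fscale H ip X \<sigma> \<pi> A; Q H ip A; x \<in> H\<rbrakk>
      \<Longrightarrow> hnorm ip (rep_apply \<pi> A F x) \<le> c * hnorm ip x"
  shows "Sup {opnorm H ip (rep_apply \<pi> A F) |(H :: ('j \<Rightarrow> complex) set) ip \<pi> A.
     covariant_representation fscale H ip X \<sigma> \<pi> A \<and> Q H ip A} \<le> c"
proof (rule cSup_least)
  show "{opnorm H ip (rep_apply \<pi> A F) |(H :: ('j \<Rightarrow> complex) set) ip \<pi> A.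
     covariant_representation fscale H ip X \<sigma> \<pi> A \<and> Q H ip A} \<noteq> {}"
    using zero_representation Q by blast
  fix r assume "r \<in> {opnorm H ip (rep_apply \<pi> A F) |(H :: ('j \<Rightarrow> complex) set) ip \<pi> A.
     covariant_representation fscale H ip X \<sigma> \<pi> A \<and> Q H ip A}"
  then obtain H :: "('j \<Rightarrow> complex) set" and ip \<pi> A where r: "r = opnorm H ip (rep_apply \<pi> A F)"
    and rep: "covariant_representation fscale H ip X \<sigma> \<pi> A" "Q H ip A" by blast
  interpret covariant_representation fscale H ip X \<sigma> \<pi> A by (rule rep(1))
  show "r \<le> c" unfolding r opnorm_def
  proof (rule cSup_least)
    have "hnorm ip (rep_apply \<pi> A F 0) \<in> {hnorm ip (rep_apply \<pi> A F x) |x. x \<in> H \<and> hnorm ip x \<le> 1}"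
      using zero_in hnorm_zero by fastforce
    then show "{hnorm ip (rep_apply \<pi> A F x) |x. x \<in> H \<and> hnorm ip x \<le> 1} \<noteq> {}" by blast
    fix q assume "q \<in> {hnorm ip (rep_apply \<pi> A F x) |x. x \<in> H \<and> hnorm ip x \<le> 1}"
    then obtain x where x: "x \<in> H" "hnorm ip x \<le> 1" "q = hnorm ip (rep_apply \<pi> A F x)" by blast
    have "q \<le> c * hnorm ip x" using le[OF rep x(1)] x(3) by simp
    also have "\<dots> \<le> c" using c x(2) by (simp add: mult_left_le)
    finally show "q \<le> c" .
  qed
qed

context covariant_representation
begin

lemma scale_representation: "covariant_representation sc H ip X \<sigma> \<pi> (\<lambda>i x. sc z (A i x))"
proof
  fix i
  obtain B where B: "\<And>x. x \<in> H \<Longrightarrow> hnorm ip (A i x) \<le> B * hnorm ip x"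
    using bounded_operator_pos[OF A_bounded] by blast
  have "hnorm ip (sc z (A i x)) \<le> (cmod z * B) * hnorm ip x" if "x \<in> H" for x
    using mult_left_mono[OF B[OF that], of "cmod z"] that by (simp add: hnorm_scale A_in mult.assoc)
  then show "bounded_operator sc H ip (\<lambda>x. sc z (A i x))"
    unfolding bounded_operator_def using bounded_operator_lin(1-3)[OF A_bounded]
    by (intro conjI exI[of _ "cmod z * B"]) (auto simp: scale_in scale_right_distrib mult.commute)
  show "\<pi> f (sc z (A i x)) = sc z (A i (\<pi> (pullback X (\<sigma> i) f) x))" if "f \<in> C0 X" "x \<in> H" for f x
    using that by (simp add: bounded_operator_lin(3)[OF rep_bounded] A_in covariance)
qed (use rep_bounded rep_add rep_scale rep_mult rep_star in auto)

lemma rep_apply_dilate: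
  assumes F: "F \<in> cov_carrier X" and x: "x \<in> H"
  shows "rep_apply \<pi> (\<lambda>i x. sc z (A i x)) F x = rep_apply \<pi> A (\<lambda>w t. z ^ length w * F w t) x"
proof -
  have w: "comp_word (\<lambda>i x. sc z (A i x)) w y = sc (z ^ length w) (comp_word A w y)" if "y \<in> H" for w y
    using that by (induction w) (auto simp: bounded_operator_lin(3)[OF A_bounded] word_in)
  have "rep_apply \<pi> A (\<lambda>w t. z ^ length w * F w t) x
      = (\<Sum>w | F w \<noteq> 0. comp_word A w (\<pi> (\<lambda>t. z ^ length w * F w t) x))"
    by (intro rep_apply_superset finite_support[OF F] x) auto
  then show ?thesis
    using F x by (simp add: rep_apply_def w pi_in cov_carrier_C0 rep_scale word_scale)
qed

lemma contractive_scale: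
  assumes "contractive H ip A" "cmod z \<le> 1" shows "contractive H ip (\<lambda>i x. sc z (A i x))"
  unfolding contractive_def
proof (intro allI ballI)
  fix i x assume x: "x \<in> H"
  have "cmod z * hnorm ip (A i x) \<le> hnorm ip (A i x)"
    using assms(2) x by (simp add: mult_left_le_one_le hnorm_nonneg A_in)
  then show "hnorm ip (sc z (A i x)) \<le> hnorm ip x"
    using assms(1) x by (simp add: hnorm_scale A_in contractive_def) (meson order_trans)
qed

lemma row_contractive_scale:
  assumes A: "row_contractive H ip A" and z: "cmod z \<le> 1" shows "row_contractive H ip (\<lambda>i x. sc z (A i x))"
  unfolding row_contractive_def
proof (intro allI impI)
  fix x :: "'n \<Rightarrow> 'v" assume x: "range x \<subseteq> H"
  let ?y = "\<Sum>i\<in>UNIV. A i (x i)"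
  have y: "?y \<in> H" using x by (intro subspace_sum[OF subspace_H] A_in) auto
  have "hnorm ip (\<Sum>i\<in>UNIV. sc z (A i (x i))) = cmod z * hnorm ip ?y"
    by (simp add: scale_sum_right[symmetric] hnorm_scale[OF y])
  also have "\<dots> \<le> hnorm ip ?y" using z by (simp add: mult_left_le_one_le hnorm_nonneg[OF y])
  finally have "(hnorm ip (\<Sum>i\<in>UNIV. sc z (A i (x i))))\<^sup>2 \<le> (hnorm ip ?y)\<^sup>2"
    using y x by (intro power_mono hnorm_nonneg subspace_sum[OF subspace_H] scale_in A_in) auto
  then show "(hnorm ip (\<Sum>i\<in>UNIV. sc z (A i (x i))))\<^sup>2 \<le> (\<Sum>i\<in>UNIV. (hnorm ip (x i))\<^sup>2)"
    using A x unfolding row_contractive_def by (meson order_trans)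
qed

end

text \<open>What the tensor algebra norm and the semicrossed product norm have in common. The property
  \<open>Q\<close> selects the admissible representations; \<open>norm_upper\<close> and \<open>norm_least\<close> say that \<open>N\<close> is the supremum
  over them.\<close>
locale covariance_norm =
  fixes X :: "'a topology" and \<sigma> :: "'n::finite \<Rightarrow> 'a \<Rightarrow> 'a"
    and N :: "('n list \<Rightarrow> 'a \<Rightarrow> complex) \<Rightarrow> real"
    and Q :: "('a, 'n) repspace set \<Rightarrow> (('a, 'n) repspace \<Rightarrow> ('a, 'n) repspace \<Rightarrow> complex)
      \<Rightarrow> ('n \<Rightarrow> ('a, 'n) repspace \<Rightarrow> ('a, 'n) repspace) \<Rightarrow> bool"
  assumes system: "multivariable_system X \<sigma>"
    and Q_contractive: "\<lbrakk>covariant_representation fscale H ip X \<sigma> \<pi> A; Q H ip A\<rbrakk> \<Longrightarrow> contractive H ip A"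
    and Q_scale: "\<lbrakk>covariant_representation fscale H ip X \<sigma> \<pi> A; Q H ip A; cmod z \<le> 1\<rbrakk>
      \<Longrightarrow> Q H ip (\<lambda>i x. fscale z (A i x))"
    and norm_upper: "\<lbrakk>F \<in> cov_carrier X; covariant_representation fscale H ip X \<sigma> \<pi> A; Q H ip A; x \<in> H\<rbrakk>
      \<Longrightarrow> hnorm ip (rep_apply \<pi> A F x) \<le> N F * hnorm ip x"
    and norm_least: "\<lbrakk>F \<in> cov_carrier X; c \<ge> 0;
      \<And>H ip \<pi> A x. \<lbrakk>covariant_representation fscale H ip X \<sigma> \<pi> A; Q H ip A; x \<in> H\<rbrakk>
        \<Longrightarrow> hnorm ip (rep_apply \<pi> A F x) \<le> c * hnorm ip x\<rbrakk> \<Longrightarrow> N F \<le> c"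
    and norm_coefficient: "F \<in> cov_carrier X \<Longrightarrow> cmod (F w t) \<le> N F"

lemma covariance_norm_tensor:
  fixes X :: "'a topology" and \<sigma> :: "'n::finite \<Rightarrow> 'a \<Rightarrow> 'a"
  assumes X: "multivariable_system X \<sigma>"
  shows "covariance_norm X \<sigma> (tensor_norm X \<sigma>) row_contractive"
proof
  show "tensor_norm X \<sigma> F \<le> c"
    if "F \<in> cov_carrier X" "c \<ge> 0"
      "\<And>(H :: ('a, 'n) repspace set) ip \<pi> A x. \<lbrakk>covariant_representation fscale H ip X \<sigma> \<pi> A; row_contractive H ip A; x \<in> H\<rbrakk>
        \<Longrightarrow> hnorm ip (rep_apply \<pi> A F x) \<le> c * hnorm ip x" for F c
    unfolding tensor_norm_def
    by (rule Sup_opnorm_le) (use that in \<open>auto simp: row_contractive_def hnorm_def\<close>)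
  show "cmod (F w t) \<le> tensor_norm X \<sigma> F" if F: "F \<in> cov_carrier X" for F :: "'n list \<Rightarrow> 'a \<Rightarrow> complex" and w t
    by (rule coefficient_le[OF X F], rule tensor_norm_universal[OF X F fock_representation[OF X] fock_row_contractive])
      (simp add: fock_space_def)
qed (use X in \<open>auto intro: covariant_representation.row_contractive_imp_contractive
      covariant_representation.row_contractive_scale tensor_norm_universal\<close>)

lemma covariance_norm_semicrossed:
  fixes X :: "'a topology" and \<sigma> :: "'n::finite \<Rightarrow> 'a \<Rightarrow> 'a"
  assumes X: "multivariable_system X \<sigma>"
  shows "covariance_norm X \<sigma> (semicrossed_norm X \<sigma>) contractive"
proof
  show "semicrossed_norm X \<sigma> F \<le> c"
    if "F \<in> cov_carrier X" "c \<ge> 0"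
      "\<And>(H :: ('a, 'n) repspace set) ip \<pi> A x. \<lbrakk>covariant_representation fscale H ip X \<sigma> \<pi> A; contractive H ip A; x \<in> H\<rbrakk>
        \<Longrightarrow> hnorm ip (rep_apply \<pi> A F x) \<le> c * hnorm ip x" for F c
    unfolding semicrossed_norm_def
    by (rule Sup_opnorm_le) (use that in \<open>auto simp: contractive_def hnorm_def\<close>)
  show "cmod (F w t) \<le> semicrossed_norm X \<sigma> F" if F: "F \<in> cov_carrier X" for F :: "'n list \<Rightarrow> 'a \<Rightarrow> complex" and w t
    by (rule coefficient_le[OF X F], rule semicrossed_norm_universal[OF X F fock_representation[OF X]
          covariant_representation.row_contractive_imp_contractive[OF fock_representation[OF X] fock_row_contractive]])
      (simp add: fock_space_def)
qed (use X in \<open>auto intro: covariant_representation.contractive_scale semicrossed_norm_universal\<close>)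

section \<open>Fourier coefficients separate the points of the completion\<close>

text \<open>Fourier multipliers that depend on the degree only. Powers of \<open>z\<close> give the dilation \<open>A \<mapsto> z A\<close>,
  the indicator of \<open>d\<close> gives the homogeneous component of degree \<open>d\<close>.\<close>
definition weight :: "(nat \<Rightarrow> complex) \<Rightarrow> ('n list \<Rightarrow> 'a \<Rightarrow> complex) \<Rightarrow> 'n list \<Rightarrow> 'a \<Rightarrow> complex" where
  "weight c F = (\<lambda>w t. c (length w) * F w t)"

abbreviation component :: "nat \<Rightarrow> ('n list \<Rightarrow> 'a \<Rightarrow> complex) \<Rightarrow> 'n list \<Rightarrow> 'a \<Rightarrow> complex" where
  "component d \<equiv> weight (\<lambda>e. if e = d then 1 else 0)"

lemma weight_in [simp]: "F \<in> cov_carrier X \<Longrightarrow> weight c F \<in> cov_carrier X"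
  unfolding weight_def by (rule cov_weight)

lemma cov_diff: "F \<in> cov_carrier X \<Longrightarrow> G \<in> cov_carrier X \<Longrightarrow> F - G \<in> cov_carrier X"
  using cov_add[OF _ cov_weight[of G X "\<lambda>_. -1"], of F] by (simp add: fun_diff_def plus_fun_def)

lemma cov_zero: "0 \<in> cov_carrier X"
  by (rule cov_carrierI[of "{}"]) (auto simp: C0_0)

lemma cov_sum: "(\<And>i. i \<in> I \<Longrightarrow> G i \<in> cov_carrier X) \<Longrightarrow> sum G I \<in> cov_carrier X"
  by (induction I rule: infinite_finite_induct) (auto simp: cov_zero intro: cov_add)

lemma degree_bound:
  assumes "F \<in> cov_carrier X"
  obtains m where "d < m" "\<And>w. F w \<noteq> 0 \<Longrightarrow> length w < m"
proof -
  have "finite (insert d (length ` {w. F w \<noteq> 0}))" using finite_support[OF assms] by simp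
  then obtain m where "\<forall>k\<in>insert d (length ` {w. F w \<noteq> 0}). k < m" using finite_nat_set_iff_bounded by blast
  then show thesis using that by blast
qed

lemma root_of_unity_orthogonality:
  assumes m: "d < m" "e < m"
  defines "z \<equiv> \<lambda>k. cis (2 * pi * real k / real m)"
  shows "(\<Sum>k<m. inverse (z k ^ d) / of_nat m * z k ^ e) = (if e = d then 1 else 0)"
proof -
  define q where "q = z e / z d"
  have z0: "z k \<noteq> 0" for k by (simp add: z_def)
  have swap: "z k ^ e = z e ^ k" for k e by (simp add: z_def Complex.DeMoivre mult_ac)
  have "inverse (z k ^ d) * z k ^ e = q ^ k" for k
    by (simp add: swap q_def power_divide field_simps z0)
  then have sum: "(\<Sum>k<m. inverse (z k ^ d) / of_nat m * z k ^ e) = (\<Sum>k<m. q ^ k) / of_nat m"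
    by (simp add: sum_divide_distrib)
  show ?thesis
  proof (cases "e = d")
    case True
    then have "q = 1" using z0 by (simp add: q_def)
    then show ?thesis unfolding sum using m True by simp
  next
    case False
    have bij: "bij_betw z {..<m} {z. z ^ m = 1}"
      unfolding z_def by (rule Complex.bij_betw_roots_unity) (use m in simp)
    have "z e \<noteq> z d" using bij_betw_imp_inj_on[OF bij] m False by (auto dest: inj_onD)
    then have "q \<noteq> 1" using z0 by (simp add: q_def)
    moreover have "z e ^ m = 1" "z d ^ m = 1" using bij m by (auto simp: bij_betw_def)
    then have "q ^ m = 1" by (simp add: q_def power_divide)
    ultimately have "(\<Sum>k<m. q ^ k) = 0" by (simp add: geometric_sum)
    then show ?thesis unfolding sum using False by simp
  qed
qed

context covariance_norm
begin

lemma N_nonneg: "F \<in> cov_carrier X \<Longrightarrow> 0 \<le> N F"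
  using norm_coefficient norm_ge_zero order_trans by blast

lemma N_add: assumes F: "F \<in> cov_carrier X" and G: "G \<in> cov_carrier X"
  shows "N (F + G) \<le> N F + N G"
proof (rule norm_least[OF cov_add[OF F G]])
  show "0 \<le> N F + N G" using F G by (simp add: N_nonneg)
  fix H ip \<pi> A x assume r: "covariant_representation fscale H ip X \<sigma> \<pi> A" "Q H ip A" "x \<in> H"
  interpret covariant_representation fscale H ip X \<sigma> \<pi> A by (rule r)
  have "hnorm ip (rep_apply \<pi> A F x + rep_apply \<pi> A G x) \<le> hnorm ip (rep_apply \<pi> A F x) + hnorm ip (rep_apply \<pi> A G x)"
    by (intro hnorm_triangle rep_apply_in F G r)
  also have "\<dots> \<le> N F * hnorm ip x + N G * hnorm ip x" by (intro add_mono norm_upper[OF F r] norm_upper[OF G r])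
  finally show "hnorm ip (rep_apply \<pi> A (F + G) x) \<le> (N F + N G) * hnorm ip x"
    by (simp only: rep_apply_add[OF F G r(3)] distrib_right)
qed

lemma N_scale_le: assumes F: "F \<in> cov_carrier X" shows "N (\<lambda>w t. c * F w t) \<le> cmod c * N F"
proof (rule norm_least[OF cov_weight[OF F]])
  show "0 \<le> cmod c * N F" using F by (simp add: N_nonneg)
  fix H ip \<pi> A x assume r: "covariant_representation fscale H ip X \<sigma> \<pi> A" "Q H ip A" "x \<in> H"
  interpret covariant_representation fscale H ip X \<sigma> \<pi> A by (rule r)
  have "cmod c * hnorm ip (rep_apply \<pi> A F x) \<le> cmod c * (N F * hnorm ip x)"
    by (intro mult_left_mono norm_upper[OF F r]) auto
  then show "hnorm ip (rep_apply \<pi> A (\<lambda>w t. c * F w t) x) \<le> cmod c * N F * hnorm ip x"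
    by (simp add: rep_apply_scale_left[OF F r(3)] hnorm_scale rep_apply_in F r(3) mult.assoc)
qed

lemma N_scale: assumes F: "F \<in> cov_carrier X" shows "N (\<lambda>w t. c * F w t) = cmod c * N F"
proof (cases "c = 0")
  case True
  then show ?thesis using N_scale_le[OF F, of c] N_nonneg[OF cov_weight[OF F, of "\<lambda>_. c"]] by simp
next
  case False
  then have "N F \<le> cmod (inverse c) * N (\<lambda>w t. c * F w t)"
    using N_scale_le[OF cov_weight[OF F, of "\<lambda>_. c"], of "inverse c"] by (simp add: mult.assoc[symmetric])
  then have "cmod c * N F \<le> N (\<lambda>w t. c * F w t)" using False by (simp add: norm_inverse norm_divide field_simps)
  then show ?thesis using N_scale_le[OF F, of c] by simp
qed

lemma N_mult: assumes F: "F \<in> cov_carrier X" and G: "G \<in> cov_carrier X"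
  shows "N (cov_mult X \<sigma> F G) \<le> N F * N G"
proof (rule norm_least[OF cov_mult_in[OF system F G]])
  show "0 \<le> N F * N G" using F G by (simp add: N_nonneg)
  fix H ip \<pi> A x assume r: "covariant_representation fscale H ip X \<sigma> \<pi> A" "Q H ip A" "x \<in> H"
  interpret covariant_representation fscale H ip X \<sigma> \<pi> A by (rule r)
  have "hnorm ip (rep_apply \<pi> A F (rep_apply \<pi> A G x)) \<le> N F * hnorm ip (rep_apply \<pi> A G x)"
    by (rule norm_upper[OF F r(1,2) rep_apply_in[OF G r(3)]])
  also have "\<dots> \<le> N F * (N G * hnorm ip x)" by (intro mult_left_mono norm_upper[OF G r] N_nonneg F)
  finally show "hnorm ip (rep_apply \<pi> A (cov_mult X \<sigma> F G) x) \<le> N F * N G * hnorm ip x"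
    by (simp add: rep_apply_mult[OF system F G r(3)] mult.assoc)
qed

text \<open>Scaling the operators \<open>A\<^sub>i\<close> by \<open>z\<close> turns an admissible representation into an admissible one.\<close>
lemma N_dilate: assumes F: "F \<in> cov_carrier X" and z: "cmod z \<le> 1"
  shows "N (weight (\<lambda>d. z ^ d) F) \<le> N F"
proof (rule norm_least[OF weight_in[OF F] N_nonneg[OF F]])
  fix H ip \<pi> A x assume r: "covariant_representation fscale H ip X \<sigma> \<pi> A" "Q H ip A" "x \<in> H"
  interpret covariant_representation fscale H ip X \<sigma> \<pi> A by (rule r)
  show "hnorm ip (rep_apply \<pi> A (weight (\<lambda>d. z ^ d) F) x) \<le> N F * hnorm ip x"
    using norm_upper[OF F scale_representation Q_scale[OF r(1,2) z] r(3)] rep_apply_dilate[OF F r(3), of z]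
    by (simp add: weight_def)
qed

lemma N_sup_bound:
  assumes F: "F \<in> cov_carrier X" and W: "finite W" "\<And>w. w \<notin> W \<Longrightarrow> F w = 0"
    and M: "M > 0" "\<And>w t. cmod (F w t) \<le> M"
  shows "N F \<le> real (card W) * M"
proof (rule norm_least[OF F])
  show "0 \<le> real (card W) * M" using M by simp
  fix H ip \<pi> A x assume r: "covariant_representation fscale H ip X \<sigma> \<pi> A" "Q H ip A" "x \<in> H"
  interpret covariant_representation fscale H ip X \<sigma> \<pi> A by (rule r)
  have "hnorm ip (rep_apply \<pi> A F x) \<le> (\<Sum>w | F w \<noteq> 0. M) * hnorm ip x"
    by (rule rep_apply_le[OF Q_contractive[OF r(1,2)] F M r(3)])
  also have "\<dots> \<le> real (card W) * M * hnorm ip x"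
  proof -
    have "card {w. F w \<noteq> 0} \<le> card W" using W by (intro card_mono) auto
    then show ?thesis using M(1) by (auto intro!: mult_right_mono hnorm_nonneg r(3))
  qed
  finally show "hnorm ip (rep_apply \<pi> A F x) \<le> real (card W) * M * hnorm ip x" .
qed

abbreviation alg :: "('n list \<Rightarrow> 'a \<Rightarrow> complex) normed_alg" where
  "alg \<equiv> covariance_algebra X \<sigma> N"

sublocale seminormed_algebra alg
proof
  show "acarrier alg \<noteq> {}" using cov_zero[of X] by (auto simp: covariance_algebra_def)
qed (auto simp: covariance_algebra_def cov_add cov_weight cov_mult_in system cov_mult_add_right cov_mult_add_left
    cov_mult_scale_left cov_mult_scale_right N_scale N_add N_mult fun_eq_iff algebra_simps)

lemma alg_carrier [simp]: "acarrier alg = cov_carrier X"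
  and alg_norm [simp]: "anorm alg = N"
  and alg_mult [simp]: "amult alg = cov_mult X \<sigma>"
  by (simp_all add: covariance_algebra_def)

lemma alg_dist: "F \<in> cov_carrier X \<Longrightarrow> G \<in> cov_carrier X \<Longrightarrow> adist alg F G = N (F - G)"
  by (simp add: adist_def covariance_algebra_def fun_diff_def plus_fun_def)

lemma N_zero: "N 0 = 0"
  using N_scale[OF cov_zero, of 0] by (simp add: zero_fun_def)

lemma N_sum: "(\<And>i. i \<in> I \<Longrightarrow> G i \<in> cov_carrier X) \<Longrightarrow> N (sum G I) \<le> (\<Sum>i\<in>I. N (G i))"
proof (induction I rule: infinite_finite_induct)
  case (insert i I)
  have "N (G i + sum G I) \<le> N (G i) + N (sum G I)" using insert by (intro N_add cov_sum) auto
  then show ?case using insert by (auto simp del: plus_fun_apply)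
qed (auto simp: N_zero)

text \<open>A homogeneous component is an average of rotations \<open>A \<mapsto> \<zeta> A\<close> over roots of unity \<open>\<zeta>\<close>. As \<open>F\<close> has
  finitely many degrees, roots of one order suffice.\<close>
lemma N_component:
  assumes F: "F \<in> cov_carrier X" shows "N (component d F) \<le> N F"
proof -
  obtain m where m: "d < m" "\<And>w. F w \<noteq> 0 \<Longrightarrow> length w < m" using degree_bound[OF F] by blast
  define z where "z k = cis (2 * pi * real k / real m)" for k
  define G where "G k = (\<lambda>w t. inverse (z k ^ d) / of_nat m * weight (\<lambda>e. z k ^ e) F w t)" for k
  have G: "G k \<in> cov_carrier X" for k unfolding G_def by (intro cov_weight weight_in F)
  have "component d F w t = (\<Sum>k<m. G k) w t" for w t
  proof (cases "F w = 0")
    case True then show ?thesis by (simp add: weight_def G_def sum_fun_apply)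
  next
    case False
    have "(\<Sum>k<m. G k) w t = (\<Sum>k<m. inverse (z k ^ d) / of_nat m * z k ^ length w) * F w t"
      by (simp add: sum_fun_apply G_def weight_def sum_distrib_right mult.assoc)
    also have "\<dots> = (if length w = d then 1 else 0) * F w t"
      using root_of_unity_orthogonality[OF m(1) m(2)[OF False]] by (simp add: z_def)
    finally show ?thesis by (simp add: weight_def)
  qed
  then have "component d F = (\<Sum>k<m. G k)" by blast
  then have "N (component d F) \<le> (\<Sum>k<m. N (G k))" using N_sum[of "{..<m}" G] G by simp
  also have "\<dots> \<le> (\<Sum>k<m. N F / real m)"
  proof (rule sum_mono)
    fix k
    have "N (G k) = 1 / real m * N (weight (\<lambda>e. z k ^ e) F)"
      unfolding G_def N_scale[OF weight_in[OF F]] by (simp add: norm_divide norm_inverse norm_power z_def)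
    also have "\<dots> \<le> 1 / real m * N F" by (intro mult_left_mono N_dilate F) (auto simp: z_def)
    finally show "N (G k) \<le> N F / real m" by simp
  qed
  also have "\<dots> = N F" using m(1) by simp
  finally show ?thesis .
qed

lemma N_weight:
  assumes F: "F \<in> cov_carrier X" and m: "\<And>w. F w \<noteq> 0 \<Longrightarrow> length w < m"
  shows "N (weight c F) \<le> (\<Sum>d<m. cmod (c d) * N (component d F))"
proof -
  define G where "G d = (\<lambda>w t. c d * component d F w t)" for d
  have G: "G d \<in> cov_carrier X" for d unfolding G_def by (intro cov_weight weight_in F)
  have "weight c F w t = (\<Sum>d<m. G d) w t" for w t
  proof (cases "F w = 0")
    case True then show ?thesis by (simp add: weight_def G_def sum_fun_apply)
  next
    case False
    have "(\<Sum>d<m. G d w t) = (\<Sum>d<m. if d = length w then c d * F w t else 0)"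
      by (intro sum.cong) (auto simp: G_def weight_def)
    then show ?thesis using m[OF False] by (simp add: sum_fun_apply weight_def)
  qed
  then have "weight c F = (\<Sum>d<m. G d)" by blast
  then show ?thesis using N_sum[of "{..<m}" G] G F by (simp add: G_def N_scale)
qed

text \<open>The coefficients converge pointwise to \<open>0\<close> and are uniformly Cauchy, hence converge
  uniformly; there are only finitely many words of length \<open>d\<close>.\<close>
lemma component_tendsto_0:
  assumes s: "s \<in> cauchy_seqs alg" and lim: "\<And>w t. (\<lambda>j. s j w t) \<longlonglongrightarrow> 0"
  shows "(\<lambda>j. N (component d (s j))) \<longlonglongrightarrow> 0"
proof (rule LIMSEQ_I)
  fix \<epsilon> :: real assume e: "\<epsilon> > 0"
  have sc: "s j \<in> cov_carrier X" for j using cauchy_seqs_in[OF s] by simp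
  let ?W = "{w :: 'n list. length w = d}"
  have W: "finite ?W" by (rule finite_subset[OF _ finite_words[of d]]) auto
  define \<delta> where "\<delta> = \<epsilon> / (real (card ?W) + 1)"
  have d: "\<delta> > 0" using e by (simp add: \<delta>_def add_nonneg_pos)
  obtain J where J: "\<And>j k. j \<ge> J \<Longrightarrow> k \<ge> J \<Longrightarrow> adist alg (s j) (s k) < \<delta>"
    using cauchy_seqsD[OF s d] by blast
  have unif: "cmod (s j w t) \<le> \<delta>" if "j \<ge> J" for j w t
  proof (rule LIMSEQ_le_const2)
    show "(\<lambda>k. cmod (s j w t - s k w t)) \<longlonglongrightarrow> cmod (s j w t)"
      using tendsto_norm[OF tendsto_diff[OF tendsto_const lim[of w t], of "s j w t"]] by simp
    have "cmod (s j w t - s k w t) \<le> \<delta>" if "k \<ge> J" for k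
      using norm_coefficient[OF cov_diff[OF sc[of j] sc[of k]], of w t] J[OF \<open>j \<ge> J\<close> that]
      by (simp add: alg_dist sc)
    then show "\<exists>K. \<forall>k\<ge>K. cmod (s j w t - s k w t) \<le> \<delta>" by blast
  qed
  have "N (component d (s j)) < \<epsilon>" if "j \<ge> J" for j
  proof -
    have "N (component d (s j)) \<le> real (card ?W) * \<delta>"
      using unif[OF that] d by (intro N_sup_bound weight_in sc W) (auto simp: weight_def fun_eq_iff)
    also have "\<dots> < (real (card ?W) + 1) * \<delta>" using d by simp
    also have "\<dots> = \<epsilon>" by (simp add: \<delta>_def)
    finally show ?thesis .
  qed
  then show "\<exists>J. \<forall>j\<ge>J. norm (N (component d (s j)) - 0) < \<epsilon>"
    using N_nonneg[OF weight_in[OF sc]] by (intro exI[of _ J]) simp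
qed

text \<open>All components tend to \<open>0\<close> and are bounded by a common constant \<open>B\<close>, so the series of the
  components damped by \<open>r\<^sup>d\<close> is dominated by \<open>B r\<^sup>d\<close> and Tannery's theorem applies.\<close>
lemma dilation_tendsto_0:
  assumes s: "s \<in> cauchy_seqs alg" and lim: "\<And>w t. (\<lambda>j. s j w t) \<longlonglongrightarrow> 0"
    and r: "0 \<le> r" "r < 1"
  shows "(\<lambda>j. N (weight (\<lambda>d. of_real r ^ d) (s j))) \<longlonglongrightarrow> 0"
proof -
  have sc: "s j \<in> cov_carrier X" for j using cauchy_seqs_in[OF s] by simp
  obtain B where B: "\<And>j. N (s j) \<le> B" using cauchy_seqs_bounded[OF s] by auto
  define a where "a d j = r ^ d * N (component d (s j))" for d j
  have a: "0 \<le> a d j" "a d j \<le> B * r ^ d" for d j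
  proof -
    show "0 \<le> a d j" using r sc by (simp add: a_def N_nonneg)
    have "N (component d (s j)) \<le> B" using N_component[OF sc] B order_trans by blast
    then show "a d j \<le> B * r ^ d" using r by (simp add: a_def mult.commute[of B] mult_left_mono)
  qed
  have sB: "summable (\<lambda>d. B * r ^ d)" using r by (intro summable_mult summable_geometric) auto
  have sa: "summable (\<lambda>d. a d j)" for j by (rule summable_comparison_test'[OF sB]) (use a in auto)
  have le: "N (weight (\<lambda>d. of_real r ^ d) (s j)) \<le> (\<Sum>d. a d j)" for j
  proof -
    obtain m where m: "\<And>w. s j w \<noteq> 0 \<Longrightarrow> length w < m" using degree_bound[OF sc] by blast
    have "N (weight (\<lambda>d. of_real r ^ d) (s j)) \<le> (\<Sum>d<m. a d j)"
      using N_weight[OF sc m, where c = "\<lambda>d. of_real r ^ d"] r by (simp add: a_def norm_power)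
    also have "\<dots> \<le> (\<Sum>d. a d j)" by (rule sum_le_suminf[OF sa]) (use a in auto)
    finally show ?thesis .
  qed
  have "(\<lambda>j. \<Sum>d. a d j) \<longlonglongrightarrow> (\<Sum>d. 0)"
  proof -
    have "\<forall>\<^sub>F (d, j) in at_top \<times>\<^sub>F sequentially. norm (a d j) \<le> B * r ^ d"
      using a by (intro always_eventually) auto
    moreover have "(\<lambda>j. a d j) \<longlonglongrightarrow> 0" for d
      unfolding a_def by (intro tendsto_mult_right_zero component_tendsto_0 s lim)
    ultimately show ?thesis using tannerys_theorem[of a "\<lambda>_. 0" sequentially, OF _ _ sB] by simp
  qed
  then show ?thesis by (intro squeeze_null[OF _ N_nonneg[OF weight_in[OF sc]] le]) simp
qed

text \<open>Abel summation. The dilations \<open>P\<^sub>r\<close> are contractions, and \<open>P\<^sub>r F \<rightarrow> F\<close> as \<open>r \<rightarrow> 1\<close> for each fixed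
  finite sum \<open>F\<close>. Taking for \<open>F\<close> a late member of the sequence, \<open>P\<^sub>r\<close> moves all later members by
  little, and it sends the sequence to \<open>0\<close>.\<close>
lemma coefficients_separate:
  assumes s: "s \<in> cauchy_seqs alg" and lim: "\<And>w t. (\<lambda>j. s j w t) \<longlonglongrightarrow> 0"
  shows "(\<lambda>j. N (s j)) \<longlonglongrightarrow> 0"
proof (rule LIMSEQ_I)
  fix \<epsilon> :: real assume "\<epsilon> > 0"
  then have e: "\<epsilon> / 4 > 0" by simp
  have sc: "s j \<in> cov_carrier X" for j using cauchy_seqs_in[OF s] by simp
  obtain J where J: "\<And>j k. j \<ge> J \<Longrightarrow> k \<ge> J \<Longrightarrow> adist alg (s j) (s k) < \<epsilon> / 4"
    using cauchy_seqsD[OF s e] by blast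
  define F where "F = s J"
  have F: "F \<in> cov_carrier X" by (simp add: F_def sc)
  obtain m where m: "\<And>w. F w \<noteq> 0 \<Longrightarrow> length w < m" using degree_bound[OF F] by blast
  define h where "h r = (\<Sum>d<m. \<bar>1 - r ^ d\<bar> * N (component d F))" for r :: real
  have "(h \<longlongrightarrow> (\<Sum>d<m. \<bar>1 - 1 ^ d\<bar> * N (component d F))) (at_left 1)"
    unfolding h_def by (intro tendsto_intros)
  then have "(h \<longlongrightarrow> 0) (at_left 1)" by simp
  then have "\<forall>\<^sub>F r in at_left 1. h r < \<epsilon> / 4 \<and> r \<in> {0<..<1}"
    using e by (intro eventually_conj order_tendstoD(2) eventually_at_left_real) auto
  then obtain r where r: "h r < \<epsilon> / 4" "0 < r" "r < 1"
    using eventually_happens'[OF trivial_limit_at_left_real[of 1]] by auto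
  let ?P = "weight (\<lambda>d. of_real r ^ d :: complex)"
  have Fr: "N (F - ?P F) < \<epsilon> / 4"
  proof -
    have "F - ?P F = weight (\<lambda>d. 1 - of_real r ^ d) F" by (auto simp: weight_def fun_eq_iff algebra_simps)
    moreover have "cmod (1 - of_real r ^ d) = \<bar>1 - r ^ d\<bar>" for d
      by (metis norm_of_real of_real_1 of_real_diff of_real_power)
    ultimately show ?thesis using N_weight[OF F m, where c = "\<lambda>d. 1 - of_real r ^ d"] r(1) by (simp add: h_def)
  qed
  obtain J' where J': "\<And>j. j \<ge> J' \<Longrightarrow> N (?P (s j)) < \<epsilon> / 4"
    using order_tendstoD(2)[OF dilation_tendsto_0[OF s lim less_imp_le[OF r(2)] r(3)] e]
    by (auto simp: eventually_sequentially)
  have "N (s j) < \<epsilon>" if "j \<ge> max J J'" for j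
  proof -
    have d: "N (s j - F) < \<epsilon> / 4" "N (F - s j) < \<epsilon> / 4"
      using J[of j J] J[of J j] that by (simp_all add: F_def alg_dist sc)
    \<comment> \<open>\<open>s j\<close> splits into \<open>s j - F\<close>, \<open>F - P\<^sub>r F\<close>, \<open>P\<^sub>r (F - s j)\<close> and \<open>P\<^sub>r (s j)\<close>, each of norm below \<open>\<epsilon> / 4\<close>.\<close>
    have "?P (F - s j) + ?P (s j) = ?P F" by (auto simp: weight_def fun_eq_iff algebra_simps)
    then have "s j = (s j - F) + ((F - ?P F) + (?P (F - s j) + ?P (s j)))" by simp
    then have "N (s j) \<le> N (s j - F) + (N (F - ?P F) + (N (?P (F - s j)) + N (?P (s j))))"
      using N_add[OF cov_diff[OF sc F] cov_add[OF cov_diff[OF F weight_in[OF F]] cov_add[OF weight_in[OF cov_diff[OF F sc]] weight_in[OF sc]]]]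
        N_add[OF cov_diff[OF F weight_in[OF F]] cov_add[OF weight_in[OF cov_diff[OF F sc]] weight_in[OF sc]]]
        N_add[OF weight_in[OF cov_diff[OF F sc]] weight_in[OF sc]]
      by (smt (verit, best))
    moreover have "N (?P (F - s j)) \<le> N (F - s j)"
      using r by (intro N_dilate cov_diff F sc) auto
    ultimately show ?thesis using d Fr J'[of j] that by simp
  qed
  then show "\<exists>J. \<forall>j\<ge>J. norm (N (s j) - 0) < \<epsilon>"
    using N_nonneg[OF sc] by (intro exI[of _ "max J J'"]) simp
qed

end

section \<open>Isomorphisms of the completed covariance algebras\<close>

context covariance_norm
begin

text \<open>The continuous extension to the completion of \<open>F \<mapsto> F w t\<close>; by \<open>coefficient_cls\<close> the value does
  not depend on the representing sequence.\<close>
definition coefficient :: "'n list \<Rightarrow> 'a \<Rightarrow> (nat \<Rightarrow> 'n list \<Rightarrow> 'a \<Rightarrow> complex) set \<Rightarrow> complex" where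
  "coefficient w t P = lim (\<lambda>j. (SOME s. s \<in> cauchy_seqs alg \<and> P = cls s) j w t)"

lemma coefficient_dist:
  assumes "F \<in> cov_carrier X" "G \<in> cov_carrier X"
  shows "cmod (F w t - G w t) \<le> adist alg F G"
  using norm_coefficient[OF cov_diff[OF assms], of w t] by (simp add: alg_dist assms)

lemma coefficient_cls:
  assumes s: "s \<in> cauchy_seqs alg"
  shows "(\<lambda>j. s j w t) \<longlonglongrightarrow> coefficient w t (cls s)"
proof -
  define r where "r = (SOME r. r \<in> cauchy_seqs alg \<and> cls s = cls r)"
  have "r \<in> cauchy_seqs alg \<and> cls s = cls r"
    unfolding r_def by (rule someI[of _ s]) (simp add: s)
  then have r: "r \<in> cauchy_seqs alg" "(s, r) \<in> null_rel alg" using cls_eq_iff[OF s] by auto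
  have in_cov: "s j \<in> cov_carrier X" "r j \<in> cov_carrier X" for j
    using cauchy_seqs_in[OF s] cauchy_seqs_in[OF r(1)] by simp_all
  have "convergent (\<lambda>j. r j w t)"
  proof (rule Cauchy_convergent, rule CauchyI)
    fix \<epsilon> :: real assume "\<epsilon> > 0"
    then obtain J where J: "\<And>j k. j \<ge> J \<Longrightarrow> k \<ge> J \<Longrightarrow> adist alg (r j) (r k) < \<epsilon>"
      using cauchy_seqsD[OF r(1)] by blast
    show "\<exists>J. \<forall>j\<ge>J. \<forall>k\<ge>J. norm (r j w t - r k w t) < \<epsilon>"
      using J coefficient_dist[OF in_cov(2) in_cov(2)] by (meson le_less_trans)
  qed
  then have "(\<lambda>j. r j w t) \<longlonglongrightarrow> coefficient w t (cls s)"
    by (simp add: coefficient_def r_def convergent_LIMSEQ_iff)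
  moreover have "(\<lambda>j. s j w t - r j w t) \<longlonglongrightarrow> 0"
    by (rule Lim_null_comparison[OF always_eventually null_rel_lim[OF r(2)]])
      (use coefficient_dist[OF in_cov] in blast)
  ultimately show ?thesis using tendsto_add by fastforce
qed

lemma coefficient_cls_eqI:
  "s \<in> cauchy_seqs alg \<Longrightarrow> (\<lambda>j. s j w t) \<longlonglongrightarrow> z \<Longrightarrow> coefficient w t (cls s) = z"
  using coefficient_cls LIMSEQ_unique by blast

lemma coefficient_add:
  assumes "P \<in> acarrier (completion alg)" "P' \<in> acarrier (completion alg)"
  shows "coefficient w t (aadd (completion alg) P P') = coefficient w t P + coefficient w t P'"
proof -
  obtain s s' where s: "s \<in> cauchy_seqs alg" "P = cls s" "s' \<in> cauchy_seqs alg" "P' = cls s'"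
    using assms completionE by metis
  have "(\<lambda>j. aadd alg (s j) (s' j) w t) \<longlonglongrightarrow> coefficient w t P + coefficient w t P'"
    using tendsto_add[OF coefficient_cls[OF s(1)] coefficient_cls[OF s(3)]] s
    by (simp add: covariance_algebra_def)
  then show ?thesis
    using coefficient_cls_eqI[OF cauchy_seqs_add[OF s(1,3)]] add_cls[OF s(1,3)] s by simp
qed

lemma coefficient_scale:
  assumes "P \<in> acarrier (completion alg)"
  shows "coefficient w t (ascale (completion alg) c P) = c * coefficient w t P"
proof -
  obtain s where s: "s \<in> cauchy_seqs alg" "P = cls s" using assms by (rule completionE)
  have "(\<lambda>j. ascale alg c (s j) w t) \<longlonglongrightarrow> c * coefficient w t P"
    using tendsto_mult_left[OF coefficient_cls[OF s(1)]] s by (simp add: covariance_algebra_def)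
  then show ?thesis
    using coefficient_cls_eqI[OF cauchy_seqs_scale[OF s(1)]] scale_cls[OF s(1)] s by simp
qed

lemma coefficient_norm:
  assumes "P \<in> acarrier (completion alg)"
  shows "cmod (coefficient w t P) \<le> anorm (completion alg) P"
proof -
  obtain s where s: "s \<in> cauchy_seqs alg" "P = cls s" using assms by (rule completionE)
  have "cmod (s j w t) \<le> anorm alg (s j)" for j
    using norm_coefficient cauchy_seqs_in[OF s(1)] by simp
  then show ?thesis
    unfolding s(2) by (intro LIMSEQ_le[OF tendsto_norm[OF coefficient_cls[OF s(1)]] norm_cls[OF s(1)]]) blast
qed

lemma coefficient_single:
  assumes f: "f \<in> C0 X" and P: "P \<in> acarrier (completion alg)"
  shows "coefficient (v @ w) t (amult (completion alg) (cls (\<lambda>_. single v f)) P)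
      = pullback X (comp_word \<sigma> w) f t * coefficient w t P"
    and "length u < length v \<Longrightarrow> coefficient u t (amult (completion alg) (cls (\<lambda>_. single v f)) P) = 0"
proof -
  obtain s where s: "s \<in> cauchy_seqs alg" "P = cls s" using P by (rule completionE)
  have v: "(\<lambda>_. single v f) \<in> cauchy_seqs alg" by (rule const_cauchy) (simp add: single_in f)
  note m = mult_cls[OF v s(1)] cauchy_seqs_mult[OF v s(1)]
  have "(\<lambda>j. pullback X (comp_word \<sigma> w) f t * s j w t)
      \<longlonglongrightarrow> pullback X (comp_word \<sigma> w) f t * coefficient w t P"
    unfolding s(2) by (intro tendsto_mult_left coefficient_cls s(1))
  then show "coefficient (v @ w) t (amult (completion alg) (cls (\<lambda>_. single v f)) P)
      = pullback X (comp_word \<sigma> w) f t * coefficient w t P"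
    unfolding s(2) m(1) by (intro coefficient_cls_eqI[OF m(2)]) (simp add: cov_mult_single s(2))
  show "coefficient u t (amult (completion alg) (cls (\<lambda>_. single v f)) P) = 0" if "length u < length v"
    unfolding s(2) m(1) by (intro coefficient_cls_eqI[OF m(2)]) (simp add: cov_mult_single that)
qed

text \<open>Some coefficient of \<open>b\<close>, at a word \<open>w\<close> and a point \<open>p\<close>, is nonzero. For a word \<open>v\<close> longer than
  \<open>w\<close> and a function \<open>f\<close>, left multiplication by \<open>u = s\<^sub>v f\<close> shifts the coefficients at \<open>p\<close> along
  \<open>w, v w, v v w, \<dots>\<close> with weights \<open>f (\<sigma>\<^sub>w p), f (\<sigma>\<^sub>v\<^sub>w p), \<dots>\<close>, so it suffices that \<open>f\<close> has no zero on this
  orbit. The word \<open>v\<close> must be longer than \<open>w\<close> for the coefficient at \<open>w\<close> to vanish on all multiples of \<open>u\<close>.\<close>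
lemma shifted_functionals_separate:
  assumes b: "b \<in> acarrier (completion alg)" "b \<noteq> azero (completion alg)"
  shows "\<exists>u\<in>acarrier (completion alg). \<exists>\<phi>. shifted_functionals (completion alg) u \<phi> \<and> \<phi> 0 b \<noteq> 0"
proof -
  interpret B: banach_algebra "completion alg" by (rule banach_algebra_completion)
  obtain s where s: "s \<in> cauchy_seqs alg" "b = cls s" using b(1) by (rule completionE)
  have sc: "s j \<in> cov_carrier X" for j using cauchy_seqs_in[OF s(1)] by simp
  have "\<exists>w t. coefficient w t b \<noteq> 0"
  proof (rule ccontr)
    assume "\<not> ?thesis"
    then have "(\<lambda>j. s j w t) \<longlonglongrightarrow> 0" for w t using coefficient_cls[OF s(1), of w t] s(2) by simp
    then have "(\<lambda>j. N (s j)) \<longlonglongrightarrow> 0" by (rule coefficients_separate[OF s(1)])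
    then have "anorm (completion alg) b = 0" unfolding s(2) by (intro norm_clsI s(1)) simp
    then show False using B.norm_definite[OF b(1)] b(2) by simp
  qed
  then obtain w p where wp: "coefficient w p b \<noteq> 0" by blast
  have p: "p \<in> topspace X"
  proof (rule ccontr)
    assume "p \<notin> topspace X"
    then have "s j w p = 0" for j using C0_outside[OF cov_carrier_C0[OF sc]] by simp
    then have "coefficient w p b = 0" unfolding s(2) by (intro coefficient_cls_eqI[OF s(1)]) simp
    then show False using wp by simp
  qed
  \<comment> \<open>Only the length of \<open>v\<close> matters, so an arbitrary letter serves.\<close>
  define v :: "'n list" where "v = replicate (Suc (length w)) undefined"
  define ws where "ws k = ((@) v ^^ k) w" for k
  have ws: "ws 0 = w" "ws (Suc k) = v @ ws k" for k by (simp_all add: ws_def)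
  obtain f where f: "f \<in> C0 X" "\<And>k. f (comp_word \<sigma> (ws k) p) \<noteq> 0"
    using C0_nonzero_on_sequence[of X "\<lambda>k. comp_word \<sigma> (ws k) p"] system comp_word_topspace[OF system p]
    by (auto simp: multivariable_system_def)
  define u where "u = cls (\<lambda>_. single v f)"
  have u: "u \<in> acarrier (completion alg)"
    unfolding u_def by (intro cls_in const_cauchy) (simp add: single_in f)
  have "shifted_functionals (completion alg) u (\<lambda>k. coefficient (ws k) p)"
    unfolding shifted_functionals_def
  proof (intro conjI allI ballI)
    show "coefficient (ws 0) p (amult (completion alg) u P) = 0" if "P \<in> acarrier (completion alg)" for P
      unfolding u_def ws(1) by (rule coefficient_single(2)[OF f(1) that]) (simp add: v_def)
    show "\<exists>c. c \<noteq> 0 \<and> (\<forall>P\<in>acarrier (completion alg).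
        coefficient (ws (Suc k)) p (amult (completion alg) u P) = c * coefficient (ws k) p P)" for k
      using f p unfolding u_def ws(2)
      by (intro exI[of _ "pullback X (comp_word \<sigma> (ws k)) f p"]) (simp add: coefficient_single(1) pullback_def)
  qed (auto simp: coefficient_add coefficient_scale coefficient_norm)
  then show ?thesis using u wp ws(1) by (intro bexI[of _ u] exI[of _ "\<lambda>k. coefficient (ws k) p"]) auto
qed

end

lemma completion_isomorphism_continuous:
  assumes "covariance_norm X \<sigma> N Q" and "covariance_norm Y \<tau> N' Q'"
    and "algebra_isomorphism (completion (covariance_algebra X \<sigma> N)) (completion (covariance_algebra Y \<tau> N')) \<gamma>"
  shows "continuous_map (norm_topology (completion (covariance_algebra X \<sigma> N)))
    (norm_topology (completion (covariance_algebra Y \<tau> N'))) \<gamma>"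
proof -
  interpret A: covariance_norm X \<sigma> N Q by fact
  interpret B: covariance_norm Y \<tau> N' Q' by fact
  show ?thesis
    by (rule isomorphism_continuous[OF A.banach_algebra_completion B.banach_algebra_completion assms(3)
          B.shifted_functionals_separate])
qed

theorem corollary3p6:
  fixes X :: "'a topology" and \<sigma> :: "'n::finite \<Rightarrow> 'a \<Rightarrow> 'a"
    and Y :: "'b topology" and \<tau> :: "'n \<Rightarrow> 'b \<Rightarrow> 'b"
  assumes "multivariable_system X \<sigma>" and "multivariable_system Y \<tau>"
  shows "(\<forall>\<gamma>. algebra_isomorphism (tensor_algebra X \<sigma>) (tensor_algebra Y \<tau>) \<gamma> \<longrightarrow>
            continuous_map (norm_topology (tensor_algebra X \<sigma>))
              (norm_topology (tensor_algebra Y \<tau>)) \<gamma>) \<and>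
         (\<forall>\<gamma>. algebra_isomorphism (semicrossed_product X \<sigma>) (semicrossed_product Y \<tau>) \<gamma> \<longrightarrow>
            continuous_map (norm_topology (semicrossed_product X \<sigma>))
              (norm_topology (semicrossed_product Y \<tau>)) \<gamma>)"
  unfolding tensor_algebra_def semicrossed_product_def
  using completion_isomorphism_continuous covariance_norm_tensor[OF assms(1)] covariance_norm_tensor[OF assms(2)]
    covariance_norm_semicrossed[OF assms(1)] covariance_norm_semicrossed[OF assms(2)]
  by blast

end
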